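(* Let $K$ be a cubic field with fundamental discriminant $d_K$ in which $3$ ramifies, and let $F(x,y)=F_K(x,y)=(a,b,c,d)$ be an associated binary cubic form. Define $$f_K(x,y)=\begin{cases}\frac13F(x,3y)&\text{if } b\equiv0\pmod 3,\\ \frac13F(3x,y)&\text{if } c\equiv 0\pmod 3,\\ \frac13F(x,3(y-x))&\text{if } b\equiv -c\pmod 3,\\ \frac13F(x,3(y+x))&\text{if } b\equiv c\pmod 3.\end{cases}$$ Then $\phi_1$ sends the $\mathrm{SL}_2(\mathbb{Z})$-class of $f_K$ in $\mathrm{Cl}(\mathrm{Sym}^3\mathbb{Z}^2;-\frac{d_K}{3})$ to the $\mathrm{SL}_2(\mathbb{Z})$-class of $\frac16 q_K$ in $\mathrm{Cl}^+_{\mathbb{Q}(\sqrt{-d_K/3})}[3]$, where $\frac16 q_K$ is the form $x\mapsto \frac16\mathrm{tr}_{K/\mathbb{Q}}(x^2)$ on $O_K^0$ in the $\mathbb{Z}$-basis $\{\alpha_0,3\beta_0\}$ if $b\equiv 0$, $\{3\alpha_0,\beta_0\}$ if $c\equiv0$, $\{\alpha_0-\beta_0,3\beta_0\}$ if $b\equiv-c$, $\{\alpha_0+\beta_0,3\beta_0\}$ if $b\equiv c\pmod 3$.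
   Context: A fundamental discriminant is the discriminant of a quadratic field. $(a,b,c,d)$ denotes $ax^3+bx^2y+cxy^2+dy^3$. By Delone–Faddeev, $K$ has an associated integral binary cubic form $F_K=(a,b,c,d)$ (unique up to $\mathrm{GL}_2(\mathbb{Z})$) with discriminant $d_K$ such that for a root $\theta$ of $F_K(x,1)$, $K=\mathbb{Q}(\theta)$ and $\{1,-a\theta,d/\theta\}$ is a $\mathbb{Z}$-basis of $O_K$; $\alpha=-a\theta$, $\beta=d/\theta$, $\alpha_0=\alpha-\mathrm{tr}(\alpha)/3$, $\beta_0=\beta-\mathrm{tr}(\beta)/3$, $O_K^0=\{x\in O_K:\mathrm{tr}_{K/\mathbb{Q}}(x)=0\}$. A Gaussian cubic form is an integral binary cubic form $(a_0,3a_1,3a_2,a_3)$ with $a_i\in\mathbb{Z}$. $\mathrm{Cl}(\mathrm{Sym}^3\mathbb{Z}^2;\Delta)$ is the set of $\mathrm{SL}_2(\mathbb{Z})$-classes of Gaussian cubic forms whose associated triply symmetric cube (entries $a_{ijk}=a_{i+j+k}$) has discriminant $\Delta$; the cube discriminant equals $-D/27$ where $D$ is the discriminant of the cubic form. The map $\phi_1$ (Bhargava) sends the class of $(a_0,3a_1,3a_2,a_3)$ to the $\mathrm{SL}_2(\mathbb{Z})$-class of the binary quadratic form $(a_1^2-a_0a_2)x^2+(a_1a_2-a_0a_3)xy+(a_2^2-a_1a_3)y^2$, an element of the $3$-torsion of the narrow class group $\mathrm{Cl}^+_{\mathbb{Q}(\sqrt\Delta)}$ (identified with $\mathrm{SL}_2(\mathbb{Z})$-classes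 of primitive forms of discriminant $\Delta$ under Gauss composition).
   Formalization: In the cases b ≡ −c and b ≡ c (mod 3), f_K is taken to be (1/3)F(x,3y−x) and (1/3)F(x,3y+x) instead of the printed (1/3)F(x,3(y−x)) and (1/3)F(x,3(y+x)), which are never Gaussian cubic forms there (e.g. F=(1,−1,2,1), d_K=−87). *)

theory Defs
  imports
    "HOL-Algebra.Algebraic_Closure_Type"
    "HOL-Algebra.Ideal_Product"
    "HOL-Number_Theory.Cong"
    "Jordan_Normal_Form.Determinant"
begin

section \<open>Number fields\<close>

text \<open>Number fields are subfields of an arbitrary ambient field of characteristic 0.\<close>

interpretation rat_vs: vector_space "\<lambda>(q::rat) (x::'a::field_char_0). of_rat q * x"
  by unfold_locales (simp_all add: algebra_simps of_rat_add of_rat_mult)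

text \<open>Since \<open>dim\<close> is 0 on infinite-dimensional spaces, this has the intended meaning for \<open>n > 0\<close>.\<close>

definition number_field :: "nat \<Rightarrow> 'a::field_char_0 set \<Rightarrow> bool" where
  "number_field n K \<longleftrightarrow> subfield K ring_of_type_algebra \<and> rat_vs.dim K = n"

definition rat_adjoin :: "'a::field_char_0 \<Rightarrow> 'a set" where
  "rat_adjoin \<theta> = {poly (map_poly of_rat p) \<theta> / poly (map_poly of_rat q) \<theta> | p q :: rat poly.
     poly (map_poly of_rat q) \<theta> \<noteq> 0}"

text \<open>The trace of multiplication by \<open>x\<close> on \<open>K\<close>, computed in some basis of \<open>K\<close> over the rationals.\<close>

definition field_trace :: "'a::field_char_0 set \<Rightarrow> 'a \<Rightarrow> rat" where
  "field_trace K x =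
     (let B = (SOME B. rat_vs.independent B \<and> rat_vs.span B = K)
      in \<Sum>b\<in>B. rat_vs.representation B (x * b) b)"

definition ring_of_integers :: "'a::field_char_0 set \<Rightarrow> 'a set" where
  "ring_of_integers K = {x \<in> K. algebraic_int x}"

definition trace_zero_integers :: "'a::field_char_0 set \<Rightarrow> 'a set" where
  "trace_zero_integers K = {x \<in> ring_of_integers K. field_trace K x = 0}"

definition int_basis :: "'a::field_char_0 list \<Rightarrow> 'a set \<Rightarrow> bool" where
  "int_basis ws M \<longleftrightarrow>
     bij_betw (\<lambda>ns::int list. \<Sum>i<length ws. of_int (ns ! i) * ws ! i)
       {ns. length ns = length ws} M"

definition field_disc :: "'a::field_char_0 set \<Rightarrow> int" where
  "field_disc K = (THE D. \<exists>ws. int_basis ws (ring_of_integers K) \<and>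
     of_int D = det (mat (length ws) (length ws) (\<lambda>(i, j). field_trace K (ws ! i * ws ! j))))"

text \<open>Every quadratic field embeds into the complex numbers.\<close>

definition fundamental_discriminant :: "int \<Rightarrow> bool" where
  "fundamental_discriminant D \<longleftrightarrow> (\<exists>L :: complex set. number_field 2 L \<and> field_disc L = D)"

text \<open>\<open>p\<close> ramifies if the square of some prime ideal divides the ideal generated by \<open>p\<close>
  in the ring of integers.\<close>

definition ramifies :: "nat \<Rightarrow> 'a::field_char_0 set \<Rightarrow> bool" where
  "ramifies p K \<longleftrightarrow>
     (let R = ring_of_type_algebra\<lparr>carrier := ring_of_integers K\<rparr>
      in \<exists>P A. primeideal P R \<and> ideal A R \<and>
           cgenideal R (of_nat p) = ideal_prod R (ideal_prod R P P) A)"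


section \<open>Integral binary forms\<close>

type_synonym quad_form = "int \<times> int \<times> int"
type_synonym cubic_form = "int \<times> int \<times> int \<times> int"

fun quad_eval :: "quad_form \<Rightarrow> 'a::comm_ring_1 \<Rightarrow> 'a \<Rightarrow> 'a" where
  "quad_eval (A, B, C) x y = of_int A * x^2 + of_int B * x * y + of_int C * y^2"

fun cubic_eval :: "cubic_form \<Rightarrow> 'a::comm_ring_1 \<Rightarrow> 'a \<Rightarrow> 'a" where
  "cubic_eval (a, b, c, d) x y =
     of_int a * x^3 + of_int b * x^2 * y + of_int c * x * y^2 + of_int d * y^3"

fun quad_disc :: "quad_form \<Rightarrow> int" where
  "quad_disc (A, B, C) = B^2 - 4 * A * C"

fun cubic_disc :: "cubic_form \<Rightarrow> int" where
  "cubic_disc (a, b, c, d) =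
     b^2 * c^2 - 4 * a * c^3 - 4 * b^3 * d - 27 * a^2 * d^2 + 18 * a * b * c * d"

fun quad_primitive :: "quad_form \<Rightarrow> bool" where
  "quad_primitive (A, B, C) \<longleftrightarrow> gcd A (gcd B C) = 1"

text \<open>Classes under \<open>SL\<^sub>2(\<int>)\<close>, acting by linear substitution of the variables.\<close>

definition quad_class :: "quad_form \<Rightarrow> quad_form set" where
  "quad_class Q = {Q'. \<exists>p q r s :: int. p * s - q * r = 1 \<and>
     (\<forall>x y :: int. quad_eval Q' x y = quad_eval Q (p * x + q * y) (r * x + s * y))}"

definition cubic_class :: "cubic_form \<Rightarrow> cubic_form set" where
  "cubic_class F = {F'. \<exists>p q r s :: int. p * s - q * r = 1 \<and>
     (\<forall>x y :: int. cubic_eval F' x y = cubic_eval F (p * x + q * y) (r * x + s * y))}"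


section \<open>Gauss composition and the narrow class group\<close>

text \<open>Gauss's direct composition; the two minor conditions fix the orientation, so that
  it is compatible with proper equivalence.\<close>

definition direct_composite :: "quad_form \<Rightarrow> quad_form \<Rightarrow> quad_form \<Rightarrow> bool" where
  "direct_composite f g h \<longleftrightarrow>
     (\<exists>p\<^sub>0 p\<^sub>1 p\<^sub>2 p\<^sub>3 q\<^sub>0 q\<^sub>1 q\<^sub>2 q\<^sub>3 :: int.
        (\<forall>x y z w :: int. quad_eval f x y * quad_eval g z w =
           quad_eval h (p\<^sub>0 * x * z + p\<^sub>1 * x * w + p\<^sub>2 * y * z + p\<^sub>3 * y * w)
                       (q\<^sub>0 * x * z + q\<^sub>1 * x * w + q\<^sub>2 * y * z + q\<^sub>3 * y * w)) \<and>
        p\<^sub>0 * q\<^sub>1 - p\<^sub>1 * q\<^sub>0 = quad_eval f 1 0 \<and>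
        p\<^sub>0 * q\<^sub>2 - p\<^sub>2 * q\<^sub>0 = quad_eval g 1 0)"

text \<open>The form \<open>x\<^sup>2 - (D/4) y\<^sup>2\<close> or \<open>x\<^sup>2 + x y + ((1 - D)/4) y\<^sup>2\<close>
  according to the parity of \<open>D\<close>.\<close>

definition principal_form :: "int \<Rightarrow> quad_form" where
  "principal_form D = (1, D mod 2, (D mod 2 - D) div 4)"

definition form_classes :: "int \<Rightarrow> quad_form set set" where
  "form_classes D = quad_class ` {Q. quad_primitive Q \<and> quad_disc Q = D}"

text \<open>For \<open>D < 0\<close> negative definite forms are included, following Bhargava's convention
  for the narrow class group.\<close>

definition form_class_group :: "int \<Rightarrow> quad_form set monoid" where
  "form_class_group D =
     \<lparr>carrier = form_classes D,
      monoid.mult = (\<lambda>S T. THE U. U \<in> form_classes D \<and>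
        (\<exists>f\<in>S. \<exists>g\<in>T. \<exists>h\<in>U. direct_composite f g h)),
      one = quad_class (principal_form D)\<rparr>"

definition narrow_class_group :: "complex set \<Rightarrow> quad_form set monoid" where
  "narrow_class_group L = form_class_group (field_disc L)"

definition three_torsion :: "('g, 'm) monoid_scheme \<Rightarrow> 'g set" where
  "three_torsion G = {x \<in> carrier G. x [^]\<^bsub>G\<^esub> (3::nat) = \<one>\<^bsub>G\<^esub>}"


section \<open>Gaussian cubic forms\<close>

definition gaussian_cubic_form :: "cubic_form \<Rightarrow> bool" where
  "gaussian_cubic_form F \<longleftrightarrow> (\<exists>a\<^sub>0 a\<^sub>1 a\<^sub>2 a\<^sub>3. F = (a\<^sub>0, 3 * a\<^sub>1, 3 * a\<^sub>2, a\<^sub>3))"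

text \<open>The next function and \<open>phi1_form\<close> are only meaningful on Gaussian forms, where the
  divisions by 3 are exact.\<close>

fun symmetric_cube :: "cubic_form \<Rightarrow> nat \<Rightarrow> nat \<Rightarrow> nat \<Rightarrow> int" where
  "symmetric_cube (a, b, c, d) i j k = [a, b div 3, c div 3, d] ! (i + j + k)"

text \<open>Cayley's hyperdeterminant.\<close>

definition cube_disc :: "(nat \<Rightarrow> nat \<Rightarrow> nat \<Rightarrow> int) \<Rightarrow> int" where
  "cube_disc A =
     (A 0 0 0)^2 * (A 1 1 1)^2 + (A 0 0 1)^2 * (A 1 1 0)^2
   + (A 0 1 0)^2 * (A 1 0 1)^2 + (A 1 0 0)^2 * (A 0 1 1)^2
   - 2 * (A 0 0 0 * A 0 0 1 * A 1 1 0 * A 1 1 1 + A 0 0 0 * A 0 1 0 * A 1 0 1 * A 1 1 1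
        + A 0 0 0 * A 1 0 0 * A 0 1 1 * A 1 1 1 + A 0 0 1 * A 0 1 0 * A 1 0 1 * A 1 1 0
        + A 0 0 1 * A 1 0 0 * A 0 1 1 * A 1 1 0 + A 0 1 0 * A 1 0 0 * A 0 1 1 * A 1 0 1)
   + 4 * (A 0 0 0 * A 0 1 1 * A 1 0 1 * A 1 1 0 + A 0 0 1 * A 0 1 0 * A 1 0 0 * A 1 1 1)"

lemma cube_disc_gaussian:
  assumes "gaussian_cubic_form F"
  shows "27 * cube_disc (symmetric_cube F) = - cubic_disc F"
  using assms
  by (auto simp: gaussian_cubic_form_def cube_disc_def numeral_eq_Suc algebra_simps)

definition Cl_Sym3 :: "int \<Rightarrow> cubic_form set set" where
  "Cl_Sym3 D = cubic_class ` {F. gaussian_cubic_form F \<and> cube_disc (symmetric_cube F) = D}"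

fun phi1_form :: "cubic_form \<Rightarrow> quad_form" where
  "phi1_form (a\<^sub>0, b, c, a\<^sub>3) =
     (let a\<^sub>1 = b div 3; a\<^sub>2 = c div 3
      in (a\<^sub>1^2 - a\<^sub>0 * a\<^sub>2, a\<^sub>1 * a\<^sub>2 - a\<^sub>0 * a\<^sub>3, a\<^sub>2^2 - a\<^sub>1 * a\<^sub>3))"

text \<open>The common class of the images of the members of \<open>S\<close>.\<close>

definition phi1 :: "cubic_form set \<Rightarrow> quad_form set" where
  "phi1 S = the_elem ((\<lambda>F. quad_class (phi1_form F)) ` S)"


section \<open>The forms attached to a cubic field\<close>

fun associated_form :: "'a::field_char_0 set \<Rightarrow> cubic_form \<Rightarrow> 'a \<Rightarrow> bool" where
  "associated_form K (a, b, c, d) \<theta> \<longleftrightarrow>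
     \<theta> \<in> K \<and> cubic_eval (a, b, c, d) \<theta> 1 = 0 \<and> K = rat_adjoin \<theta> \<and>
     int_basis [1, - of_int a * \<theta>, of_int d / \<theta>] (ring_of_integers K) \<and>
     cubic_disc (a, b, c, d) = field_disc K"

definition trace_free_part :: "'a::field_char_0 set \<Rightarrow> 'a \<Rightarrow> 'a" where
  "trace_free_part K x = x - of_rat (field_trace K x) / 3"

text \<open>In the next two definitions the four conditions (the last being \<open>b \<equiv> c\<close> mod 3) are
  mutually exclusive and exhaustive whenever 3 exactly divides the discriminant of the form.
  In the last two cases the second argument of the form is \<open>3y - x\<close> resp. \<open>3y + x\<close>,
  matching the change of basis in \<open>trace_zero_basis\<close>. It cannot be \<open>3(y - x)\<close> resp.
  \<open>3(y + x)\<close>: for the form (1,-1,2,1) of discriminant -87, a third of \<open>F(x, 3(y + x))\<close>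
  is not even integral.\<close>

fun f_K :: "cubic_form \<Rightarrow> int \<Rightarrow> int \<Rightarrow> rat" where
  "f_K (a, b, c, d) x y =
     (let F = (\<lambda>u v :: int. of_int (cubic_eval (a, b, c, d) u v) :: rat) in
      if [b = 0] (mod 3) then 1/3 * F x (3 * y)
      else if [c = 0] (mod 3) then 1/3 * F (3 * x) y
      else if [b = - c] (mod 3) then 1/3 * F x (3 * y - x)
      else 1/3 * F x (3 * y + x))"

fun trace_zero_basis :: "'a::field_char_0 set \<Rightarrow> cubic_form \<Rightarrow> 'a \<Rightarrow> 'a \<times> 'a" where
  "trace_zero_basis K (a, b, c, d) \<theta> =
     (let \<alpha>\<^sub>0 = trace_free_part K (- of_int a * \<theta>);
          \<beta>\<^sub>0 = trace_free_part K (of_int d / \<theta>) in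
      if [b = 0] (mod 3) then (\<alpha>\<^sub>0, 3 * \<beta>\<^sub>0)
      else if [c = 0] (mod 3) then (3 * \<alpha>\<^sub>0, \<beta>\<^sub>0)
      else if [b = - c] (mod 3) then (\<alpha>\<^sub>0 - \<beta>\<^sub>0, 3 * \<beta>\<^sub>0)
      else (\<alpha>\<^sub>0 + \<beta>\<^sub>0, 3 * \<beta>\<^sub>0))"

end

(* Write Q for the Hessian form attached to a Gaussian cubic form f. The discriminant of Q is that
   of the cube of f, and the two bilinear forms obtained from the symmetric trilinear form of f
   compose Q with itself to the opposite of Q, so the class of Q is killed by 3. Since Gauss's
   direct composition is unique up to SL_2(Z), this can be checked on representatives. A unimodular
   shift y -> y + t x with t = 0, -1, 1 (or exchanging x and y) reduces the cubic form of K to the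
   case 3 | b; as the discriminant is divisible by 3 (ramification) but not by 9 (it is
   fundamental), then 3 | a and c is prime to 3. Comparing coefficients identifies the Hessian of
   f_K with a sixth of the trace form. *)

theory Submission
  imports Defs
begin

section \<open>Composition of binary quadratic forms\<close>

text \<open>The product in \<open>form_class_group\<close> is a definite description, so a cube is
  evaluated product by product: each product needs one explicit composite, and all composites of two
  given classes must be equivalent. The obstacle is that \<open>direct_composite\<close> prescribes
  two minors at a single point, a condition tied to the chosen bases; it is first propagated to all
  points. That argument is for nonsquare discriminants. The only square that can occur here is 1,
  where there is a single class. Fundamental discriminants enter only through
  \<open>minimal_disc\<close>, a condition on residues and square divisors. It is reached by
  computing the rings of integers of all quadratic fields, which also gives the discriminant of the
  target field. Ramification enters only through an integer of \<open>K\<close> that is nonzero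
  modulo 3 but has square zero modulo 3. The substitution in \<open>f_K\<close> has determinant 3 or
  -3 up to a unimodular shift and multiplies the discriminant by 3^6; the factor 1/3 contributes
  3^(-4). So \<open>f_K\<close> has discriminant 9 d_K, and its cube has -9 d_K / 27 = -d_K /
  3.\<close>

fun quad_subst :: "quad_form \<Rightarrow> int \<Rightarrow> int \<Rightarrow> int \<Rightarrow> int \<Rightarrow> quad_form" where
  "quad_subst (A, B, C) p q r s =
     (A * p^2 + B * p * r + C * r^2,
      2 * A * p * q + B * (p * s + q * r) + 2 * C * r * s,
      A * q^2 + B * q * s + C * s^2)"

lemma quad_eval_subst:
  "quad_eval (quad_subst Q p q r s) x y = quad_eval Q (p * x + q * y) (r * x + s * y)"
  for x y :: int
  by (cases Q) (simp add: algebra_simps power2_eq_square)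

lemma quad_form_eqI:
  assumes "\<And>x y :: int. quad_eval Q x y = quad_eval Q' x y"
  shows "Q = Q'"
  using assms[of 1 0] assms[of 0 1] assms[of 1 1] by (cases Q, cases Q') auto

lemma quad_class_iff:
  "Q' \<in> quad_class Q \<longleftrightarrow> (\<exists>p q r s. p * s - q * r = 1 \<and> Q' = quad_subst Q p q r s)"
proof -
  have "(\<forall>x y :: int. quad_eval Q' x y = quad_eval Q (p * x + q * y) (r * x + s * y)) \<longleftrightarrow>
      Q' = quad_subst Q p q r s" for p q r s
    by (metis quad_eval_subst quad_form_eqI)
  then show ?thesis unfolding quad_class_def by simp
qed

lemma quad_class_refl: "Q \<in> quad_class Q"
  unfolding quad_class_def by (rule CollectI, rule exI[of _ 1], rule exI[of _ 0],
    rule exI[of _ 0], rule exI[of _ 1]) simp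

lemma quad_class_sym:
  assumes "Q' \<in> quad_class Q"
  shows "Q \<in> quad_class Q'"
proof -
  obtain p q r s where d: "p * s - q * r = 1"
    and e: "\<And>x y :: int. quad_eval Q' x y = quad_eval Q (p * x + q * y) (r * x + s * y)"
    using assms unfolding quad_class_def by auto
  have "quad_eval Q x y = quad_eval Q' (s * x + (- q) * y) ((- r) * x + p * y)" for x y :: int
  proof -
    have "p * (s * x + - q * y) + q * (- r * x + p * y) = (p * s - q * r) * x"
      "r * (s * x + - q * y) + s * (- r * x + p * y) = (p * s - q * r) * y"
      by (simp_all add: algebra_simps)
    then show ?thesis unfolding e by (simp add: d)
  qed
  moreover have "s * p - (- q) * (- r) = 1" using d by (simp add: algebra_simps)
  ultimately show ?thesis unfolding quad_class_def by blast
qed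

lemma quad_class_trans:
  assumes "Q' \<in> quad_class Q" "Q'' \<in> quad_class Q'"
  shows "Q'' \<in> quad_class Q"
proof -
  obtain p q r s where d: "p * s - q * r = 1"
    and e: "\<And>x y :: int. quad_eval Q' x y = quad_eval Q (p * x + q * y) (r * x + s * y)"
    using assms(1) unfolding quad_class_def by auto
  obtain p' q' r' s' where d': "p' * s' - q' * r' = 1"
    and e': "\<And>x y :: int. quad_eval Q'' x y = quad_eval Q' (p' * x + q' * y) (r' * x + s' * y)"
    using assms(2) unfolding quad_class_def by auto
  have "quad_eval Q'' x y = quad_eval Q ((p * p' + q * r') * x + (p * q' + q * s') * y)
      ((r * p' + s * r') * x + (r * q' + s * s') * y)" for x y :: int
    unfolding e e' by (simp add: algebra_simps)
  moreover have "(p * p' + q * r') * (r * q' + s * s') - (p * q' + q * s') * (r * p' + s * r') = 1"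
  proof -
    have "(p * p' + q * r') * (r * q' + s * s') - (p * q' + q * s') * (r * p' + s * r')
        = (p * s - q * r) * (p' * s' - q' * r')" by (simp add: algebra_simps)
    then show ?thesis using d d' by simp
  qed
  ultimately show ?thesis unfolding quad_class_def by blast
qed

lemma quad_class_eqI:
  assumes "Q' \<in> quad_class Q"
  shows "quad_class Q' = quad_class Q"
  using quad_class_trans[OF assms] quad_class_trans[OF quad_class_sym[OF assms]] by blast

lemma quad_disc_subst: "quad_disc (quad_subst Q p q r s) = (p * s - q * r)^2 * quad_disc Q"
  by (cases Q) (simp add: algebra_simps power2_eq_square)

lemma quad_primitive_iff_dvd:
  "quad_primitive (A, B, C) \<longleftrightarrow> (\<forall>d. d dvd A \<longrightarrow> d dvd B \<longrightarrow> d dvd C \<longrightarrow> is_unit d)"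
proof
  assume "quad_primitive (A, B, C)"
  then show "\<forall>d. d dvd A \<longrightarrow> d dvd B \<longrightarrow> d dvd C \<longrightarrow> is_unit d"
    by (metis gcd_greatest quad_primitive.simps)
next
  assume "\<forall>d. d dvd A \<longrightarrow> d dvd B \<longrightarrow> d dvd C \<longrightarrow> is_unit d"
  then have "is_unit (gcd A (gcd B C))" by (meson dvd_trans gcd_dvd1 gcd_dvd2)
  then show "quad_primitive (A, B, C)" by simp
qed

lemma quad_disc_class: "Q' \<in> quad_class Q \<Longrightarrow> quad_disc Q' = quad_disc Q"
  by (auto simp: quad_class_iff quad_disc_subst)

lemma quad_primitive_class:
  assumes "Q' \<in> quad_class Q" "quad_primitive Q"
  shows "quad_primitive Q'"
proof -
  obtain p q r s where "Q = quad_subst Q' p q r s"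
    using quad_class_sym[OF assms(1)] by (auto simp: quad_class_iff)
  then show ?thesis using assms(2)
    by (cases Q; cases Q') (auto simp: quad_primitive_iff_dvd simp del: quad_primitive.simps)
qed

lemma form_classes_mem:
  assumes "S \<in> form_classes D" "Q \<in> S"
  shows "quad_primitive Q" "quad_disc Q = D" "S = quad_class Q"
proof -
  obtain Q0 where "S = quad_class Q0" "quad_primitive Q0" "quad_disc Q0 = D"
    using assms(1) unfolding form_classes_def by blast
  then show "quad_primitive Q" "quad_disc Q = D" "S = quad_class Q"
    using assms(2) quad_primitive_class quad_disc_class quad_class_eqI by blast+
qed

section \<open>Uniqueness of Gauss composition\<close>

lemma quad_eval_1_0_nonzero:
  assumes "quad_disc Q = D" "\<And>n. D \<noteq> n^2"
  shows "quad_eval Q 1 0 \<noteq> (0::int)"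
  using assms(1) assms(2)[of "fst (snd Q)"] by (cases Q) auto

text \<open>The basis-free form of \<open>direct_composite\<close>. For fixed \<open>(x, y)\<close>
  the substitution is linear in \<open>(z, w)\<close>, and its determinant has to be
  \<open>f(x, y)\<close>; symmetrically, for fixed \<open>(z, w)\<close> the determinant is
  \<open>g(z, w)\<close>. Both conditions survive substitutions of determinant 1 in either
  argument.\<close>

definition oriented_composite :: "quad_form \<Rightarrow> quad_form \<Rightarrow> quad_form \<Rightarrow> bool" where
  "oriented_composite f g h \<longleftrightarrow>
     (\<exists>p\<^sub>0 p\<^sub>1 p\<^sub>2 p\<^sub>3 q\<^sub>0 q\<^sub>1 q\<^sub>2 q\<^sub>3 :: int.
        (\<forall>x y z w :: int. quad_eval f x y * quad_eval g z w =
           quad_eval h (p\<^sub>0 * x * z + p\<^sub>1 * x * w + p\<^sub>2 * y * z + p\<^sub>3 * y * w)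
                       (q\<^sub>0 * x * z + q\<^sub>1 * x * w + q\<^sub>2 * y * z + q\<^sub>3 * y * w)) \<and>
        (\<forall>x y. (p\<^sub>0 * x + p\<^sub>2 * y) * (q\<^sub>1 * x + q\<^sub>3 * y) - (p\<^sub>1 * x + p\<^sub>3 * y) * (q\<^sub>0 * x + q\<^sub>2 * y)
           = quad_eval f x y) \<and>
        (\<forall>z w. (p\<^sub>0 * z + p\<^sub>1 * w) * (q\<^sub>2 * z + q\<^sub>3 * w) - (p\<^sub>2 * z + p\<^sub>3 * w) * (q\<^sub>0 * z + q\<^sub>1 * w)
           = quad_eval g z w))"

text \<open>Two forms with equal squares agree up to sign, and a nonzero common leading coefficient
  fixes the sign.\<close>

lemma quad_form_eq_of_square_eq:
  assumes sq: "\<And>x y :: int. (quad_eval Q x y)^2 = (quad_eval Q' x y)^2"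
    and nz: "quad_eval Q 1 0 \<noteq> (0::int)" and eq: "quad_eval Q 1 0 = (quad_eval Q' 1 0 :: int)"
  shows "Q = Q'"
proof -
  obtain a b c where Q: "Q = (a, b, c)" by (cases Q)
  obtain a' b' c' where Q': "Q' = (a', b', c')" by (cases Q')
  have a: "a' = a" "a \<noteq> 0" using nz eq Q Q' by auto
  define r where "r = 2 * a * b - 2 * a * b'"
  define s where "s = b^2 + 2 * a * c - (b'^2 + 2 * a * c')"
  define t where "t = 2 * b * c - 2 * b' * c'"
  define u where "u = c^2 - c'^2"
  have *: "r * y + s * y^2 + t * y^3 + u * y^4 = 0" for y
  proof -
    have "(a + b * y + c * y^2)^2 = (a + b' * y + c' * y^2)^2"
      using sq[of 1 y] by (simp add: Q Q' a)
    moreover have "r * y + s * y^2 + t * y^3 + u * y^4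
        = (a + b * y + c * y^2)^2 - (a + b' * y + c' * y^2)^2"
      unfolding r_def s_def t_def u_def
      by (simp add: algebra_simps power2_eq_square power3_eq_cube power4_eq_xxxx)
    ultimately show ?thesis by simp
  qed
  \<comment> \<open>The values at 1 and -1 separate the odd part \<open>r + t\<close> from the even
    part \<open>s + u\<close>. The values at 2 and -2 do the same with other weights, so all four
    coefficients vanish.\<close>
  have "r = 0" "s = 0"
    using *[of 1] *[of "-1"] *[of 2] *[of "-2"] by simp_all
  then have "b' = b" using a by (simp add: r_def)
  with \<open>s = 0\<close> have "c' = c" using a by (simp add: s_def)
  with a \<open>b' = b\<close> show ?thesis by (simp add: Q Q')
qed

text \<open>Comparing discriminants on both sides of the composition identity for a fixed
  \<open>(x, y)\<close> gives the determinant only up to sign: its square is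
  \<open>f(x, y)^2\<close>. The determinant is itself a quadratic form in \<open>(x, y)\<close>, so
  one sign at \<open>(1, 0)\<close>, where the value is nonzero because \<open>D\<close> is not a
  square, decides all of them. The same holds for \<open>g\<close>.\<close>

lemma oriented_composite_of_direct:
  assumes dc: "direct_composite f g h"
    and disc: "quad_disc f = D" "quad_disc g = D" "quad_disc h = D" "\<And>n. D \<noteq> n^2"
  shows "oriented_composite f g h"
proof -
  obtain p0 p1 p2 p3 q0 q1 q2 q3 :: int where
    id: "\<And>x y z w :: int. quad_eval f x y * quad_eval g z w =
           quad_eval h (p0 * x * z + p1 * x * w + p2 * y * z + p3 * y * w)
                       (q0 * x * z + q1 * x * w + q2 * y * z + q3 * y * w)"
    and m: "p0 * q1 - p1 * q0 = quad_eval f 1 0" "p0 * q2 - p2 * q0 = quad_eval g 1 0"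
    using dc unfolding direct_composite_def by blast
  have D0: "D \<noteq> 0" using disc(4)[of 0] by simp
  \<comment> \<open>The form \<open>e * g'\<close> has discriminant \<open>e^2 * D\<close>, while
    \<open>h\<close> after a substitution has the squared determinant times \<open>D\<close>; cancel
    \<open>D\<close>.\<close>
  have key: "(P * S - T * R)^2 = e^2"
    if "\<And>z w. e * quad_eval g' z w = quad_eval h (P * z + T * w) (R * z + S * w)"
      and g': "quad_disc g' = D" for P T R S e :: int and g'
  proof -
    obtain A B C where gg: "g' = (A, B, C)" by (cases g')
    have "(e * A, e * B, e * C) = quad_subst h P T R S"
      by (rule quad_form_eqI, unfold quad_eval_subst that(1)[symmetric] gg)
         (simp add: algebra_simps)
    then have "quad_disc (e * A, e * B, e * C) = (P * S - T * R)^2 * D"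
      by (simp add: quad_disc_subst disc)
    moreover have "quad_disc (e * A, e * B, e * C) = e^2 * quad_disc g'"
      by (simp add: gg algebra_simps power2_eq_square)
    ultimately show ?thesis using D0 g' by simp
  qed
  have 1: "((p0 * x + p2 * y) * (q1 * x + q3 * y) - (p1 * x + p3 * y) * (q0 * x + q2 * y))^2
       = (quad_eval f x y)^2" for x y
    by (rule key[of _ g]) (simp_all add: id disc algebra_simps)
  have 2: "((p0 * z + p1 * w) * (q2 * z + q3 * w) - (p2 * z + p3 * w) * (q0 * z + q1 * w))^2
       = (quad_eval g z w)^2" for z w
    by (rule key[of _ f], subst mult.commute) (simp_all add: id disc algebra_simps)
  define F where "F = (p0 * q1 - p1 * q0, p0 * q3 + p2 * q1 - p1 * q2 - p3 * q0, p2 * q3 - p3 * q2)"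
  define G where "G = (p0 * q2 - p2 * q0, p0 * q3 + p1 * q2 - p2 * q1 - p3 * q0, p1 * q3 - p3 * q1)"
  have F: "(p0 * x + p2 * y) * (q1 * x + q3 * y) - (p1 * x + p3 * y) * (q0 * x + q2 * y)
      = quad_eval F x y" for x y
    by (simp add: F_def algebra_simps power2_eq_square)
  have G: "(p0 * z + p1 * w) * (q2 * z + q3 * w) - (p2 * z + p3 * w) * (q0 * z + q1 * w)
      = quad_eval G z w" for z w
    by (simp add: G_def algebra_simps power2_eq_square)
  have "f = F"
    by (rule quad_form_eq_of_square_eq)
      (use 1 m quad_eval_1_0_nonzero[OF disc(1,4)] in \<open>simp_all add: F F_def\<close>)
  moreover have "g = G"
    by (rule quad_form_eq_of_square_eq)
      (use 2 m quad_eval_1_0_nonzero[OF disc(2,4)] in \<open>simp_all add: G G_def\<close>)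
  ultimately show ?thesis
    unfolding oriented_composite_def using id F G by blast
qed

lemma oriented_composite_subst_left:
  assumes "oriented_composite f g h" "f' \<in> quad_class f"
  shows "oriented_composite f' g h"
proof -
  obtain p0 p1 p2 p3 q0 q1 q2 q3 :: int where
    id: "\<And>x y z w :: int. quad_eval f x y * quad_eval g z w =
           quad_eval h (p0 * x * z + p1 * x * w + p2 * y * z + p3 * y * w)
                       (q0 * x * z + q1 * x * w + q2 * y * z + q3 * y * w)"
    and F: "\<And>x y. (p0 * x + p2 * y) * (q1 * x + q3 * y) - (p1 * x + p3 * y) * (q0 * x + q2 * y)
      = quad_eval f x y"
    and G: "\<And>z w. (p0 * z + p1 * w) * (q2 * z + q3 * w) - (p2 * z + p3 * w) * (q0 * z + q1 * w)
      = quad_eval g z w"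
    using assms(1) unfolding oriented_composite_def by blast
  obtain p q r s where d: "p * s - q * r = 1"
    and e: "\<And>x y :: int. quad_eval f' x y = quad_eval f (p * x + q * y) (r * x + s * y)"
    using assms(2) unfolding quad_class_def by auto
  show ?thesis unfolding oriented_composite_def
  proof (intro exI conjI allI)
    fix x y z w :: int
    show "quad_eval f' x y * quad_eval g z w =
      quad_eval h ((p0 * p + p2 * r) * x * z + (p1 * p + p3 * r) * x * w + (p0 * q + p2 * s) * y * z + (p1 * q + p3 * s) * y * w)
       ((q0 * p + q2 * r) * x * z + (q1 * p + q3 * r) * x * w + (q0 * q + q2 * s) * y * z + (q1 * q + q3 * s) * y * w)"
      unfolding e id by (simp add: algebra_simps)
    show "((p0 * p + p2 * r) * x + (p0 * q + p2 * s) * y) * ((q1 * p + q3 * r) * x + (q1 * q + q3 * s) * y)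
       - ((p1 * p + p3 * r) * x + (p1 * q + p3 * s) * y) * ((q0 * p + q2 * r) * x + (q0 * q + q2 * s) * y)
       = quad_eval f' x y"
      unfolding e F[symmetric] by (simp add: algebra_simps)
    have "((p0 * p + p2 * r) * z + (p1 * p + p3 * r) * w) * ((q0 * q + q2 * s) * z + (q1 * q + q3 * s) * w)
       - ((p0 * q + p2 * s) * z + (p1 * q + p3 * s) * w) * ((q0 * p + q2 * r) * z + (q1 * p + q3 * r) * w)
       = (p * s - q * r) * quad_eval g z w"
      unfolding G[symmetric] by (simp add: algebra_simps)
    then show "((p0 * p + p2 * r) * z + (p1 * p + p3 * r) * w) * ((q0 * q + q2 * s) * z + (q1 * q + q3 * s) * w)
       - ((p0 * q + p2 * s) * z + (p1 * q + p3 * s) * w) * ((q0 * p + q2 * r) * z + (q1 * p + q3 * r) * w)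
       = quad_eval g z w" by (simp add: d)
  qed
qed

lemma oriented_composite_commute:
  assumes "oriented_composite f g h"
  shows "oriented_composite g f h"
proof -
  obtain p0 p1 p2 p3 q0 q1 q2 q3 :: int where
    id: "\<And>x y z w :: int. quad_eval f x y * quad_eval g z w =
           quad_eval h (p0 * x * z + p1 * x * w + p2 * y * z + p3 * y * w)
                       (q0 * x * z + q1 * x * w + q2 * y * z + q3 * y * w)"
    and F: "\<And>x y. (p0 * x + p2 * y) * (q1 * x + q3 * y) - (p1 * x + p3 * y) * (q0 * x + q2 * y)
      = quad_eval f x y"
    and G: "\<And>z w. (p0 * z + p1 * w) * (q2 * z + q3 * w) - (p2 * z + p3 * w) * (q0 * z + q1 * w)
      = quad_eval g z w"
    using assms(1) unfolding oriented_composite_def by blast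
  show ?thesis unfolding oriented_composite_def
  proof (intro exI conjI allI)
    fix x y z w :: int
    show "quad_eval g x y * quad_eval f z w =
      quad_eval h (p0 * x * z + p2 * x * w + p1 * y * z + p3 * y * w)
       (q0 * x * z + q2 * x * w + q1 * y * z + q3 * y * w)"
      by (subst mult.commute) (simp add: id algebra_simps)
    show "(p0 * x + p1 * y) * (q2 * x + q3 * y) - (p2 * x + p3 * y) * (q0 * x + q1 * y)
      = quad_eval g x y" by (rule G)
    show "(p0 * z + p2 * w) * (q1 * z + q3 * w) - (p1 * z + p3 * w) * (q0 * z + q2 * w)
      = quad_eval f z w" by (rule F)
  qed
qed

text \<open>The vector of the three minors is orthogonal to the rows of both matrices. Hence each
  primed row lies in the plane of the unprimed rows, and Cramer's rule on the columns i and j gives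
  its coefficients, multiplied by the minor of these columns.\<close>

lemma row_in_span_of_equal_minors:
  fixes pi :: "'a::comm_ring_1"
  assumes "pi * qj - pj * qi = pi' * qj' - pj' * qi'"
    "pi * qk - pk * qi = pi' * qk' - pk' * qi'"
    "pj * qk - pk * qj = pj' * qk' - pk' * qj'"
  shows "(pi' * qj - pj' * qi) * pk + (pi * pj' - pj * pi') * qk = (pi * qj - pj * qi) * pk'"
    "(qi' * qj - qj' * qi) * pk + (pi * qj' - pj * qi') * qk = (pi * qj - pj * qi) * qk'"
proof -
  have "pk' * (pi * qj - pj * qi) - pj' * (pi * qk - pk * qi) + pi' * (pj * qk - pk * qj) = 0"
    unfolding assms by (simp add: algebra_simps)
  moreover have "(pi' * qj - pj' * qi) * pk + (pi * pj' - pj * pi') * qk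
      = pj' * (pi * qk - pk * qi) - pi' * (pj * qk - pk * qj)"
    by (simp add: algebra_simps)
  ultimately show "(pi' * qj - pj' * qi) * pk + (pi * pj' - pj * pi') * qk = (pi * qj - pj * qi) * pk'"
    by (simp add: algebra_simps)
  have "qk' * (pi * qj - pj * qi) - qj' * (pi * qk - pk * qi) + qi' * (pj * qk - pk * qj) = 0"
    unfolding assms by (simp add: algebra_simps)
  moreover have "(qi' * qj - qj' * qi) * pk + (pi * qj' - pj * qi') * qk
      = qj' * (pi * qk - pk * qi) - qi' * (pj * qk - pk * qj)"
    by (simp add: algebra_simps)
  ultimately show "(qi' * qj - qj' * qi) * pk + (pi * qj' - pj * qi') * qk = (pi * qj - pj * qi) * qk'"
    by (simp add: algebra_simps)
qed

lemma quad_form_nonzero_value: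
  assumes "quad_primitive f"
  obtains x y :: int where "quad_eval f x y \<noteq> (0::int)"
proof -
  have "f \<noteq> (0, 0, 0)" using assms by auto
  then have "\<exists>x y :: int. quad_eval f x y \<noteq> (0::int)"
    using quad_form_eqI[of f "(0,0,0)"] by auto
  then show ?thesis using that by blast
qed

text \<open>The \<open>2 \<times> 2\<close> minors of the \<open>2 \<times> 4\<close> matrix of the bilinear substitution are determined
  by \<open>f\<close> and \<open>g\<close>, and they generate the unit ideal because \<open>f\<close> is primitive. So any two such
  matrices differ by left multiplication with an element of \<open>SL\<^sub>2(\<int>)\<close>.\<close>

lemma oriented_composite_unique:
  assumes "oriented_composite f g h" "oriented_composite f g h'" "quad_primitive f"
  shows "h \<in> quad_class h'"
proof -
  obtain p0 p1 p2 p3 q0 q1 q2 q3 :: int where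
    id: "\<And>x y z w :: int. quad_eval f x y * quad_eval g z w =
           quad_eval h (p0 * x * z + p1 * x * w + p2 * y * z + p3 * y * w)
                       (q0 * x * z + q1 * x * w + q2 * y * z + q3 * y * w)"
    and F: "\<And>x y. (p0 * x + p2 * y) * (q1 * x + q3 * y) - (p1 * x + p3 * y) * (q0 * x + q2 * y)
      = quad_eval f x y"
    and G: "\<And>z w. (p0 * z + p1 * w) * (q2 * z + q3 * w) - (p2 * z + p3 * w) * (q0 * z + q1 * w)
      = quad_eval g z w"
    using assms(1) unfolding oriented_composite_def by blast
  obtain p0' p1' p2' p3' q0' q1' q2' q3' :: int where
    id': "\<And>x y z w :: int. quad_eval f x y * quad_eval g z w =
           quad_eval h' (p0' * x * z + p1' * x * w + p2' * y * z + p3' * y * w)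
                       (q0' * x * z + q1' * x * w + q2' * y * z + q3' * y * w)"
    and F': "\<And>x y. (p0' * x + p2' * y) * (q1' * x + q3' * y) - (p1' * x + p3' * y) * (q0' * x + q2' * y)
      = quad_eval f x y"
    and G': "\<And>z w. (p0' * z + p1' * w) * (q2' * z + q3' * w) - (p2' * z + p3' * w) * (q0' * z + q1' * w)
      = quad_eval g z w"
    using assms(2) unfolding oriented_composite_def by blast
  obtain A B C where f: "f = (A, B, C)" by (cases f)
  obtain A' B' C' where g: "g = (A', B', C')" by (cases g)
  have P01: "p0 * q1 - p1 * q0 = A" and P01': "p0' * q1' - p1' * q0' = A"
    using F[of 1 0] F'[of 1 0] f by auto
  have P23: "p2 * q3 - p3 * q2 = C" and P23': "p2' * q3' - p3' * q2' = C"
    using F[of 0 1] F'[of 0 1] f by auto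
  have P02: "p0 * q2 - p2 * q0 = A'" and P02': "p0' * q2' - p2' * q0' = A'"
    using G[of 1 0] G'[of 1 0] g by auto
  have P13: "p1 * q3 - p3 * q1 = C'" and P13': "p1' * q3' - p3' * q1' = C'"
    using G[of 0 1] G'[of 0 1] g by auto
  have B: "(p0 * q3 - p3 * q0) - (p1 * q2 - p2 * q1) = B"
    "(p0' * q3' - p3' * q0') - (p1' * q2' - p2' * q1') = B"
    using F[of 1 1] F'[of 1 1] P01 P01' P23 P23' f by (simp_all add: algebra_simps)
  have B': "(p0 * q3 - p3 * q0) + (p1 * q2 - p2 * q1) = B'"
    "(p0' * q3' - p3' * q0') + (p1' * q2' - p2' * q1') = B'"
    using G[of 1 1] G'[of 1 1] P02 P02' P13 P13' g by (simp_all add: algebra_simps)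
  have m01: "p0 * q1 - p1 * q0 = p0' * q1' - p1' * q0'"
    and m02: "p0 * q2 - p2 * q0 = p0' * q2' - p2' * q0'"
    and m13: "p1 * q3 - p3 * q1 = p1' * q3' - p3' * q1'"
    and m23: "p2 * q3 - p3 * q2 = p2' * q3' - p3' * q2'"
    using P01 P01' P02 P02' P13 P13' P23 P23' by simp_all
  \<comment> \<open>The middle coefficients of \<open>f\<close> and \<open>g\<close> are the
    difference and the sum of these two minors, so together they determine both.\<close>
  have m03: "p0 * q3 - p3 * q0 = p0' * q3' - p3' * q0'"
    and m12: "p1 * q2 - p2 * q1 = p1' * q2' - p2' * q1'"
    using B B' by linarith+
  have neg: "b * c - a * d = b' * c' - a' * d'" if "a * d - b * c = a' * d' - b' * c'"
    for a b c d a' b' c' d' :: int using that by linarith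
  note m = m01 m02 m03 m12 m13 m23
  have z: "a * b - a * b = a' * b' - a' * b'" for a b a' b' :: int by simp
  note m' = m neg[OF m01] neg[OF m02] neg[OF m03] neg[OF m12] neg[OF m13] neg[OF m23] z
  obtain l1 l2 l3 where bez: "l1 * A + l2 * B + l3 * C = 1"
  proof -
    obtain u v where "u * B + v * C = gcd B C" using bezout_int by blast
    moreover obtain u' v' where "u' * A + v' * gcd B C = gcd A (gcd B C)" using bezout_int by blast
    ultimately have "u' * A + (v' * u) * B + (v' * v) * C = 1"
      using assms(3) f by (simp add: algebra_simps) (metis distrib_left mult.assoc mult.commute)
    then show ?thesis using that by blast
  qed
  \<comment> \<open>These are the Cramer coefficients for the column pairs 01, 03 minus 12, and 23.
    Their denominators are \<open>A\<close>, \<open>B\<close> and \<open>C\<close>, and the weights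
    \<open>l1\<close>, \<open>l2\<close>, \<open>l3\<close> combine the denominators to 1, so the
    change of basis is integral.\<close>
  define n11 where "n11 = l1 * (p0' * q1 - p1' * q0)
    + l2 * ((p0' * q3 - p3' * q0) - (p1' * q2 - p2' * q1)) + l3 * (p2' * q3 - p3' * q2)"
  define n12 where "n12 = l1 * (p0 * p1' - p1 * p0')
    + l2 * ((p0 * p3' - p3 * p0') - (p1 * p2' - p2 * p1')) + l3 * (p2 * p3' - p3 * p2')"
  define n21 where "n21 = l1 * (q0' * q1 - q1' * q0)
    + l2 * ((q0' * q3 - q3' * q0) - (q1' * q2 - q2' * q1)) + l3 * (q2' * q3 - q3' * q2)"
  define n22 where "n22 = l1 * (p0 * q1' - p1 * q0')
    + l2 * ((p0 * q3' - p3 * q0') - (p1 * q2' - p2 * q1')) + l3 * (p2 * q3' - p3 * q2')"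
  have rp: "n11 * pk + n12 * qk = pk'" and rq: "n21 * pk + n22 * qk = qk'"
    if k0: "p0 * qk - pk * q0 = p0' * qk' - pk' * q0'"
     and k1: "p1 * qk - pk * q1 = p1' * qk' - pk' * q1'"
     and k2: "p2 * qk - pk * q2 = p2' * qk' - pk' * q2'"
     and k3: "p3 * qk - pk * q3 = p3' * qk' - pk' * q3'" for pk qk pk' qk'
  proof -
    note r01 = row_in_span_of_equal_minors[OF m01 k0 k1]
    note r03 = row_in_span_of_equal_minors[OF m03 k0 k3]
    note r12 = row_in_span_of_equal_minors[OF m12 k1 k2]
    note r23 = row_in_span_of_equal_minors[OF m23 k2 k3]
    have "n11 * pk + n12 * qk =
       l1 * ((p0' * q1 - p1' * q0) * pk + (p0 * p1' - p1 * p0') * qk)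
       + l2 * (((p0' * q3 - p3' * q0) * pk + (p0 * p3' - p3 * p0') * qk)
              - ((p1' * q2 - p2' * q1) * pk + (p1 * p2' - p2 * p1') * qk))
       + l3 * ((p2' * q3 - p3' * q2) * pk + (p2 * p3' - p3 * p2') * qk)"
      unfolding n11_def n12_def by (simp add: algebra_simps)
    also have "\<dots> = (l1 * (p0 * q1 - p1 * q0)
        + l2 * ((p0 * q3 - p3 * q0) - (p1 * q2 - p2 * q1)) + l3 * (p2 * q3 - p3 * q2)) * pk'"
      unfolding r01 r03 r12 r23 by (simp add: algebra_simps)
    finally show "n11 * pk + n12 * qk = pk'" unfolding P01 P23 B bez by simp
    have "n21 * pk + n22 * qk =
       l1 * ((q0' * q1 - q1' * q0) * pk + (p0 * q1' - p1 * q0') * qk)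
       + l2 * (((q0' * q3 - q3' * q0) * pk + (p0 * q3' - p3 * q0') * qk)
              - ((q1' * q2 - q2' * q1) * pk + (p1 * q2' - p2 * q1') * qk))
       + l3 * ((q2' * q3 - q3' * q2) * pk + (p2 * q3' - p3 * q2') * qk)"
      unfolding n21_def n22_def by (simp add: algebra_simps)
    also have "\<dots> = (l1 * (p0 * q1 - p1 * q0)
        + l2 * ((p0 * q3 - p3 * q0) - (p1 * q2 - p2 * q1)) + l3 * (p2 * q3 - p3 * q2)) * qk'"
      unfolding r01 r03 r12 r23 by (simp add: algebra_simps)
    finally show "n21 * pk + n22 * qk = qk'" unfolding P01 P23 B bez by simp
  qed
  have s0: "n11 * p0 + n12 * q0 = p0'" "n21 * p0 + n22 * q0 = q0'"
    and s1: "n11 * p1 + n12 * q1 = p1'" "n21 * p1 + n22 * q1 = q1'"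
    and s2: "n11 * p2 + n12 * q2 = p2'" "n21 * p2 + n22 * q2 = q2'"
    and s3: "n11 * p3 + n12 * q3 = p3'" "n21 * p3 + n22 * q3 = q3'"
    by ((rule rp; fact m'), (rule rq; fact m'))+
  \<comment> \<open>Left multiplication scales every minor by the determinant, but the minors
    \<open>A\<close>, \<open>B\<close>, \<open>C\<close> are unchanged; apply the Bezout combination
    once more.\<close>
  have det: "n11 * n22 - n12 * n21 = 1"
  proof -
    have "A = (n11 * n22 - n12 * n21) * A" "B = (n11 * n22 - n12 * n21) * B"
      "C = (n11 * n22 - n12 * n21) * C"
      unfolding P01[symmetric] P23[symmetric] B(1)[symmetric]
      using m unfolding s0[symmetric] s1[symmetric] s2[symmetric] s3[symmetric]
      by (simp_all add: algebra_simps)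
    then have "l1 * A + l2 * B + l3 * C = (n11 * n22 - n12 * n21) * (l1 * A + l2 * B + l3 * C)"
      by (metis (no_types, lifting) distrib_left mult.left_commute)
    then show ?thesis unfolding bez by simp
  qed
  obtain x y :: int where "quad_eval f x y \<noteq> (0::int)"
    using quad_form_nonzero_value[OF assms(3)] .
  define e where "e = (quad_eval f x y :: int)"
  have e: "e \<noteq> 0" using \<open>quad_eval f x y \<noteq> 0\<close> by (simp add: e_def)
  have "quad_eval h u v = quad_eval h' (n11 * u + n12 * v) (n21 * u + n22 * v)" for u v :: int
  proof -
    have sc: "quad_eval Q (e * a) (e * b) = e^2 * quad_eval Q a b" for Q and a b :: int
      by (cases Q) (simp add: algebra_simps power2_eq_square)
    \<comment> \<open>For fixed \<open>(x, y)\<close> the substitution has determinant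
      \<open>e\<close>. This choice of \<open>(z, w)\<close> is its adjugate applied to
      \<open>(u, v)\<close>, so the values become \<open>e * u\<close> and \<open>e * v\<close>; the
      factor \<open>e^2\<close> then cancels. Thus \<open>h\<close> and \<open>h'\<close> are
      compared at every point, although composition need not reach every point directly.\<close>
    define z where "z = (q1 * x + q3 * y) * u - (p1 * x + p3 * y) * v"
    define w where "w = (p0 * x + p2 * y) * v - (q0 * x + q2 * y) * u"
    have U: "p0 * x * z + p1 * x * w + p2 * y * z + p3 * y * w = e * u"
      unfolding e_def F[symmetric] z_def w_def by (simp add: algebra_simps)
    have V: "q0 * x * z + q1 * x * w + q2 * y * z + q3 * y * w = e * v"
      unfolding e_def F[symmetric] z_def w_def by (simp add: algebra_simps)
    have U': "p0' * x * z + p1' * x * w + p2' * y * z + p3' * y * w = e * (n11 * u + n12 * v)"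
    proof -
      have "p0' * x * z + p1' * x * w + p2' * y * z + p3' * y * w =
        n11 * (p0 * x * z + p1 * x * w + p2 * y * z + p3 * y * w)
        + n12 * (q0 * x * z + q1 * x * w + q2 * y * z + q3 * y * w)"
        unfolding s0[symmetric] s1[symmetric] s2[symmetric] s3[symmetric]
        by (simp add: algebra_simps)
      then show ?thesis unfolding U V by (simp add: algebra_simps)
    qed
    have V': "q0' * x * z + q1' * x * w + q2' * y * z + q3' * y * w = e * (n21 * u + n22 * v)"
    proof -
      have "q0' * x * z + q1' * x * w + q2' * y * z + q3' * y * w =
        n21 * (p0 * x * z + p1 * x * w + p2 * y * z + p3 * y * w)
        + n22 * (q0 * x * z + q1 * x * w + q2 * y * z + q3 * y * w)"
        unfolding s0[symmetric] s1[symmetric] s2[symmetric] s3[symmetric]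
        by (simp add: algebra_simps)
      then show ?thesis unfolding U V by (simp add: algebra_simps)
    qed
    show ?thesis using id[of x y z w] id'[of x y z w] e unfolding U V U' V' sc by simp
  qed
  then show ?thesis unfolding quad_class_def using det by blast
qed

text \<open>What the definite description in \<open>form_class_group\<close> needs. The two
  composites may use different representatives; passing to \<open>oriented_composite\<close> moves
  the first one to the representatives of the second.\<close>

lemma direct_composite_class_unique:
  assumes D: "\<And>n. D \<noteq> n^2"
    and cl: "S \<in> form_classes D" "T \<in> form_classes D" "U \<in> form_classes D" "U' \<in> form_classes D"
    and c: "direct_composite f g h" "f \<in> S" "g \<in> T" "h \<in> U"
    and c': "direct_composite f' g' h'" "f' \<in> S" "g' \<in> T" "h' \<in> U'"
  shows "U' = U"
proof -
  note mem = form_classes_mem[OF cl(1) c(2)] form_classes_mem[OF cl(2) c(3)]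
    form_classes_mem[OF cl(3) c(4)]
  note mem' = form_classes_mem[OF cl(1) c'(2)] form_classes_mem[OF cl(2) c'(3)]
    form_classes_mem[OF cl(4) c'(4)]
  have "oriented_composite f g h"
    by (rule oriented_composite_of_direct[OF c(1)]) (use mem D in auto)
  moreover have "f' \<in> quad_class f" "g' \<in> quad_class g" using c' mem by auto
  ultimately have "oriented_composite f' g' h"
    by (meson oriented_composite_commute oriented_composite_subst_left)
  moreover have "oriented_composite f' g' h'"
    by (rule oriented_composite_of_direct[OF c'(1)]) (use mem' D in auto)
  ultimately have "h \<in> quad_class h'" using oriented_composite_unique mem'(1) by blast
  then show ?thesis using mem mem' quad_class_eqI by metis
qed

section \<open>Gaussian cubic forms and the class group\<close>

text \<open>Holds exactly for \<open>1\<close> and the discriminants of quadratic fields.\<close>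

definition minimal_disc :: "int \<Rightarrow> bool" where
  "minimal_disc D \<longleftrightarrow> D mod 4 \<in> {0, 1} \<and>
     (\<forall>k>1. k^2 dvd D \<longrightarrow> (D div k^2) mod 4 \<notin> {0, 1})"

lemma minimal_discD:
  assumes "minimal_disc (k^2 * D)" "D mod 4 \<in> {0, 1}"
  shows "\<bar>k\<bar> = 1"
proof (rule ccontr)
  assume "\<bar>k\<bar> \<noteq> 1"
  then consider "k = 0" | "\<bar>k\<bar> > 1" by linarith
  then show False
  proof cases
    \<comment> \<open>Zero is not minimal: 4 divides it and the quotient is again 0 modulo
      4.\<close>
    case 1
    then show False using assms(1) unfolding minimal_disc_def
      by (auto dest: spec[of _ 2])
  next
    case 2
    then have "k^2 \<noteq> 0" by auto
    then have "k^2 * D div \<bar>k\<bar>^2 = D" by simp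
    then show False using assms 2 unfolding minimal_disc_def
      by (metis dvd_triv_left power2_abs)
  qed
qed

lemma minimal_disc_square:
  assumes "minimal_disc (n^2)"
  shows "n^2 = 1"
  using minimal_discD[of n 1] assms by (simp add: power2_eq_1_iff abs_eq_iff')

lemma square_mod_4: "(B::int)^2 mod 4 \<in> {0, 1}"
proof -
  have "B mod 4 = 0 \<or> B mod 4 = 1 \<or> B mod 4 = 2 \<or> B mod 4 = 3" by presburger
  then have "(B mod 4)^2 mod 4 \<in> {0, 1}" by auto
  then show ?thesis by (simp add: power_mod)
qed

lemma quad_disc_mod_4: "quad_disc Q mod 4 \<in> {0, 1}"
proof -
  obtain A B C where Q: "Q = (A, B, C)" by (cases Q)
  have "quad_disc Q = B^2 + 4 * (- (A * C))" by (simp add: Q)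
  then have "quad_disc Q mod 4 = B^2 mod 4" by presburger
  then show ?thesis using square_mod_4 by simp
qed

text \<open>Dividing out the content \<open>k\<close> leaves a form whose discriminant is smaller by
  the factor \<open>k^2\<close> and still 0 or 1 modulo 4.\<close>

lemma quad_primitive_of_minimal_disc:
  assumes "minimal_disc (quad_disc Q)"
  shows "quad_primitive Q"
proof -
  obtain A B C where Q: "Q = (A, B, C)" by (cases Q)
  define k where "k = gcd A (gcd B C)"
  obtain a b c where "A = k * a" "B = k * b" "C = k * c"
    unfolding k_def by (metis dvd_def dvd_trans gcd_dvd1 gcd_dvd2)
  then have "quad_disc Q = k^2 * quad_disc (a, b, c)"
    by (simp add: Q algebra_simps power2_eq_square)
  then have "\<bar>k\<bar> = 1" using assms minimal_discD quad_disc_mod_4 by metis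
  then show ?thesis by (simp add: Q k_def)
qed

text \<open>The one square discriminant that the uniqueness argument must leave to a separate
  treatment. A form of discriminant 1 splits into two integral linear factors with determinant 1, so
  it is equivalent to \<open>x * y\<close>.\<close>

lemma quad_class_hyperbolic:
  assumes "quad_disc Q = 1"
  shows "Q \<in> quad_class (0, 1, 0)"
proof -
  obtain A B C where Q: "Q = (A, B, C)" by (cases Q)
  have disc: "B^2 = 1 + 4 * (A * C)" using assms by (simp add: Q)
  then have "odd (B^2)" by presburger
  then have "odd B" by simp
  then obtain n where B: "B = 2 * n + 1" by (rule oddE)
  define m where "m = n + 1"
  have AC: "A * C = m * n" using disc by (simp add: B m_def power2_eq_square algebra_simps)
  \<comment> \<open>The matrix with rows \<open>(A, m)\<close> and \<open>(n, C)\<close> is singular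
    and \<open>m + n = B\<close>. Writing it as the outer product of \<open>(p, q)\<close> and
    \<open>(r, s)\<close> factors the form as \<open>(p x + q y) (r x + s y)\<close>, with
    determinant \<open>m - n = 1\<close>. Take for \<open>p\<close> the gcd of the first row; the
    case of a zero first row forces \<open>n = -1\<close>.\<close>
  have "\<exists>p q r s. p * r = A \<and> p * s = m \<and> q * r = n \<and> q * s = C"
  proof (cases "A = 0 \<and> m = 0")
    case True
    then show ?thesis
      by (intro exI[of _ 0] exI[of _ 1] exI[of _ "-1"] exI[of _ C]) (simp add: m_def)
  next
    case False
    define p where "p = gcd A m"
    have p: "p \<noteq> 0" using False by (simp add: p_def)
    obtain r s where rs: "A = p * r" "m = p * s" "coprime r s"
      using gcd_coprime_exists[of A m] False unfolding p_def by (auto simp: mult.commute)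
    have Cr: "r * C = s * n" using AC p by (simp add: rs)
    show ?thesis
    proof (cases "r = 0")
      case True
      then have "\<bar>s\<bar> = 1" using rs(3) by simp
      then have "s * s = 1" by (metis abs_mult_self_eq mult_1)
      moreover have "n = 0" using Cr True \<open>\<bar>s\<bar> = 1\<close> by auto
      ultimately show ?thesis using rs True
        by (intro exI[of _ p] exI[of _ "C * s"] exI[of _ r] exI[of _ s]) simp
    next
      case False
      have "r dvd n" using Cr rs(3) by (metis coprime_dvd_mult_right_iff dvd_triv_left)
      then obtain q where "n = r * q" ..
      then show ?thesis using rs Cr False
        by (intro exI[of _ p] exI[of _ q] exI[of _ r] exI[of _ s]) (simp add: mult.commute mult.left_commute)
    qed
  qed
  then obtain p q r s where "p * r = A" "p * s = m" "q * r = n" "q * s = C" by blast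
  then have "p * s - q * r = 1" "Q = quad_subst (0, 1, 0) p q r s"
    by (simp_all add: Q B m_def)
  then show ?thesis unfolding quad_class_iff by blast
qed

text \<open>Evaluates the group product from a single composition of representatives. A minimal
  discriminant other than 1 is not a square, which is what uniqueness requires; for 1 there is only
  one class.\<close>

lemma form_class_group_mult:
  assumes D: "minimal_disc D"
    and disc: "quad_disc f = D" "quad_disc g = D" "quad_disc h = D"
    and dc: "direct_composite f g h"
  shows "quad_class f \<otimes>\<^bsub>form_class_group D\<^esub> quad_class g = quad_class h"
proof -
  have mem: "quad_class Q \<in> form_classes D" if "quad_disc Q = D" for Q
    using quad_primitive_of_minimal_disc[of Q] that D unfolding form_classes_def by blast
  have "(THE U. U \<in> form_classes D \<and>
      (\<exists>f'\<in>quad_class f. \<exists>g'\<in>quad_class g. \<exists>h'\<in>U. direct_composite f' g' h')) = quad_class h"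
  proof (rule the_equality)
    show "quad_class h \<in> form_classes D \<and>
      (\<exists>f'\<in>quad_class f. \<exists>g'\<in>quad_class g. \<exists>h'\<in>quad_class h. direct_composite f' g' h')"
      using mem[OF disc(3)] dc quad_class_refl by blast
  next
    fix U assume U: "U \<in> form_classes D \<and>
      (\<exists>f'\<in>quad_class f. \<exists>g'\<in>quad_class g. \<exists>h'\<in>U. direct_composite f' g' h')"
    show "U = quad_class h"
    proof (cases "D = 1")
      case True
      have "V = quad_class (0, 1, 0)" if V: "V \<in> form_classes 1" for V
      proof -
        obtain Q where "V = quad_class Q" "Q \<in> {Q. quad_primitive Q \<and> quad_disc Q = 1}"
          using V unfolding form_classes_def by (rule imageE)
        then show ?thesis using quad_class_eqI[OF quad_class_hyperbolic, of Q] by simp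
      qed
      note singleton = this
      have "U \<in> form_classes 1" "quad_class h \<in> form_classes 1"
        using U mem[OF disc(3)] by (simp_all add: True)
      then show ?thesis using singleton[of U] singleton[of "quad_class h"] by simp
    next
      case False
      then have nsq: "D \<noteq> n^2" for n using D minimal_disc_square by metis
      obtain f' g' h' where c': "direct_composite f' g' h'"
        "f' \<in> quad_class f" "g' \<in> quad_class g" "h' \<in> U" using U by blast
      show ?thesis
        using direct_composite_class_unique[OF nsq mem[OF disc(1)] mem[OF disc(2)]
            mem[OF disc(3)] _ dc quad_class_refl quad_class_refl quad_class_refl c'] U by blast
    qed
  qed
  then show ?thesis by (simp add: form_class_group_def)
qed

section \<open>Neutral and opposite forms, and the cube of the Hessian class\<close>

lemma principal_form_quad_disc:
  assumes "e \<in> {0, 1}"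
  shows "principal_form (quad_disc (A, e + 2 * k, C)) = (1, e, A * C - e * k - k^2)"
proof -
  have ee: "e * e = e" using assms by auto
  \<comment> \<open>With \<open>e\<close> the parity of the middle coefficient,
    \<open>e * e = e\<close>, so the discriminant is \<open>e\<close> plus a multiple of 4. The
    \<open>div\<close> and \<open>mod\<close> in \<open>principal_form\<close> thereby turn into
    polynomials, as the following composition identities require.\<close>
  have D: "quad_disc (A, e + 2 * k, C) = e + 4 * (e * k + k^2 - A * C)"
    using ee by (simp add: power2_eq_square algebra_simps)
  have "(e + 4 * t) mod 2 = e" for t 
  proof -
    have "e = 0 \<or> e = 1" using assms by simp
    then show ?thesis by presburger
  qed
  then have "quad_disc (A, e + 2 * k, C) mod 2 = e" unfolding D .
  moreover have "(e - quad_disc (A, e + 2 * k, C)) div 4 = A * C - e * k - k^2"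
    unfolding D by simp
  ultimately show ?thesis by (simp add: principal_form_def)
qed

lemma half_coeff:
  obtains e k :: int where "B = e + 2 * k" "e \<in> {0, 1}"
  by (rule that[of "B mod 2" "B div 2"]) auto

lemma quad_disc_principal_form:
  "quad_disc (principal_form (quad_disc Q)) = quad_disc Q"
proof -
  obtain A B C where Q: "Q = (A, B, C)" by (cases Q)
  obtain e k where B: "B = e + 2 * k" "e \<in> {0, 1}" by (rule half_coeff)
  show ?thesis unfolding Q B(1) principal_form_quad_disc[OF B(2)]
    using B(2) by (auto simp: power2_eq_square algebra_simps)
qed

lemma direct_composite_principal: "direct_composite (principal_form (quad_disc Q)) Q Q"
proof -
  obtain A B C where Q: "Q = (A, B, C)" by (cases Q)
  obtain e k where B: "B = e + 2 * k" "e \<in> {0, 1}" by (rule half_coeff)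
  show ?thesis unfolding Q B(1) principal_form_quad_disc[OF B(2)] direct_composite_def
    \<comment> \<open>Let w have trace \<open>e\<close> and norm \<open>A * C - e * k - k^2\<close>;
      then t = w + \<open>k\<close> has trace \<open>B\<close> and norm \<open>A * C\<close>. The
      witnesses are the coordinates of (x + y w)(A z + t w'), with w' the fourth variable, in the
      basis \<open>A\<close>, t.\<close>
    by (rule exI[of _ 1], rule exI[of _ 0], rule exI[of _ "-k"], rule exI[of _ "-C"],
      rule exI[of _ 0], rule exI[of _ 1], rule exI[of _ A], rule exI[of _ "e + k"])
      (use B(2) in \<open>auto simp: power2_eq_square algebra_simps\<close>)
qed

lemma direct_composite_opposite:
  "direct_composite (A, - B, C) (A, B, C) (principal_form (quad_disc (A, B, C)))"
proof -
  obtain e k where B: "B = e + 2 * k" "e \<in> {0, 1}" by (rule half_coeff)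
  show ?thesis unfolding B(1) principal_form_quad_disc[OF B(2)] direct_composite_def
    \<comment> \<open>With w and t as for the principal form and t' the conjugate of t, multiply A x
      - y t' by A z + t w', where w' is the fourth variable, and divide by \<open>A\<close>. The
      witnesses are the coordinates in the basis 1, w.\<close>
    by (rule exI[of _ A], rule exI[of _ k], rule exI[of _ "-k-e"], rule exI[of _ "-C"],
      rule exI[of _ 0], rule exI[of _ 1], rule exI[of _ 1], rule exI[of _ 0])
      (use B(2) in \<open>auto simp: power2_eq_square algebra_simps\<close>)
qed

text \<open>The symmetric trilinear form of a Gaussian cubic form with two slots filled is a pair
  of bilinear forms, and these compose the Hessian with itself to the opposite class.\<close>

lemma direct_composite_hessian:
  assumes "A = a1^2 - a0 * a2" "B = a1 * a2 - a0 * a3" "C = a2^2 - a1 * a3"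
  shows "direct_composite (A, B, C) (A, B, C) (A, - B, C)"
  unfolding assms direct_composite_def
  by (rule exI[of _ a1], rule exI[of _ a2], rule exI[of _ a2], rule exI[of _ a3],
      rule exI[of _ a0], rule exI[of _ a1], rule exI[of _ a1], rule exI[of _ a2])
     (simp add: power2_eq_square algebra_simps)

lemma cube_disc_eq_quad_disc:
  "cube_disc (symmetric_cube (a0, 3 * a1, 3 * a2, a3)) = quad_disc (phi1_form (a0, 3 * a1, 3 * a2, a3))"
  by (simp add: cube_disc_def numeral_eq_Suc algebra_simps Let_def)

text \<open>The power unfolds to ((1 Q) Q) Q, so three explicit products are composed: 1 Q is Q, Q Q
  is the opposite of Q, and the opposite times Q is principal.\<close>

lemma hessian_class_three_torsion:
  assumes D: "minimal_disc (quad_disc (phi1_form f))" and f: "gaussian_cubic_form f"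
  shows "quad_class (phi1_form f) \<in> three_torsion (form_class_group (quad_disc (phi1_form f)))"
proof -
  obtain a0 a1 a2 a3 where f: "f = (a0, 3 * a1, 3 * a2, a3)"
    using f unfolding gaussian_cubic_form_def by blast
  define A B C where ABC: "A = a1^2 - a0 * a2" "B = a1 * a2 - a0 * a3" "C = a2^2 - a1 * a3"
  have phi: "phi1_form f = (A, B, C)" by (simp add: f ABC)
  define E where "E = quad_disc (A, B, C)"
  have E: "minimal_disc E" using D by (simp add: phi E_def)
  have opp: "quad_disc (A, - B, C) = E" by (simp add: E_def)
  note m = form_class_group_mult[OF E]
  have "quad_class (principal_form E) \<otimes>\<^bsub>form_class_group E\<^esub> quad_class (A, B, C) = quad_class (A, B, C)"
    using m direct_composite_principal[of "(A, B, C)"] quad_disc_principal_form[of "(A, B, C)"]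
    unfolding E_def by blast
  moreover have "quad_class (A, B, C) \<otimes>\<^bsub>form_class_group E\<^esub> quad_class (A, B, C) = quad_class (A, - B, C)"
    using m direct_composite_hessian[OF ABC] opp unfolding E_def by blast
  moreover have "quad_class (A, - B, C) \<otimes>\<^bsub>form_class_group E\<^esub> quad_class (A, B, C)
      = quad_class (principal_form E)"
    using m direct_composite_opposite[of A B C] opp quad_disc_principal_form[of "(A, B, C)"]
    unfolding E_def by blast
  moreover have "\<one>\<^bsub>form_class_group E\<^esub> = quad_class (principal_form E)"
    by (simp add: form_class_group_def)
  ultimately have "quad_class (A, B, C) [^]\<^bsub>form_class_group E\<^esub> (3::nat) = \<one>\<^bsub>form_class_group E\<^esub>"
    by (simp add: nat_pow_def numeral_3_eq_3)
  moreover have "quad_class (A, B, C) \<in> carrier (form_class_group E)"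
    using quad_primitive_of_minimal_disc[of "(A, B, C)"] E
    unfolding form_class_group_def form_classes_def E_def by auto
  ultimately show ?thesis unfolding three_torsion_def phi E_def by simp
qed

section \<open>The map \<open>phi1\<close> on classes\<close>

lemma cubic_form_eqI:
  assumes "\<And>x y :: int. cubic_eval F x y = cubic_eval F' x y"
  shows "F = F'"
  using assms[of 1 0] assms[of 0 1] assms[of 1 1] assms[of 1 "-1"]
  by (cases F, cases F') auto

lemma cubic_class_refl: "F \<in> cubic_class F"
  unfolding cubic_class_def by (rule CollectI, rule exI[of _ 1], rule exI[of _ 0],
    rule exI[of _ 0], rule exI[of _ 1]) simp

lemma phi1_form_covariant:
  assumes "gaussian_cubic_form f" "f' \<in> cubic_class f"
  shows "phi1_form f' \<in> quad_class (phi1_form f)"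
proof -
  obtain a0 a1 a2 a3 where f: "f = (a0, 3 * a1, 3 * a2, a3)"
    using assms(1) unfolding gaussian_cubic_form_def by blast
  obtain p q r s where d: "p * s - q * r = 1"
    and e: "\<And>x y :: int. cubic_eval f' x y = cubic_eval f (p * x + q * y) (r * x + s * y)"
    using assms(2) unfolding cubic_class_def by auto
  \<comment> \<open>The symmetric trilinear form obtained by polarising \<open>f\<close>, each
    argument being a pair. The Gaussian coefficients of \<open>f'\<close> are its values on the
    columns \<open>(p, r)\<close> and \<open>(q, s)\<close>, which makes the covariance of the
    Hessian, with factor the squared determinant, a polynomial identity.\<close>
  define T where "T = (\<lambda>x x' y y' z z'. a0 * x * y * z + a1 * (x' * y * z + x * y' * z + x * y * z')
    + a2 * (x * y' * z' + x' * y * z' + x' * y' * z) + a3 * x' * y' * z')"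
  have "f' = (T p r p r p r, 3 * T p r p r q s, 3 * T p r q s q s, T q s q s q s)"
    by (rule cubic_form_eqI)
      (simp add: e f T_def algebra_simps power2_eq_square power3_eq_cube)
  then have phi: "phi1_form f' = ((T p r p r q s)^2 - T p r p r p r * T p r q s q s,
      T p r p r q s * T p r q s q s - T p r p r p r * T q s q s q s,
      (T p r q s q s)^2 - T p r p r q s * T q s q s q s)"
    by (simp add: Let_def)
  define A B C where ABC: "A = a1^2 - a0 * a2" "B = a1 * a2 - a0 * a3" "C = a2^2 - a1 * a3"
  have "(T p r p r q s)^2 - T p r p r p r * T p r q s q s
      = (p * s - q * r)^2 * (A * p^2 + B * p * r + C * r^2)"
    unfolding T_def ABC by (simp add: algebra_simps power2_eq_square)
  moreover have "T p r p r q s * T p r q s q s - T p r p r p r * T q s q s q s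
      = (p * s - q * r)^2 * (2 * A * p * q + B * (p * s + q * r) + 2 * C * r * s)"
    unfolding T_def ABC by (simp add: algebra_simps power2_eq_square)
  moreover have "(T p r q s q s)^2 - T p r p r q s * T q s q s q s
      = (p * s - q * r)^2 * (A * q^2 + B * q * s + C * s^2)"
    unfolding T_def ABC by (simp add: algebra_simps power2_eq_square)
  ultimately have "phi1_form f' = quad_subst (A, B, C) p q r s"
    unfolding phi d by simp
  moreover have "phi1_form f = (A, B, C)" by (simp add: f ABC)
  ultimately show ?thesis unfolding quad_class_iff using d by auto
qed

lemma phi1_cubic_class:
  assumes "gaussian_cubic_form f"
  shows "phi1 (cubic_class f) = quad_class (phi1_form f)"
proof -
  have "(\<lambda>F. quad_class (phi1_form F)) ` cubic_class f = {quad_class (phi1_form f)}"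
    using phi1_form_covariant[OF assms] quad_class_eqI cubic_class_refl by blast
  then show ?thesis unfolding phi1_def by simp
qed

section \<open>Traces and discriminants\<close>

lemma subfield_closed:
  fixes K :: "'a::field_char_0 set"
  assumes K: "subfield K ring_of_type_algebra"
  shows subfield_one: "1 \<in> K"
    and subfield_add: "x \<in> K \<Longrightarrow> y \<in> K \<Longrightarrow> x + y \<in> K"
    and subfield_mult: "x \<in> K \<Longrightarrow> y \<in> K \<Longrightarrow> x * y \<in> K"
    and subfield_uminus: "x \<in> K \<Longrightarrow> - x \<in> K"
    and subfield_inverse: "x \<in> K \<Longrightarrow> inverse x \<in> K"
    and subfield_of_rat: "of_rat r \<in> K"
    and subfield_subspace: "rat_vs.subspace K"
proof -
  note sub = subringE[OF subfieldE(1)[OF K]]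
  show one: "1 \<in> K" using sub(3) by (simp add: ring_of_type_algebra_def)
  show add: "x + y \<in> K" if "x \<in> K" "y \<in> K" for x y
    using sub(7)[OF that] by (simp add: ring_of_type_algebra_def)
  show mult: "x * y \<in> K" if "x \<in> K" "y \<in> K" for x y
    using sub(6)[OF that] by (simp add: ring_of_type_algebra_def)
  have inv: "\<exists>y\<in>K. x * y = 1" if "x \<in> K" "x \<noteq> 0" for x
  proof -
    have "x \<in> Units (ring_of_type_algebra\<lparr>carrier := K\<rparr>)"
      using subfield.subfield_Units[OF K] that by (simp add: ring_of_type_algebra_def)
    then show ?thesis by (auto simp: Units_def ring_of_type_algebra_def)
  qed
  show inverse: "inverse x \<in> K" if "x \<in> K" for x
    using inv[OF that] that by (cases "x = 0") (auto simp: inverse_unique)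
  have zero: "0 \<in> K" using sub(2) by (simp add: ring_of_type_algebra_def)
  have nat: "of_nat n \<in> K" for n by (induction n) (auto intro: add one zero)
  show uminus: "- x \<in> K" if "x \<in> K" for x
  proof -
    have "\<ominus>\<^bsub>ring_of_type_algebra\<^esub> x = - x"
    proof -
      interpret R: ring "ring_of_type_algebra :: 'a ring" by (rule ring_from_type_algebra)
      have "- x \<oplus>\<^bsub>ring_of_type_algebra\<^esub> x = \<zero>\<^bsub>ring_of_type_algebra\<^esub>"
        by (simp add: ring_of_type_algebra_def)
      then show ?thesis by (intro R.minus_equality) (auto simp: ring_of_type_algebra_def)
    qed
    then show ?thesis using sub(5)[OF that] by simp
  qed
  have int: "of_int n \<in> K" for n by (cases n rule: int_cases2) (auto intro: nat uminus)
  show rat: "of_rat r \<in> K" for r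
    by (cases r) (auto simp: of_rat_rat divide_inverse intro: mult int inverse)
  show "rat_vs.subspace K"
    by (rule rat_vs.subspaceI) (auto intro: zero add mult rat)
qed

lemma number_field_span:
  assumes "number_field n K" "rat_vs.independent S" "S \<subseteq> K" "card S = n" "n > 0"
  shows "rat_vs.span S = K"
proof -
  have sub: "rat_vs.subspace K" "rat_vs.dim K = n"
    using assms(1) subfield_subspace unfolding number_field_def by auto
  obtain B where B: "S \<subseteq> B" "B \<subseteq> K" "rat_vs.independent B" "K \<subseteq> rat_vs.span B"
    using rat_vs.maximal_independent_subset_extend[OF assms(3,2)] by blast
  \<comment> \<open>A default value matters here: \<open>n > 0\<close> excludes an infinite
    \<open>B\<close>, whose cardinality would be 0, and only for finite \<open>B\<close> does
    equality of cardinalities give \<open>B = S\<close>.\<close>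
  have "card B = n" using rat_vs.basis_card_eq_dim[OF B(2,4,3)] sub by simp
  moreover from this have "finite B" using \<open>n > 0\<close> card_ge_0_finite by blast
  ultimately have "B = S" using B(1) assms(4) by (metis card_subset_eq)
  then show ?thesis using B sub by (metis rat_vs.span_minimal subset_antisym)
qed

context
  fixes B K :: "'a::field_char_0 set"
  assumes fin: "finite B" and ind: "rat_vs.independent B" and span: "rat_vs.span B = K"
    and mult: "\<And>x y. x \<in> K \<Longrightarrow> y \<in> K \<Longrightarrow> x * y \<in> K"
begin

text \<open>Independence of the basis picked by \<open>SOME\<close>. Both traces equal the same
  double sum over \<open>b\<close> in \<open>B\<close> and \<open>b'\<close> in \<open>B'\<close>:
  the coefficient of \<open>b'\<close> in \<open>b\<close> times the coefficient of \<open>b\<close>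
  in \<open>x * b'\<close>. This is the usual tr(XY) = tr(YX).\<close>

lemma field_trace_basis:
  assumes x: "x \<in> K"
  shows "field_trace K x = (\<Sum>b\<in>B. rat_vs.representation B (x * b) b)"
proof -
  define B' where "B' = (SOME B. rat_vs.independent B \<and> rat_vs.span B = K)"
  have B': "rat_vs.independent B' \<and> rat_vs.span B' = K"
    unfolding B'_def by (rule someI[of _ B]) (use ind span in blast)
  have sub: "B' \<subseteq> rat_vs.span B" "B \<subseteq> K" "B' \<subseteq> K"
    using B' span rat_vs.span_superset by auto
  have fin': "finite B'"
    using rat_vs.independent_span_bound[OF fin] B' sub by blast
  have repr: "rat_vs.representation C (x * b) d
      = (\<Sum>b'\<in>C'. rat_vs.representation C' b b' * rat_vs.representation C (x * b') d)"
    if C: "rat_vs.independent C" "rat_vs.span C = K" "rat_vs.independent C'" "rat_vs.span C' = K"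
      "finite C'" "b \<in> K" for C C' b d
  proof -
    have CK: "C' \<subseteq> K" using C rat_vs.span_superset by blast
    have "b = (\<Sum>b'\<in>C'. of_rat (rat_vs.representation C' b b') * b')"
      using rat_vs.sum_representation_eq[of C' b C'] C by simp
    then have "x * b = (\<Sum>b'\<in>C'. of_rat (rat_vs.representation C' b b') * (x * b'))"
      by (metis (no_types, lifting) mult.left_commute sum.cong sum_distrib_left)
    moreover have "of_rat r * (x * b') \<in> rat_vs.span C" if "b' \<in> C'" for r b'
      using mult[OF x] CK that C(2) rat_vs.span_scale[of "x * b'" C r] by auto
    ultimately have "rat_vs.representation C (x * b)
       = (\<lambda>d. \<Sum>b'\<in>C'. rat_vs.representation C (of_rat (rat_vs.representation C' b b') * (x * b')) d)"
      using rat_vs.representation_sum[OF C(1), of C'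
        "\<lambda>b'. of_rat (rat_vs.representation C' b b') * (x * b')"] by simp
    moreover have "rat_vs.representation C (of_rat r * (x * b')) d
        = r * rat_vs.representation C (x * b') d" if "b' \<in> C'" for r b' d
      using rat_vs.representation_scale[OF C(1), of "x * b'" r] mult[OF x] CK that C(2) by auto
    ultimately show ?thesis by simp
  qed
  have repr': "rat_vs.representation B' (x * b') b' =
     (\<Sum>b\<in>B. rat_vs.representation B (x * b') b * rat_vs.representation B' b b')"
    if "b' \<in> B'" for b'
  proof -
    have xb: "x * b' \<in> K" using mult x sub that by blast
    have "x * b' = (\<Sum>b\<in>B. of_rat (rat_vs.representation B (x * b') b) * b)"
      using rat_vs.sum_representation_eq[of B "x * b'" B] ind span fin xb by simp
    moreover have "of_rat r * b \<in> rat_vs.span B'" if "b \<in> B" for r b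
      using B' that sub rat_vs.span_scale[of b B' r] by auto
    ultimately have "rat_vs.representation B' (x * b')
       = (\<lambda>d. \<Sum>b\<in>B. rat_vs.representation B' (of_rat (rat_vs.representation B (x * b') b) * b) d)"
      using rat_vs.representation_sum[of B' B "\<lambda>b. of_rat (rat_vs.representation B (x * b') b) * b"] B'
      by simp
    moreover have "rat_vs.representation B' (of_rat r * b) d
        = r * rat_vs.representation B' b d" if "b \<in> B" for r b d
      using rat_vs.representation_scale[of B' b r] B' sub that by auto
    ultimately show ?thesis by simp
  qed
  have "field_trace K x = (\<Sum>b'\<in>B'. rat_vs.representation B' (x * b') b')"
    unfolding field_trace_def B'_def[symmetric] by (simp add: Let_def)
  also have "\<dots> = (\<Sum>b'\<in>B'. \<Sum>b\<in>B. rat_vs.representation B (x * b') b * rat_vs.representation B' b b')"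
    by (rule sum.cong) (auto simp: repr')
  also have "\<dots> = (\<Sum>b\<in>B. \<Sum>b'\<in>B'. rat_vs.representation B' b b' * rat_vs.representation B (x * b') b)"
    by (subst sum.swap) (simp add: mult.commute)
  also have "\<dots> = (\<Sum>b\<in>B. rat_vs.representation B (x * b) b)"
    by (rule sum.cong) (use repr[of B B'] ind span B' fin' sub in auto)
  finally show ?thesis .
qed

lemma field_trace_matrix:
  assumes x: "x \<in> K" and M: "\<And>b. b \<in> B \<Longrightarrow> x * b = (\<Sum>b'\<in>B. of_rat (M b b') * b')"
  shows "field_trace K x = (\<Sum>b\<in>B. M b b)"
proof -
  have "rat_vs.representation B (x * b) b = M b b" if b: "b \<in> B" for b
  proof -
    have "rat_vs.representation B (x * b) = (\<lambda>d. \<Sum>b'\<in>B. rat_vs.representation B (of_rat (M b b') * b') d)"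
      unfolding M[OF b]
      by (rule rat_vs.representation_sum[OF ind]) (auto intro: rat_vs.span_scale rat_vs.span_base)
    then have "rat_vs.representation B (x * b) b = (\<Sum>b'\<in>B. rat_vs.representation B (of_rat (M b b') * b') b)"
      by simp
    also have "\<dots> = (\<Sum>b'\<in>B. M b b' * (if b = b' then 1 else 0))"
      by (rule sum.cong)
        (auto simp: rat_vs.representation_scale[OF ind] rat_vs.representation_basis[OF ind] rat_vs.span_base)
    also have "\<dots> = M b b" using fin b by (simp add: if_distrib cong: if_cong)
    finally show ?thesis .
  qed
  then show ?thesis using field_trace_basis[OF x] by simp
qed

lemma field_trace_add:
  assumes "x \<in> K" "y \<in> K"
  shows "field_trace K (x + y) = field_trace K x + field_trace K y"
proof -
  have BK: "B \<subseteq> K" using span rat_vs.span_superset by blast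
  have xy: "x + y \<in> K" using assms span rat_vs.span_add by blast
  have "rat_vs.representation B ((x + y) * b) b
     = rat_vs.representation B (x * b) b + rat_vs.representation B (y * b) b" if "b \<in> B" for b
    using rat_vs.representation_add[OF ind, of "x * b" "y * b"] mult assms BK that span
    by (auto simp: distrib_right add.commute)
  then show ?thesis
    unfolding field_trace_basis[OF xy] field_trace_basis[OF assms(1)] field_trace_basis[OF assms(2)]
    by (simp add: sum.distrib)
qed

lemma field_trace_scale:
  assumes "x \<in> K"
  shows "field_trace K (of_rat r * x) = r * field_trace K x"
proof -
  have BK: "B \<subseteq> K" using span rat_vs.span_superset by blast
  have rx: "of_rat r * x \<in> K" using assms span rat_vs.span_scale by blast
  have "rat_vs.representation B (of_rat r * x * b) b = r * rat_vs.representation B (x * b) b"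
    if "b \<in> B" for b
    using rat_vs.representation_scale[OF ind, of "x * b" r] mult assms BK that span
    by (auto simp: mult.assoc)
  then show ?thesis
    unfolding field_trace_basis[OF rx] field_trace_basis[OF assms] by (simp add: sum_distrib_left)
qed

lemma field_trace_int_sum:
  assumes "finite I" "\<And>i. i \<in> I \<Longrightarrow> w i \<in> K"
  shows "field_trace K (\<Sum>i\<in>I. of_int (c i) * w i) = (\<Sum>i\<in>I. of_int (c i) * field_trace K (w i))
    \<and> (\<Sum>i\<in>I. of_int (c i) * w i) \<in> K"
  using assms
proof (induction I rule: finite_induct)
  case empty
  have "0 \<in> K" using span rat_vs.span_zero by blast
  moreover have "field_trace K 0 = 0" using field_trace_scale[OF \<open>0 \<in> K\<close>, of 0] by simp
  ultimately show ?case by simp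
next
  case (insert i I)
  have c: "of_int (c i) * w i \<in> K"
    using insert.prems span rat_vs.span_scale[of "w i" B "of_int (c i)"] by auto
  have "field_trace K (of_int (c i) * w i) = of_int (c i) * field_trace K (w i)"
    using field_trace_scale[of "w i" "of_int (c i)"] insert.prems by simp
  then show ?case using insert c field_trace_add[OF c] span rat_vs.span_add by auto
qed

end

section \<open>Integral bases and invariance of the discriminant\<close>

lemma int_basis_unique:
  assumes "int_basis ws M"
    and "(\<Sum>i<length ws. of_int (f i) * ws ! i) = (\<Sum>i<length ws. of_int (g i) * ws ! i)"
    and "i < length ws"
  shows "f i = g i"
proof -
  let ?l = "\<lambda>h. map h [0..<length ws]"
  have "?l f = ?l g"
    by (rule inj_onD[OF bij_betw_imp_inj_on[OF assms(1)[unfolded int_basis_def]]])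
      (use assms(2) in auto)
  then show ?thesis using assms(3) by (metis add_0 nth_map_upt diff_zero)
qed

lemma int_basis_repr:
  assumes "int_basis ws M" "x \<in> M"
  obtains f where "x = (\<Sum>i<length ws. of_int (f i) * ws ! i)"
proof -
  obtain ns where "x = (\<Sum>i<length ws. of_int (ns ! i) * ws ! i)"
    using bij_betw_imp_surj_on[OF assms(1)[unfolded int_basis_def]] assms(2) by auto
  then show ?thesis by (rule that)
qed

lemma int_basis_sum_mem:
  assumes "int_basis ws M"
  shows "(\<Sum>i<length ws. of_int (f i) * ws ! i) \<in> M"
proof -
  have "(\<Sum>i<length ws. of_int (map f [0..<length ws] ! i) * ws ! i) \<in> M"
    unfolding bij_betw_imp_surj_on[OF assms(1)[unfolded int_basis_def], symmetric]
    by (rule imageI) simp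
  then show ?thesis by simp
qed

lemma int_basis_nth_mem:
  assumes "int_basis ws M" "i < length ws"
  shows "ws ! i \<in> M"
proof -
  have "(\<Sum>j<length ws. of_int (if j = i then 1 else 0) * ws ! j)
     = (\<Sum>j<length ws. if j = i then ws ! j else 0)"
    by (rule sum.cong) auto
  also have "\<dots> = ws ! i" using assms(2) by simp
  finally show ?thesis using int_basis_sum_mem[OF assms(1)] by metis
qed

lemma int_basis_change:
  assumes w: "int_basis ws M" and w': "int_basis ws' M"
  obtains A A' :: "nat \<Rightarrow> nat \<Rightarrow> int" where
    "\<And>i. i < length ws' \<Longrightarrow> ws' ! i = (\<Sum>j<length ws. of_int (A i j) * ws ! j)"
    "\<And>j k. j < length ws \<Longrightarrow> k < length ws \<Longrightarrow>
       (\<Sum>i<length ws'. A' j i * A i k) = (if j = k then 1 else 0)"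
    "length ws' = length ws"
proof -
  let ?n = "length ws" and ?n' = "length ws'"
  have "\<forall>i\<in>{..<?n'}. \<exists>f. ws' ! i = (\<Sum>j<?n. of_int (f j) * ws ! j)"
    using int_basis_repr[OF w] int_basis_nth_mem[OF w'] by (metis lessThan_iff)
  from bchoice[OF this] obtain A :: "nat \<Rightarrow> nat \<Rightarrow> int" where
    A: "i < ?n' \<Longrightarrow> ws' ! i = (\<Sum>j<?n. of_int (A i j) * ws ! j)" for i
    by blast
  have "\<forall>i\<in>{..<?n}. \<exists>f. ws ! i = (\<Sum>j<?n'. of_int (f j) * ws' ! j)"
    using int_basis_repr[OF w'] int_basis_nth_mem[OF w] by (metis lessThan_iff)
  from bchoice[OF this] obtain A' :: "nat \<Rightarrow> nat \<Rightarrow> int" where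
    A': "i < ?n \<Longrightarrow> ws ! i = (\<Sum>j<?n'. of_int (A' i j) * ws' ! j)" for i
    by blast
  have inverse: "(\<Sum>i<length vs'. P' j i * P i k) = (if j = k then 1 else 0)"
    if v: "int_basis vs M" "j < length vs" "k < length vs"
      and P: "\<And>i. i < length vs' \<Longrightarrow> vs' ! i = (\<Sum>j<length vs. of_int (P i j) * vs ! j)"
      and P': "\<And>i. i < length vs \<Longrightarrow> vs ! i = (\<Sum>j<length vs'. of_int (P' i j) * vs' ! j)"
    for vs vs' :: "'a list" and P P' :: "nat \<Rightarrow> nat \<Rightarrow> int" and j k
  proof -
    have "(\<Sum>k<length vs. of_int (if j = k then 1 else 0) * vs ! k)
        = (\<Sum>k<length vs. if k = j then vs ! k else 0)"
      by (rule sum.cong) auto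
    also have "\<dots> = vs ! j" using v(2) by simp
    also have "\<dots> = (\<Sum>i<length vs'. of_int (P' j i) * vs' ! i)" by (rule P'[OF v(2)])
    also have "\<dots> = (\<Sum>i<length vs'. \<Sum>k<length vs. of_int (P' j i) * (of_int (P i k) * vs ! k))"
      by (rule sum.cong) (simp_all add: P sum_distrib_left)
    also have "\<dots> = (\<Sum>k<length vs. of_int (\<Sum>i<length vs'. P' j i * P i k) * vs ! k)"
      by (subst sum.swap) (simp add: sum_distrib_right mult.assoc)
    finally have eq: "(\<Sum>k<length vs. of_int (if j = k then 1 else 0) * vs ! k)
      = (\<Sum>k<length vs. of_int (\<Sum>i<length vs'. P' j i * P i k) * vs ! k)" .
    show ?thesis by (rule int_basis_unique[OF v(1) eq v(3), symmetric])
  qed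
  have 1: "(\<Sum>i<?n'. A' j i * A i k) = (if j = k then 1 else 0)" if "j < ?n" "k < ?n" for j k
    using inverse[OF w that A A'] .
  have 2: "(\<Sum>i<?n. A j i * A' i k) = (if j = k then 1 else 0)" if "j < ?n'" "k < ?n'" for j k
    using inverse[OF w' that A' A] .
  \<comment> \<open>Nothing in \<open>int_basis\<close> fixes the length of a basis. The transition
    matrices are inverse to each other on both sides, and equating the traces of the two products
    gives equality of lengths.\<close>
  have "int ?n = (\<Sum>j<?n. \<Sum>i<?n'. A' j i * A i j)" by (simp add: 1)
  also have "\<dots> = (\<Sum>i<?n'. \<Sum>j<?n. A i j * A' j i)"
    by (subst sum.swap) (simp add: mult.commute)
  also have "\<dots> = int ?n'" by (simp add: 2)
  finally have "?n' = ?n" by simp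
  then show ?thesis using that A 1 by blast
qed

text \<open>One integral basis determines \<open>field_disc\<close>: another one changes the Gram
  matrix G of the trace form to P G P^T with P integrally invertible, so det P is 1 or -1 and the
  determinant is unchanged.\<close>

lemma field_disc_eqI:
  fixes K :: "'a::field_char_0 set"
  assumes B: "finite B" "rat_vs.independent B" "rat_vs.span B = K"
    and mult: "\<And>x y. x \<in> K \<Longrightarrow> y \<in> K \<Longrightarrow> x * y \<in> K"
    and ws: "int_basis ws (ring_of_integers K)"
    and D: "of_int D = det (mat (length ws) (length ws) (\<lambda>(i, j). field_trace K (ws ! i * ws ! j)))"
  shows "field_disc K = D"
  unfolding field_disc_def
proof (rule the_equality)
  show "\<exists>ws. int_basis ws (ring_of_integers K) \<and>
     of_int D = det (mat (length ws) (length ws) (\<lambda>(i, j). field_trace K (ws ! i * ws ! j)))"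
    using ws D by blast
next
  fix D'
  assume "\<exists>ws. int_basis ws (ring_of_integers K) \<and>
     of_int D' = det (mat (length ws) (length ws) (\<lambda>(i, j). field_trace K (ws ! i * ws ! j)))"
  then obtain ws' where ws': "int_basis ws' (ring_of_integers K)"
    and D': "of_int D' = det (mat (length ws') (length ws') (\<lambda>(i, j). field_trace K (ws' ! i * ws' ! j)))"
    by blast
  obtain A A' :: "nat \<Rightarrow> nat \<Rightarrow> int" where
    A: "\<And>i. i < length ws' \<Longrightarrow> ws' ! i = (\<Sum>j<length ws. of_int (A i j) * ws ! j)"
    and inv: "\<And>j k. j < length ws \<Longrightarrow> k < length ws \<Longrightarrow>
       (\<Sum>i<length ws'. A' j i * A i k) = (if j = k then 1 else 0)"
    and len: "length ws' = length ws"
    by (rule int_basis_change[OF ws ws']) blast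
  define n where "n = length ws"
  define P where "P = mat n n (\<lambda>(i, j). A i j)"
  define P' where "P' = mat n n (\<lambda>(i, j). A' i j)"
  define Pq where "Pq = map_mat rat_of_int P"
  define G where "G = mat n n (\<lambda>(i, j). field_trace K (ws ! i * ws ! j))"
  have cP: "P \<in> carrier_mat n n" "P' \<in> carrier_mat n n" "Pq \<in> carrier_mat n n" "G \<in> carrier_mat n n"
    by (simp_all add: P_def P'_def Pq_def G_def)
  have "P' * P = 1\<^sub>m n"
    by (rule eq_matI) (use inv len in \<open>auto simp: P_def P'_def n_def scalar_prod_def atLeast0LessThan\<close>)
  then have "det P' * det P = 1" using det_mult[OF cP(2,1)] by simp
  then have "det P dvd 1" by (metis dvd_triv_right)
  then have "det P * det P = 1" by (metis abs_mult_self_eq mult_1 zdvd1_eq)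
  moreover have "det Pq = of_int (det P)" unfolding Pq_def by simp
  ultimately have detPq: "det Pq * det Pq = 1" by (metis of_int_1 of_int_mult)
  have wsK: "ws ! i \<in> K" if "i < n" for i
    using int_basis_nth_mem[OF ws] that by (simp add: n_def ring_of_integers_def)
  have tr: "field_trace K (ws' ! i * ws' ! j)
      = (\<Sum>k<n. \<Sum>l<n. of_int (A i k) * field_trace K (ws ! k * ws ! l) * of_int (A j l))"
    if "i < n" "j < n" for i j
  proof -
    note tsum = field_trace_int_sum[OF B mult, of "{..<n}"]
    have 1: "ws ! k * ws' ! j = (\<Sum>l<n. of_int (A j l) * (ws ! k * ws ! l))" for k
      using A[of j] that len by (simp add: n_def sum_distrib_left mult.left_commute)
    have t1: "field_trace K (ws ! k * ws' ! j)
        = (\<Sum>l<n. of_int (A j l) * field_trace K (ws ! k * ws ! l)) \<and> ws ! k * ws' ! j \<in> K"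
      if "k < n" for k
      unfolding 1 by (rule tsum) (use mult wsK that in auto)
    have 2: "ws' ! i * ws' ! j = (\<Sum>k<n. of_int (A i k) * (ws ! k * ws' ! j))"
      using A[of i] that len by (simp add: n_def sum_distrib_right mult.assoc)
    have "field_trace K (ws' ! i * ws' ! j)
        = (\<Sum>k<n. of_int (A i k) * field_trace K (ws ! k * ws' ! j))"
      unfolding 2 by (rule tsum[THEN conjunct1]) (use t1 in auto)
    also have "\<dots> = (\<Sum>k<n. \<Sum>l<n. of_int (A i k) * field_trace K (ws ! k * ws ! l) * of_int (A j l))"
      by (rule sum.cong) (simp_all add: t1 sum_distrib_left mult_ac)
    finally show ?thesis .
  qed
  have "mat n n (\<lambda>(i, j). field_trace K (ws' ! i * ws' ! j)) = Pq * G * transpose_mat Pq"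
  proof (rule eq_matI)
    fix i j assume "i < dim_row (Pq * G * transpose_mat Pq)" "j < dim_col (Pq * G * transpose_mat Pq)"
    then have ij: "i < n" "j < n" by (simp_all add: Pq_def P_def)
    have "(Pq * G * transpose_mat Pq) $$ (i, j)
        = (\<Sum>l<n. (\<Sum>k<n. of_int (A i k) * field_trace K (ws ! k * ws ! l)) * of_int (A j l))"
      using ij by (simp add: Pq_def P_def G_def scalar_prod_def atLeast0LessThan)
    also have "\<dots> = (\<Sum>k<n. \<Sum>l<n. of_int (A i k) * field_trace K (ws ! k * ws ! l) * of_int (A j l))"
      by (subst sum.swap) (simp add: sum_distrib_right)
    finally show "mat n n (\<lambda>(i, j). field_trace K (ws' ! i * ws' ! j)) $$ (i, j)
        = (Pq * G * transpose_mat Pq) $$ (i, j)"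
      using ij tr by simp
  qed (simp_all add: Pq_def P_def)
  then have "of_int D' = det (Pq * G * transpose_mat Pq)" using D' len by (simp add: n_def)
  also have "\<dots> = det Pq * det G * det Pq"
    using cP by (simp add: det_mult[of _ n] det_transpose)
  also have "\<dots> = det G" using detPq by (simp add: mult.commute mult.left_commute)
  also have "\<dots> = of_int D" using D by (simp add: G_def n_def)
  finally show "D' = D" by simp
qed

section \<open>Quadratic fields\<close>

lemma of_int_poly_add:
  "map_poly of_int (p + q) = map_poly of_int p + (map_poly of_int q :: 'a::comm_ring_1 poly)"
  by (intro poly_eqI) (simp add: coeff_map_poly)

lemma of_int_poly_mult:
  "map_poly of_int (p * q) = map_poly of_int p * (map_poly of_int q :: 'a::comm_ring_1 poly)"
  by (intro poly_eqI) (simp add: coeff_map_poly coeff_mult)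

text \<open>Gauss's lemma. Clearing denominators and content gives a primitive integral quadratic
  \<open>G\<close> with root \<open>x\<close>, and \<open>P\<close> is a monic integral polynomial
  with root \<open>x\<close>. Pseudo-division of \<open>P\<close> by \<open>G\<close> leaves a
  remainder of degree at most 1, which vanishes since \<open>x\<close> is irrational. Comparing
  contents shows that the leading coefficient of \<open>G\<close> is a unit.\<close>

lemma algebraic_int_quadratic:
  fixes x :: "'a::field_char_0"
  assumes alg: "algebraic_int x" and irr: "x \<notin> \<rat>" and root: "x^2 - of_rat t * x + of_rat n = 0"
  shows "t \<in> \<int>" "n \<in> \<int>"
proof -
  obtain P :: "int poly" where P: "poly (map_poly of_int P) x = 0" "lead_coeff P = 1"
    using alg unfolding algebraic_int_altdef_ipoly by blast
  obtain t1 t2 where t: "t = of_int t1 / of_int t2" "t2 > 0" by (metis Fract_of_int_quotient Rat_cases)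
  obtain n1 n2 where n: "n = of_int n1 / of_int n2" "n2 > 0" by (metis Fract_of_int_quotient Rat_cases)
  define G0 where "G0 = [:n1 * t2, - (t1 * n2), t2 * n2:]"
  define c where "c = content G0"
  define G where "G = primitive_part G0"
  define a where "a = lead_coeff G"
  have G0: "G0 \<noteq> 0" "degree G0 = 2" using t n by (simp_all add: G0_def)
  have c: "c \<noteq> 0" using G0 by (simp add: c_def)
  have G0_eq: "G0 = smult c G" by (simp add: c_def G_def)
  have contG: "content G = 1" using G0 by (simp add: G_def)
  have degG: "degree G = 2" using G0 by (simp add: G_def)
  have G: "G \<noteq> 0" using degG by auto
  have coeffs: "c * coeff G 0 = n1 * t2" "c * coeff G 1 = - (t1 * n2)" "c * a = t2 * n2"
  proof -
    have "c * coeff G i = coeff G0 i" for i by (simp add: G0_eq)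
    from this[of 0] this[of 1] this[of 2]
    show "c * coeff G 0 = n1 * t2" "c * coeff G 1 = - (t1 * n2)" "c * a = t2 * n2"
      by (simp_all add: G0_def a_def degG numeral_2_eq_2)
  qed
  have "poly (map_poly of_int G0) x = of_int (t2 * n2) * (x^2 - of_rat t * x + of_rat n)"
  proof -
    have A: "of_int t2 * of_rat t = (of_int t1 :: 'a)" and B: "of_int n2 * of_rat n = (of_int n1 :: 'a)"
      using t n by (simp_all add: of_rat_divide)
    have "of_int (t2 * n2) * (x^2 - of_rat t * x + of_rat n)
      = of_int t2 * of_int n2 * x^2 - (of_int t2 * of_rat t) * of_int n2 * x + of_int t2 * (of_int n2 * of_rat n)"
      by (simp add: algebra_simps)
    then show ?thesis unfolding A B
      by (simp add: G0_def map_poly_pCons algebra_simps power2_eq_square)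
  qed
  then have rootG: "poly (map_poly of_int G) x = 0"
    using root c by (simp add: G0_eq map_poly_smult)
  obtain Q R where QR: "pseudo_divmod P G = (Q, R)" by fastforce
  define k where "k = Suc (degree P) - degree G"
  have div: "smult (a ^ k) P = G * Q + R" and R: "R = 0 \<or> degree R < 2"
    using pseudo_divmod[OF G QR] by (simp_all add: a_def k_def degG)
  have "poly (map_poly of_int (smult (a ^ k) P)) x = (0 :: 'a)" by (simp add: map_poly_smult P)
  then have rootR: "poly (map_poly of_int R) x = (0 :: 'a)"
    unfolding div by (simp add: of_int_poly_add of_int_poly_mult rootG)
  have "R = 0"
  proof (rule ccontr)
    assume "R \<noteq> 0"
    then have "degree R < 2" using R by blast
    then have R_eq: "R = [:coeff R 0, coeff R 1:]"
      by (intro poly_eqI) (auto simp: coeff_pCons coeff_eq_0 split: nat.split)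
    have "of_int (coeff R 0) + x * of_int (coeff R 1) = 0"
      using rootR by (subst (asm) R_eq) (simp add: map_poly_pCons mult.commute)
    moreover from this have "coeff R 1 \<noteq> 0" using \<open>R \<noteq> 0\<close> R_eq by auto
    ultimately have "x = - of_int (coeff R 0) / of_int (coeff R 1)" by (simp add: field_simps add_eq_0_iff)
    then show False using irr by (metis Rats_divide Rats_minus_iff Rats_of_int)
  qed
  then have div: "smult (a ^ k) P = G * Q" using div by simp
  have "content P dvd 1" using content_dvd_coeff[of P "degree P"] P(2) by simp
  then have "content P = 1" by (metis is_unit_normalize normalize_content)
  \<comment> \<open>As \<open>P\<close> and \<open>G\<close> have content 1, all of
    \<open>a ^ k\<close> sits in \<open>Q\<close>. Comparing leading coefficients, \<open>a\<close>
    times an integer is then 1 or -1.\<close>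
  then have "\<bar>a ^ k\<bar> = content Q"
    using arg_cong[OF div, of content] contG by (simp add: content_mult)
  then have "Q = smult \<bar>a ^ k\<bar> (primitive_part Q)" by simp
  then have "lead_coeff Q = \<bar>a ^ k\<bar> * lead_coeff (primitive_part Q)" by (metis lead_coeff_smult)
  then have "a ^ k = a * (\<bar>a ^ k\<bar> * lead_coeff (primitive_part Q))"
    using arg_cong[OF div, of lead_coeff] P(2) G by (simp add: lead_coeff_mult a_def)
  moreover have "a \<noteq> 0" using G by (simp add: a_def)
  ultimately have "\<bar>a ^ k\<bar> * 1 = \<bar>a ^ k\<bar> * (\<bar>a\<bar> * \<bar>lead_coeff (primitive_part Q)\<bar>)"
    by (metis abs_abs abs_mult mult.left_commute mult.right_neutral)
  then have "\<bar>a\<bar> * \<bar>lead_coeff (primitive_part Q)\<bar> = 1" using \<open>a \<noteq> 0\<close> by simp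
  then have "a dvd 1" by (metis abs_dvd_iff dvd_triv_left)
  then have "a * a = 1" by (metis abs_mult_self_eq mult_1 zdvd1_eq)
  then have aa: "of_int a * (of_int a * r) = r" for r :: rat
    by (metis mult.assoc mult_1 of_int_1 of_int_mult)
  have coeffs': "of_int c * of_int a = (of_int t2 * of_int n2 :: rat)"
    "of_int c * of_int (- coeff G 1) = (of_int t1 * of_int n2 :: rat)"
    "of_int c * of_int (coeff G 0) = (of_int n1 * of_int t2 :: rat)"
    using coeffs by (simp_all flip: of_int_mult)
  have "of_int c * of_int a * t = of_int c * of_int (- coeff G 1)"
    unfolding coeffs' using t n by simp
  then have "of_int a * t = of_int (- coeff G 1)"
    using c by (metis mult.assoc mult_left_cancel of_int_eq_0_iff)
  then have "t = of_int a * of_int (- coeff G 1)" using aa[of t] by simp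
  then show "t \<in> \<int>" by (metis Ints_of_int of_int_mult)
  have "of_int c * of_int a * n = of_int c * of_int (coeff G 0)"
    unfolding coeffs' using t n by simp
  then have "of_int a * n = of_int (coeff G 0)"
    using c by (metis mult.assoc mult_left_cancel of_int_eq_0_iff)
  then have "n = of_int a * of_int (coeff G 0)" using aa[of n] by simp
  then show "n \<in> \<int>" by (metis Ints_of_int of_int_mult)
qed

lemma algebraic_int_quadratic_root:
  fixes x :: "'a::field_char_0"
  assumes "x^2 - of_int t * x + of_int n = 0"
  shows "algebraic_int x"
proof (rule algebraic_int.intros)
  show "lead_coeff [:of_int n, - of_int t, 1 :: 'a:] = 1" by simp
  show "\<forall>i. coeff [:of_int n, - of_int t, 1 :: 'a:] i \<in> \<int>"
    by (auto simp: coeff_pCons split: nat.split)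
  show "poly [:of_int n, - of_int t, 1 :: 'a:] x = 0"
    using assms by (simp add: algebra_simps power2_eq_square)
qed

lemma int_basis_pairI:
  assumes "M = {of_int m * u + of_int n * v | m n :: int. True}"
    and "\<And>m n :: int. of_int m * u + of_int n * v = 0 \<Longrightarrow> m = 0 \<and> n = 0"
  shows "int_basis [u, v] M"
proof -
  have len: "ns = [ns ! 0, ns ! 1]" if "length ns = 2" for ns :: "int list"
    using that by (cases ns; cases "tl ns") auto
  have sum: "(\<Sum>i<length [u, v]. of_int (ns ! i) * [u, v] ! i) = of_int (ns ! 0) * u + of_int (ns ! 1) * v"
    for ns :: "int list" by (simp add: numeral_2_eq_2)
  show ?thesis unfolding int_basis_def sum
  proof (rule bij_betw_imageI)
    show "inj_on (\<lambda>ns. of_int (ns ! 0) * u + of_int (ns ! 1) * v) {ns :: int list. length ns = length [u, v]}"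
    proof (rule inj_onI)
      fix ms ns :: "int list"
      assume *: "ms \<in> {ns. length ns = length [u, v]}" "ns \<in> {ns. length ns = length [u, v]}"
        "of_int (ms ! 0) * u + of_int (ms ! 1) * v = of_int (ns ! 0) * u + of_int (ns ! 1) * v"
      have "of_int (ms ! 0 - ns ! 0) * u + of_int (ms ! 1 - ns ! 1) * v = 0"
        using *(3) by (simp add: algebra_simps)
      then have "ms ! 0 = ns ! 0" "ms ! 1 = ns ! 1" using assms(2) by fastforce+
      then show "ms = ns" using len[of ms] len[of ns] * by simp
    qed
    show "(\<lambda>ns. of_int (ns ! 0) * u + of_int (ns ! 1) * v) ` {ns :: int list. length ns = length [u, v]} = M"
    proof
      show "M \<subseteq> (\<lambda>ns. of_int (ns ! 0) * u + of_int (ns ! 1) * v) ` {ns :: int list. length ns = length [u, v]}"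
      proof
        fix x assume "x \<in> M"
        then obtain m n :: int where "x = of_int m * u + of_int n * v" using assms(1) by blast
        then show "x \<in> (\<lambda>ns. of_int (ns ! 0) * u + of_int (ns ! 1) * v) ` {ns :: int list. length ns = length [u, v]}"
          by (intro image_eqI[of _ _ "[m, n]"]) simp_all
      qed
    qed (use assms(1) in blast)
  qed
qed

lemma det_mat_2: "det (mat 2 2 f) = f (0, 0) * f (1, 1) - f (0, 1) * f (1, 0)"
proof -
  have *: "det A = A $$ (0, 0)" if "dim_row A = 1" "dim_col A = 1" for A :: "'a mat"
    using that by (intro det_single) auto
  have "det (mat 2 2 f) = (\<Sum>j<2. mat 2 2 f $$ (0, j) * cofactor (mat 2 2 f) 0 j)"
    by (rule laplace_expansion_row) auto
  then show ?thesis by (simp add: numeral_2_eq_2 cofactor_def * mat_delete_def)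
qed

section \<open>Rings of integers of quadratic fields\<close>

locale quadratic_field =
  fixes K :: "'a::field_char_0 set" and \<delta> :: 'a and D :: int
  assumes sq: "\<delta>^2 = of_int D" and irrational: "\<delta> \<notin> \<rat>"
    and K_eq: "K = {of_rat p + of_rat q * \<delta> | p q. True}"
begin

lemma mem: "of_rat p + of_rat q * \<delta> \<in> K"
  unfolding K_eq by blast

lemma coeff_zero:
  assumes "of_rat p + of_rat q * \<delta> = 0"
  shows "p = 0" "q = 0"
proof -
  show "q = 0"
  proof (rule ccontr)
    assume "q \<noteq> 0"
    then have "\<delta> = of_rat (- p / q)"
      using assms by (simp add: of_rat_divide of_rat_minus field_simps add_eq_0_iff)
    then show False using irrational by (metis Rats_of_rat)
  qed
  then show "p = 0" using assms by simp
qed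

lemma mult_closed: "x \<in> K \<Longrightarrow> y \<in> K \<Longrightarrow> x * y \<in> K"
proof -
  assume "x \<in> K" "y \<in> K"
  then obtain p q r s where xy: "x = of_rat p + of_rat q * \<delta>" "y = of_rat r + of_rat s * \<delta>"
    unfolding K_eq by blast
  have "x * y = of_rat (p * r) + of_rat (p * s + q * r) * \<delta> + of_rat (q * s) * \<delta>^2"
    unfolding xy by (simp add: of_rat_add of_rat_mult algebra_simps power2_eq_square)
  also have "\<dots> = of_rat (p * r + q * s * of_int D) + of_rat (p * s + q * r) * \<delta>"
    unfolding sq by (simp add: of_rat_add of_rat_mult algebra_simps)
  finally show "x * y \<in> K" using mem by metis
qed

lemma basis: "finite {1, \<delta>}" "rat_vs.independent {1, \<delta>}" "rat_vs.span {1, \<delta>} = K"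
proof -
  show "finite {1, \<delta>}" by simp
  have "\<delta> \<notin> rat_vs.span {1}"
    using irrational by (auto simp: rat_vs.span_singleton)
  moreover have "rat_vs.independent {1 :: 'a}" by simp
  ultimately have "rat_vs.independent (insert \<delta> {1})" by (rule rat_vs.independent_insertI)
  then show "rat_vs.independent {1, \<delta>}" by (simp add: insert_commute)
  have "x \<in> rat_vs.span {1, \<delta>} \<longleftrightarrow> (\<exists>p q. x = of_rat p + of_rat q * \<delta>)" for x
  proof -
    have "x \<in> rat_vs.span {1, \<delta>} \<longleftrightarrow> (\<exists>p q. x - of_rat p * 1 = of_rat q * \<delta>)"
      by (auto simp: rat_vs.span_insert rat_vs.span_singleton)
    also have "\<dots> \<longleftrightarrow> (\<exists>p q. x = of_rat p + of_rat q * \<delta>)"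
      by (auto simp: diff_eq_eq add.commute)
    finally show ?thesis .
  qed
  then show "rat_vs.span {1, \<delta>} = K" unfolding K_eq by blast
qed

lemma trace: "field_trace K (of_rat p + of_rat q * \<delta>) = 2 * p"
proof -
  have ne: "1 \<noteq> \<delta>" using irrational by (metis Rats_1)
  define M where "M = (\<lambda>(b :: 'a) (b' :: 'a). if b = 1 then (if b' = 1 then p else q)
    else if b' = 1 then q * of_int D else p)"
  have "(of_rat p + of_rat q * \<delta>) * \<delta> = of_rat p * \<delta> + of_rat q * \<delta>^2"
    by (simp add: algebra_simps power2_eq_square)
  then have "(of_rat p + of_rat q * \<delta>) * \<delta> = of_rat (q * of_int D) + of_rat p * \<delta>"
    by (simp add: sq of_rat_mult)
  then have "field_trace K (of_rat p + of_rat q * \<delta>) = (\<Sum>b\<in>{1, \<delta>}. M b b)"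
    using ne by (intro field_trace_matrix[OF basis mult_closed mem]) (auto simp: M_def)
  also have "\<dots> = 2 * p" using ne by (simp add: M_def)
  finally show ?thesis .
qed

lemma quadratic_relation:
  "(of_rat p + of_rat q * \<delta>)^2 - of_rat (2 * p) * (of_rat p + of_rat q * \<delta>)
    + of_rat (p^2 - of_int D * q^2) = 0"
proof -
  have 1: "of_rat (2 * p) = (2 * of_rat p :: 'a)" by (simp add: of_rat_mult)
  have 2: "of_rat (p^2 - of_int D * q^2) = (of_rat p)^2 - \<delta>^2 * (of_rat q)^2"
    by (simp add: of_rat_diff of_rat_mult of_rat_power sq)
  show ?thesis unfolding 1 2 by (simp add: algebra_simps power2_eq_square)
qed

text \<open>Integrality means that trace \<open>2 * p\<close> and norm are integers. With
  \<open>2 * q = r / e\<close> in lowest terms, the norm condition forces \<open>e^2\<close> to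
  divide \<open>D\<close> with quotient 0 or 1 modulo 4, and minimality gives \<open>e = 1\<close>.
  The congruence between \<open>t\<close> and \<open>D * w\<close> treats even and odd
  \<open>D\<close> together.\<close>

lemma algebraic_int_iff:
  assumes min: "minimal_disc D"
  shows "algebraic_int (of_rat p + of_rat q * \<delta>) \<longleftrightarrow>
    (\<exists>t w. 2 * p = of_int t \<and> 2 * q = of_int w \<and> [t = D * w] (mod 2))"
proof
  assume alg: "algebraic_int (of_rat p + of_rat q * \<delta>)"
  have norm: "2 * p \<in> \<int> \<and> p^2 - of_int D * q^2 \<in> \<int>"
  proof (cases "q = 0")
    case True
    then have "(of_rat p :: 'a) \<in> \<int>" using alg rational_algebraic_int_is_int[of "of_rat p :: 'a"] by simp
    then obtain z where "(of_rat p :: 'a) = of_int z" by (rule Ints_cases)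
    then have "p = of_int z" by (metis of_rat_eq_iff of_rat_of_int_eq)
    then show ?thesis using True by (auto simp flip: of_int_power)
  next
    case False
    have "of_rat p + of_rat q * \<delta> \<notin> \<rat>"
    proof
      assume "of_rat p + of_rat q * \<delta> \<in> \<rat>"
      then obtain r where "of_rat p + of_rat q * \<delta> = of_rat r" by (rule Rats_cases)
      then have "of_rat (p - r) + of_rat q * \<delta> = 0" by (simp add: of_rat_diff algebra_simps)
      then show False using coeff_zero False by blast
    qed
    moreover have "(of_rat p + of_rat q * \<delta>)^2 - of_rat (2 * p) * (of_rat p + of_rat q * \<delta>)
        + of_rat (p^2 - of_int D * q^2) = 0"
      by (rule quadratic_relation)
    ultimately show ?thesis using algebraic_int_quadratic[OF alg] by blast
  qed
  then obtain t n where t: "2 * p = of_int t" and n: "p^2 - of_int D * q^2 = of_int n"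
    by (auto elim!: Ints_cases)
  obtain r e where re: "quotient_of (2 * q) = (r, e)" by fastforce
  have w: "2 * q = of_int r / of_int e" and e: "e > 0" and cop: "coprime r e"
    using quotient_of_div[OF re] quotient_of_denom_pos[OF re] quotient_of_coprime[OF re] by auto
  have "(2 * p)^2 - of_int D * (2 * q)^2 = 4 * of_int n"
    using n by (simp add: power2_eq_square algebra_simps)
  then have "of_int ((t^2 - 4 * n) * e^2) = (of_int (D * r^2) :: rat)"
    unfolding t w using e by (simp add: field_simps)
  then have eq: "(t^2 - 4 * n) * e^2 = D * r^2" by (simp only: of_int_eq_iff)
  then have "e^2 dvd D * r^2" by (metis dvd_triv_right)
  moreover have "coprime (e^2) (r^2)" using cop by (simp add: coprime_commute)
  ultimately have "e^2 dvd D" by (simp add: coprime_dvd_mult_left_iff)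
  then obtain D' where D': "D = e^2 * D'" ..
  have eq': "t^2 - 4 * n = D' * r^2" using eq e by (simp add: D')
  have mod4: "D mod 4 \<in> {0, 1}" using min by (simp add: minimal_disc_def)
  have odd_sq: "z^2 mod 4 = 1" if "odd z" for z :: int
  proof -
    have "z mod 4 = 1 \<or> z mod 4 = 3" using that by presburger
    then have "(z mod 4)^2 mod 4 = 1" by auto
    then show ?thesis by (simp add: power_mod)
  qed
  \<comment> \<open>If \<open>r\<close> is even then \<open>e\<close> is odd, and division by
    \<open>e^2\<close> preserves the residue modulo 4. If \<open>r\<close> is odd then
    \<open>D'\<close> is congruent to \<open>D' * r^2\<close>, hence to \<open>t^2\<close>.\<close>
  have "D' mod 4 \<in> {0, 1}"
  proof (cases "even r")
    case True
    then have "odd e" using cop by (metis coprime_common_divisor odd_one)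
    then have "D' mod 4 = D mod 4" unfolding D' by (metis mod_mult_left_eq mult_1 odd_sq)
    then show ?thesis using mod4 by simp
  next
    case False
    then have "D' mod 4 = D' * r^2 mod 4" by (metis mod_mult_right_eq mult.right_neutral odd_sq)
    also have "\<dots> = t^2 mod 4" unfolding eq'[symmetric] by presburger
    finally show ?thesis using square_mod_4[of t] by simp
  qed
  then have "e = 1" using minimal_discD[of e D'] min e D' by auto
  then have "t^2 - 4 * n = D * r^2" "2 * q = of_int r" using eq' D' w by auto
  moreover from this(1) have "even (t^2 - 4 * n) = even (D * r^2)" by simp
  then have "[t = D * r] (mod 2)" by (auto simp: cong_def mod2_eq_if)
  ultimately show "\<exists>t w. 2 * p = of_int t \<and> 2 * q = of_int w \<and> [t = D * w] (mod 2)"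
    using t by blast
next
  assume "\<exists>t w. 2 * p = of_int t \<and> 2 * q = of_int w \<and> [t = D * w] (mod 2)"
  then obtain t w where t: "2 * p = of_int t" and w: "2 * q = of_int w" and c: "[t = D * w] (mod 2)"
    by blast
  obtain s where s: "t = D * w + 2 * s"
    using c by (metis cong_iff_lin mult.commute cong_sym)
  \<comment> \<open>Since \<open>D\<close> is 0 or 1 modulo 4, 4 divides \<open>D * (D - 1)\<close>.
    This is what makes the norm integral after substituting
    \<open>t = D * w + 2 * s\<close>.\<close>
  obtain j where j: "D * D - D = 4 * j"
  proof -
    have "D mod 4 = 0 \<or> D mod 4 = 1" using min by (auto simp: minimal_disc_def)
    then consider m where "D = 4 * m" | m where "D = 4 * m + 1"
      by (metis mult_div_mod_eq add.right_neutral)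
    then show ?thesis
    proof cases
      case 1
      then show ?thesis using that[of "m * (D - 1)"] by (simp add: algebra_simps)
    next
      case 2
      then show ?thesis using that[of "m * D"] by (simp add: algebra_simps)
    qed
  qed
  have "t^2 - D * w^2 = 4 * (w^2 * j + D * w * s + s^2)"
  proof -
    have "t^2 - D * w^2 = w^2 * (D * D - D) + 4 * (D * w * s + s^2)"
      unfolding s by (simp add: algebra_simps power2_eq_square)
    then show ?thesis unfolding j by (simp add: algebra_simps)
  qed
  then obtain n where n: "t^2 - D * w^2 = 4 * n" by blast
  have "p^2 - of_int D * q^2 = of_int n"
  proof -
    have "4 * (p^2 - of_int D * q^2) = (2 * p)^2 - of_int D * (2 * q)^2"
      by (simp add: power2_eq_square algebra_simps)
    also have "\<dots> = of_int (t^2 - D * w^2)" unfolding t w by simp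
    finally show ?thesis unfolding n by simp
  qed
  then have n': "of_int n = (of_rat (p^2 - of_int D * q^2) :: 'a)" by (metis of_rat_of_int_eq)
  have t': "of_int t = (of_rat (2 * p) :: 'a)" by (metis t of_rat_of_int_eq)
  have "(of_rat p + of_rat q * \<delta>)^2 - of_int t * (of_rat p + of_rat q * \<delta>) + of_int n = 0"
    unfolding n' t' by (rule quadratic_relation)
  then show "algebraic_int (of_rat p + of_rat q * \<delta>)"
    by (rule algebraic_int_quadratic_root)
qed

lemma field_disc_eq:
  assumes min: "minimal_disc D"
  shows "field_disc K = D"
proof -
  \<comment> \<open>The generator \<open>(D + \<delta>) / 2\<close> serves both parities of
    \<open>D\<close>. The Gram determinant of \<open>1, \<omega>\<close> is
    \<open>2 * (D^2 + D) / 2 - D^2 = D\<close>.\<close>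
  define \<omega> where "\<omega> = of_rat (of_int D / 2) + of_rat (1/2) * \<delta>"
  have comb: "of_int m * 1 + of_int n * \<omega> = of_rat (of_int m + of_int D * of_int n / 2) + of_rat (of_int n / 2) * \<delta>"
    for m n :: int
    by (simp add: \<omega>_def of_rat_add of_rat_mult of_rat_divide algebra_simps)
  have ws: "int_basis [1, \<omega>] (ring_of_integers K)"
  proof (rule int_basis_pairI)
    show "ring_of_integers K = {of_int m * 1 + of_int n * \<omega> | m n :: int. True}"
    proof (rule subset_antisym; rule subsetI)
      fix x assume "x \<in> ring_of_integers K"
      then obtain p q where x: "x = of_rat p + of_rat q * \<delta>" and alg: "algebraic_int x"
        unfolding ring_of_integers_def K_eq by blast
      obtain t w where tw: "2 * p = of_int t" "2 * q = of_int w" "[t = D * w] (mod 2)"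
        using alg algebraic_int_iff[OF min] unfolding x by blast
      obtain s where s: "t = D * w + 2 * s"
        using tw(3) by (metis cong_iff_lin mult.commute cong_sym)
      have "p = of_int s + of_int D * of_int w / 2" using tw(1) unfolding s by simp
      moreover have "q = of_int w / 2" using tw(2) by simp
      ultimately have "x = of_int s * 1 + of_int w * \<omega>" unfolding comb x by simp
      then show "x \<in> {of_int m * 1 + of_int n * \<omega> | m n :: int. True}" by blast
    next
      fix x assume "x \<in> {of_int m * 1 + of_int n * \<omega> | m n :: int. True}"
      then obtain m n :: int where x: "x = of_int m * 1 + of_int n * \<omega>" by blast
      have "algebraic_int x" unfolding x comb algebraic_int_iff[OF min]
        by (rule exI[of _ "2 * m + n * D"], rule exI[of _ n]) (simp add: cong_def algebra_simps)
      then show "x \<in> ring_of_integers K" using x comb mem by (simp add: ring_of_integers_def)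
    qed
    fix m n :: int assume "of_int m * 1 + of_int n * \<omega> = 0"
    from coeff_zero[OF this[unfolded comb]] show "m = 0 \<and> n = 0" by simp
  qed
  have tr: "field_trace K 1 = 2" "field_trace K \<omega> = of_int D"
    "field_trace K (\<omega> * \<omega>) = (of_int D ^ 2 + of_int D) / 2"
  proof -
    show "field_trace K 1 = 2" using trace[of 1 0] by simp
    show "field_trace K \<omega> = of_int D" using trace[of "of_int D / 2" "1/2"] by (simp add: \<omega>_def)
    have "\<omega> * \<omega> = of_rat ((of_int D)^2 / 4) + of_rat (of_int D / 2) * \<delta> + of_rat (1/4) * \<delta>^2"
      by (simp add: \<omega>_def of_rat_divide of_rat_mult field_simps power2_eq_square)
    also have "\<dots> = of_rat ((of_int D)^2 / 4 + of_int D / 4) + of_rat (of_int D / 2) * \<delta>"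
      unfolding sq by (simp add: of_rat_add of_rat_divide of_rat_power)
    finally show "field_trace K (\<omega> * \<omega>) = (of_int D ^ 2 + of_int D) / 2"
      using trace by simp
  qed
  show ?thesis
  proof (rule field_disc_eqI[OF basis mult_closed ws])
    show "of_int D = det (mat (length [1, \<omega>]) (length [1, \<omega>])
        (\<lambda>(i, j). field_trace K ([1, \<omega>] ! i * [1, \<omega>] ! j)))"
      by (simp add: det_mat_2[unfolded numeral_2_eq_2] tr) (simp add: power2_eq_square field_simps)
  qed
qed

end

text \<open>Take the largest \<open>k\<close> whose square divides \<open>N\<close> with a quotient
  that is 0 or 1 modulo 4. A further square factor of the quotient would produce a larger
  one.\<close>

lemma minimal_disc_square_class:
  fixes N :: int
  assumes "N \<noteq> 0" "N mod 4 \<in> {0, 1}"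
  obtains k D where "k > 0" "N = k^2 * D" "minimal_disc D"
proof -
  define A where "A = {k :: int. k > 0 \<and> k^2 dvd N \<and> (N div k^2) mod 4 \<in> {0, 1}}"
  have "k \<le> \<bar>N\<bar>" if "k \<in> A" for k
  proof -
    have "k \<le> k^2" using that by (simp add: A_def power2_eq_square)
    also have "\<dots> \<le> \<bar>N\<bar>" using that assms(1) dvd_imp_le_int[of N "k^2"] by (simp add: A_def)
    finally show ?thesis .
  qed
  then have "A \<subseteq> {0..\<bar>N\<bar>}" by (auto simp: A_def)
  then have fin: "finite A" using finite_subset by blast
  have "1 \<in> A" using assms by (simp add: A_def)
  then have ne: "A \<noteq> {}" by blast
  define k where "k = Max A"
  have k: "k \<in> A" unfolding k_def using fin ne by (rule Max_in)
  then obtain D where D: "N = k^2 * D" by (auto simp: A_def elim: dvdE)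
  have k0: "k > 0" using k by (simp add: A_def)
  have "minimal_disc D" unfolding minimal_disc_def
  proof (intro conjI allI impI)
    show "D mod 4 \<in> {0, 1}" using k k0 by (simp add: A_def D)
    fix j :: int assume j: "j > 1" "j^2 dvd D"
    then obtain E where E: "D = j^2 * E" by (elim dvdE)
    show "D div j^2 mod 4 \<notin> {0, 1}"
    proof
      assume "D div j^2 mod 4 \<in> {0, 1}"
      then have "E mod 4 \<in> {0, 1}" using j by (simp add: E)
      moreover have "N = (k * j)^2 * E" by (simp add: D E power_mult_distrib)
      ultimately have "k * j \<in> A" using j k0 by (simp add: A_def)
      then have "k * j \<le> k" unfolding k_def by (rule Max_ge[OF fin])
      then show False using j k0 by simp
    qed
  qed
  then show ?thesis using that k0 D by blast
qed

lemma number_field_2_is_quadratic: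
  fixes L :: "'a::field_char_0 set"
  assumes L: "number_field 2 L"
  obtains \<delta> D where "quadratic_field L \<delta> D" "minimal_disc D"
proof -
  have sub: "subfield L ring_of_type_algebra" and dim: "rat_vs.dim L = 2"
    using L by (auto simp: number_field_def)
  note cl = subfield_closed[OF sub]
  have span1: "rat_vs.span {1} = range (of_rat :: rat \<Rightarrow> 'a)"
    by (simp add: rat_vs.span_singleton)
  have "\<not> L \<subseteq> range of_rat"
  proof
    assume "L \<subseteq> range (of_rat :: rat \<Rightarrow> 'a)"
    then have "rat_vs.dim L \<le> card {1 :: 'a}"
      by (intro rat_vs.dim_le_card) (simp_all add: span1)
    then show False using dim by simp
  qed
  then obtain x where x: "x \<in> L" "x \<notin> range of_rat" by blast
  have "rat_vs.independent (insert x {1})"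
    by (rule rat_vs.independent_insertI) (use x span1 in auto)
  moreover have "x \<noteq> 1" using x(2) by (metis of_rat_1 rangeI)
  then have "card (insert x {1}) = 2" by simp
  ultimately have span: "rat_vs.span (insert x {1}) = L"
    using x cl(1) by (intro number_field_span[OF L]) auto
  have L_eq: "y \<in> L \<longleftrightarrow> (\<exists>p q. y = of_rat p + of_rat q * x)" for y
  proof -
    have "y \<in> L \<longleftrightarrow> (\<exists>q p. y - of_rat q * x = of_rat p)"
      unfolding span[symmetric] by (auto simp: rat_vs.span_insert span1)
    then show ?thesis by (auto simp: diff_eq_eq)
  qed
  obtain p q where pq: "x * x = of_rat p + of_rat q * x" using L_eq cl(3)[OF x(1,1)] by blast
  define r where "r = p + q^2 / 4"
  have y: "(x - of_rat (q / 2))^2 = of_rat r"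
  proof -
    have h: "of_rat q = 2 * (of_rat (q / 2) :: 'a)" by (simp add: of_rat_divide)
    have r: "of_rat r = of_rat p + (of_rat (q / 2))^2"
      by (simp add: r_def of_rat_add of_rat_divide of_rat_power power_divide)
    have "(x - of_rat (q / 2))^2 = x * x - 2 * of_rat (q / 2) * x + (of_rat (q / 2))^2"
      by (simp add: power2_eq_square algebra_simps)
    then show ?thesis unfolding pq r h[symmetric] by simp
  qed
  obtain m n where r: "r = of_int m / of_int n" "n > 0" by (metis Fract_of_int_quotient Rat_cases)
  \<comment> \<open>After completing the square, \<open>n\<close> clears the denominator of
    \<open>r\<close>; the extra 2 makes \<open>z^2\<close> a multiple of 4, so that a minimal
    discriminant can be extracted from it.\<close>
  define z where "z = of_int (2 * n) * (x - of_rat (q / 2))"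
  have z2: "z^2 = of_int (4 * (m * n))"
    unfolding z_def power_mult_distrib y using r(2)
    by (simp add: r(1) of_rat_divide power2_eq_square)
  have zL: "of_rat a * z = of_rat (a * of_int (2 * n)) * x - of_rat (a * of_int n * q)" for a
    by (simp add: z_def of_rat_mult of_rat_divide algebra_simps)
  have z_irr: "of_rat a * z \<notin> range of_rat" if "a \<noteq> 0" for a
  proof
    assume "of_rat a * z \<in> range of_rat"
    then obtain b where "of_rat (a * of_int (2 * n)) * x = of_rat (b + a * of_int n * q)"
      unfolding zL by (auto simp: diff_eq_eq of_rat_add)
    then have "x = of_rat ((b + a * of_int n * q) / (a * of_int (2 * n)))"
      using that r(2) by (simp add: of_rat_divide field_simps)
    then show False using x(2) by blast
  qed
  have "4 * (m * n) \<noteq> 0"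
  proof
    assume "4 * (m * n) = 0"
    then have "z = 0" using z2 by (simp only: of_int_0 power_eq_0_iff)
    then show False using z_irr[of 1] by (auto intro: range_eqI[of _ _ 0])
  qed
  then obtain k D where k: "k > 0" "4 * (m * n) = k^2 * D" and D: "minimal_disc D"
    by (rule minimal_disc_square_class) auto
  define \<delta> where "\<delta> = of_rat (1 / of_int k) * z"
  have "quadratic_field L \<delta> D"
  proof
    have "\<delta>^2 = of_rat ((1 / of_int k)^2) * z^2" by (simp add: \<delta>_def power_mult_distrib of_rat_power)
    also have "\<dots> = of_int D"
      unfolding z2 k(2) using k(1) by (simp add: of_rat_divide power_divide of_rat_power)
    finally show "\<delta>^2 = of_int D" .
    show "\<delta> \<notin> \<rat>" using z_irr[of "1 / of_int k"] k(1) by (auto simp: \<delta>_def Rats_def)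
    define e :: rat where "e = 1 / of_int k * of_int (2 * n)"
    define f :: rat where "f = 1 / of_int k * of_int n * q"
    have e: "e \<noteq> 0" using k r by (simp add: e_def)
    have d: "\<delta> = of_rat e * x - of_rat f" unfolding \<delta>_def zL e_def f_def ..
    have "(\<exists>p q. y = of_rat p + of_rat q * x) \<longleftrightarrow> (\<exists>p q. y = of_rat p + of_rat q * \<delta>)" for y
    proof
      assume "\<exists>p q. y = of_rat p + of_rat q * x"
      then obtain p q where "y = of_rat p + of_rat q * x" by blast
      then have "y = of_rat (p + q * f / e) + of_rat (q / e) * \<delta>"
      proof -
        have 1: "of_rat (q / e) * of_rat e = (of_rat q :: 'a)"
          unfolding of_rat_mult[symmetric] using e by simp
        have 2: "of_rat (q / e) * of_rat f = (of_rat (q * f / e) :: 'a)"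
          unfolding of_rat_mult[symmetric] by simp
        show ?thesis unfolding d right_diff_distrib mult.assoc[symmetric] 1 2
          using \<open>y = of_rat p + of_rat q * x\<close> by (simp add: of_rat_add)
      qed
      then show "\<exists>p q. y = of_rat p + of_rat q * \<delta>" by blast
    next
      assume "\<exists>p q. y = of_rat p + of_rat q * \<delta>"
      then obtain p q where "y = of_rat p + of_rat q * \<delta>" by blast
      then have "y = of_rat (p - q * f) + of_rat (q * e) * x"
        by (simp add: d of_rat_diff of_rat_mult algebra_simps)
      then show "\<exists>p q. y = of_rat p + of_rat q * x" by blast
    qed
    then show "L = {of_rat p + of_rat q * \<delta> | p q. True}" using L_eq by blast
  qed
  then show ?thesis using that D by blast
qed

section \<open>Arithmetic of fundamental discriminants\<close>

lemma minimal_disc_of_fundamental: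
  assumes "fundamental_discriminant D"
  shows "minimal_disc D"
  using assms number_field_2_is_quadratic quadratic_field.field_disc_eq
  unfolding fundamental_discriminant_def by metis

text \<open>Multiplication by -3 preserves residues modulo 4, so a square factor that could be split
  off from \<open>E\<close> could also be split off from \<open>-3 * E\<close>. This turns
  minimality of d_K into minimality of -d_K / 3.\<close>

lemma minimal_disc_div_neg_3:
  assumes "minimal_disc (- 3 * E)"
  shows "minimal_disc E"
proof -
  have mod4: "(- 3 * z) mod 4 = z mod 4" for z :: int by presburger
  show ?thesis unfolding minimal_disc_def
  proof (intro conjI allI impI)
    show "E mod 4 \<in> {0, 1}" using assms mod4[of E] by (simp add: minimal_disc_def)
    fix k :: int assume k: "k > 1" "k^2 dvd E"
    then obtain E' where E': "E = k^2 * E'" by (elim dvdE)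
    show "E div k^2 mod 4 \<notin> {0, 1}"
    proof
      assume "E div k^2 mod 4 \<in> {0, 1}"
      then have "(- 3 * E') mod 4 \<in> {0, 1}" using k mod4[of E'] by (simp add: E')
      moreover have "- 3 * E = k^2 * (- 3 * E')" by (simp add: E')
      ultimately have "\<bar>k\<bar> = 1" using minimal_discD[of k "- 3 * E'"] assms by metis
      then show False using k by simp
    qed
  qed
qed

text \<open>As 9 is 1 modulo 4, dividing by it would leave the residue 0 or 1.\<close>

lemma minimal_disc_not_9_dvd:
  assumes "minimal_disc D"
  shows "\<not> 9 dvd D"
proof
  assume "9 dvd D"
  then obtain E where E: "D = 3^2 * E" by auto
  have "(9 * E) mod 4 = E mod 4" by presburger
  then have "E mod 4 \<in> {0, 1}" using assms by (simp add: minimal_disc_def E)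
  then show False using minimal_discD[of 3 E] assms E by simp
qed

section \<open>Adjoining a square root to the rationals\<close>

lemma (in quadratic_field) rat_adjoin_eq: "rat_adjoin \<delta> = K"
proof -
  have poly: "poly (map_poly of_rat p) \<delta> \<in> K" for p
  proof (induction p)
    case 0
    show ?case using mem[of 0 0] by simp
  next
    case (pCons c p)
    have "poly (map_poly of_rat (pCons c p)) \<delta> = of_rat c + \<delta> * poly (map_poly of_rat p) \<delta>"
      by (cases "p = 0 \<and> c = 0") (auto simp: map_poly_pCons)
    moreover have "\<delta> * poly (map_poly of_rat p) \<delta> \<in> K"
      using mult_closed pCons.IH mem[of 0 1] by simp
    moreover have "of_rat c + y \<in> K" if y: "y \<in> K" for y
    proof -
      obtain a b where "y = of_rat a + of_rat b * \<delta>" using y K_eq by blast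
      then have "of_rat c + y = of_rat (c + a) + of_rat b * \<delta>" by (simp add: of_rat_add)
      then show ?thesis using mem by simp
    qed
    ultimately show ?case by simp
  qed
  have inv: "inverse y \<in> K" if yK: "y \<in> K" for y
  proof (cases "y = 0")
    case True
    then show ?thesis using mem[of 0 0] by simp
  next
    case False
    obtain a b where y: "y = of_rat a + of_rat b * \<delta>" using yK K_eq by blast
    define N where "N = a^2 - of_int D * b^2"
    have "y * (of_rat a - of_rat b * \<delta>) = (of_rat a)^2 - (of_rat b)^2 * \<delta>^2"
      by (simp add: y power2_eq_square algebra_simps)
    also have "\<dots> = of_rat N" by (simp add: sq N_def of_rat_diff of_rat_mult of_rat_power)
    finally have N: "y * (of_rat a - of_rat b * \<delta>) = of_rat N" .
    have "N \<noteq> 0"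
    proof
      assume "N = 0"
      then have "of_rat a + of_rat (- b) * \<delta> = 0" using N False by (simp add: of_rat_minus)
      then have "a = 0" "b = 0" using coeff_zero by fastforce+
      then show False using False y by simp
    qed
    then have "inverse y = of_rat (a / N) + of_rat (- b / N) * \<delta>"
      using N False by (simp add: of_rat_divide of_rat_minus field_simps)
    then show ?thesis using mem by metis
  qed
  show ?thesis
  proof
    show "rat_adjoin \<delta> \<subseteq> K"
      using poly inv mult_closed unfolding rat_adjoin_def by (auto simp: divide_inverse)
    show "K \<subseteq> rat_adjoin \<delta>"
    proof
      fix y assume "y \<in> K"
      then obtain a b where "y = of_rat a + of_rat b * \<delta>" using K_eq by blast
      then have "y = poly (map_poly of_rat [:a, b:]) \<delta> / poly (map_poly of_rat 1) \<delta>"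
        by (simp add: map_poly_pCons mult.commute)
      moreover have "poly (map_poly of_rat 1) \<delta> \<noteq> 0" by simp
      ultimately show "y \<in> rat_adjoin \<delta>" unfolding rat_adjoin_def by blast
    qed
  qed
qed

text \<open>Covers the discriminant 1, that is d_K = -3: adjoining the square root of 1 gives the
  rationals, and the narrow class group is then formed with discriminant 1.\<close>

lemma field_disc_rat: "field_disc (range (of_rat :: rat \<Rightarrow> 'a::field_char_0)) = 1"
proof -
  let ?K = "range (of_rat :: rat \<Rightarrow> 'a)"
  have basis: "finite {1 :: 'a}" "rat_vs.independent {1 :: 'a}" "rat_vs.span {1 :: 'a} = ?K"
    by (simp_all add: rat_vs.span_singleton)
  have mult: "x * y \<in> ?K" if "x \<in> ?K" "y \<in> ?K" for x y
    using that by (auto simp flip: of_rat_mult)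
  have one: "1 \<in> ?K" by (rule range_eqI[of _ _ 1]) simp
  have tr: "field_trace ?K 1 = 1"
    using field_trace_matrix[OF basis mult one, of "\<lambda>_ _. 1"] by simp
  have sum: "(\<Sum>i<length [1 :: 'a]. of_int (ns ! i) * [1 :: 'a] ! i) = of_int (ns ! 0)" for ns :: "int list"
    by simp
  have len: "ns = [ns ! 0]" if "length ns = 1" for ns :: "int list"
    using that by (cases ns) auto
  have ws: "int_basis [1] (ring_of_integers ?K)"
    unfolding int_basis_def sum
  proof (rule bij_betw_imageI)
    show "inj_on (\<lambda>ns. of_int (ns ! 0) :: 'a) {ns. length ns = length [1 :: 'a]}"
      by (rule inj_onI) (metis len length_Cons list.size(3) mem_Collect_eq of_int_eq_iff One_nat_def)
    show "(\<lambda>ns. of_int (ns ! 0) :: 'a) ` {ns. length ns = length [1 :: 'a]} = ring_of_integers ?K"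
    proof (rule subset_antisym; rule subsetI)
      fix x :: 'a assume "x \<in> (\<lambda>ns. of_int (ns ! 0)) ` {ns. length ns = length [1 :: 'a]}"
      then obtain n where "x = of_int n" by blast
      then show "x \<in> ring_of_integers ?K"
        by (auto simp: ring_of_integers_def intro: range_eqI[of _ _ "of_int n"] int_imp_algebraic_int)
    next
      fix x :: 'a assume "x \<in> ring_of_integers ?K"
      then have "x \<in> \<int>"
        by (intro rational_algebraic_int_is_int) (auto simp: ring_of_integers_def)
      then obtain n where "x = of_int n" by (rule Ints_cases)
      then show "x \<in> (\<lambda>ns. of_int (ns ! 0)) ` {ns. length ns = length [1 :: 'a]}"
        by (intro image_eqI[of _ _ "[n]"]) simp_all
    qed
  qed
  show ?thesis
    by (rule field_disc_eqI[OF basis mult ws]) (simp_all add: det_single[of "mat _ _ _"] tr)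
qed

lemma rat_adjoin_1: "rat_adjoin 1 = range (of_rat :: rat \<Rightarrow> 'a::field_char_0)"
proof -
  have poly: "poly (map_poly of_rat p) 1 = (of_rat (poly p 1) :: 'a)" for p
    by (induction p) (simp_all add: map_poly_pCons of_rat_add)
  show ?thesis
  proof (rule subset_antisym; rule subsetI)
    fix x :: 'a assume "x \<in> rat_adjoin 1"
    then show "x \<in> range of_rat" unfolding rat_adjoin_def poly by (auto simp flip: of_rat_divide)
  next
    fix x :: 'a assume "x \<in> range of_rat"
    then obtain r where "x = of_rat r" by blast
    then have "x = poly (map_poly of_rat [:r:]) 1 / poly (map_poly of_rat 1) 1"
      by (simp add: map_poly_pCons)
    moreover have "poly (map_poly of_rat 1) (1 :: 'a) \<noteq> 0" by simp
    ultimately show "x \<in> rat_adjoin 1" unfolding rat_adjoin_def by blast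
  qed
qed

lemma field_disc_rat_adjoin_csqrt:
  assumes "minimal_disc D"
  shows "field_disc (rat_adjoin (csqrt (of_int D))) = D"
proof (cases "D = 1")
  case True
  then show ?thesis by (simp add: rat_adjoin_1 field_disc_rat)
next
  case False
  define \<delta> where "\<delta> = csqrt (of_int D)"
  have sq: "\<delta>^2 = of_int D" by (simp add: \<delta>_def)
  have "\<delta> \<notin> \<rat>"
  proof
    assume rat: "\<delta> \<in> \<rat>"
    have "algebraic_int \<delta>" unfolding \<delta>_def by (intro algebraic_int_csqrt) auto
    then have "\<delta> \<in> \<int>" using rat rational_algebraic_int_is_int by blast
    then obtain n where "\<delta> = of_int n" by (rule Ints_cases)
    then have "D = n^2" using sq by (metis of_int_eq_iff of_int_power)
    then show False using minimal_disc_square assms False by blast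
  qed
  then interpret quadratic_field "{of_rat p + of_rat q * \<delta> | p q. True}" \<delta> D
    using sq by unfold_locales auto
  show ?thesis using rat_adjoin_eq field_disc_eq[OF assms] unfolding \<delta>_def[symmetric] by simp
qed

section \<open>Ramification at 3\<close>

lemma cong_3_cube: "[z^3 = z] (mod (3::int))"
proof -
  have "z mod 3 = 0 \<or> z mod 3 = 1 \<or> z mod 3 = 2" by presburger
  then have "(z mod 3)^3 mod 3 = z mod 3" by auto
  then show ?thesis by (simp add: cong_def power_mod)
qed

lemma cong_3_square: "\<not> 3 dvd z \<Longrightarrow> [z^2 = 1] (mod (3::int))"
proof -
  assume "\<not> 3 dvd z"
  then have "z mod 3 = 1 \<or> z mod 3 = 2" by presburger
  then have "(z mod 3)^2 mod 3 = 1" by auto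
  then show ?thesis by (simp add: cong_def power_mod)
qed

text \<open>The hypotheses say that the integer \<open>n + m \<alpha> + k \<beta>\<close> of the cubic ring is nonzero
  modulo \<open>3\<close> but has square zero modulo \<open>3\<close>.\<close>

lemma three_dvd_cubic_disc:
  assumes 0: "3 dvd n^2 - m^2 * a * c - k^2 * b * d - 2 * m * k * a * d"
    and 1: "3 dvd 2 * n * m + m^2 * b + k^2 * d"
    and 2: "3 dvd 2 * n * k - m^2 * a - k^2 * c"
    and nz: "\<not> (3 dvd n \<and> 3 dvd m \<and> 3 dvd k)"
  shows "3 dvd cubic_disc (a, b, c, d)"
proof -
  have p: "prime (3::int)" by simp
  note [simp] = prime_dvd_mult_iff[OF p] prime_dvd_power_iff[OF p]
  have sub: "3 dvd x" if "3 dvd x + y" "3 dvd y" for x y :: int using that by (simp add: dvd_add_left_iff)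
  consider "3 dvd m" "3 dvd k" | "3 dvd k" "\<not> 3 dvd m" | "3 dvd m" "\<not> 3 dvd k" | "\<not> 3 dvd m" "\<not> 3 dvd k"
    by blast
  then show ?thesis
  proof cases
    case 1
    then have "3 dvd n^2"
      by (intro sub[of "n^2" "- (m^2 * a * c) - k^2 * b * d - 2 * m * k * a * d"])
        (use 0 in \<open>simp_all add: algebra_simps dvd_diff\<close>)
    then show ?thesis using nz 1 by simp
  next
    case 2
    have "3 dvd m^2 * a"
      by (rule sub[of _ "k^2 * c - 2 * n * k"])
        (use assms(3) 2 dvd_minus_iff[of 3 "2 * n * k - m^2 * a - k^2 * c"] in \<open>simp_all add: algebra_simps dvd_diff\<close>)
    then have a: "3 dvd a" using 2 by simp
    have "3 dvd n^2"
      by (rule sub[of _ "- (m^2 * a * c) - k^2 * b * d - 2 * m * k * a * d"])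
        (use 0 a 2 in \<open>simp_all add: algebra_simps dvd_diff\<close>)
    then have n: "3 dvd n" by simp
    have "3 dvd m^2 * b"
      by (rule sub[of _ "2 * n * m + k^2 * d"]) (use assms(2) n 2 in \<open>simp_all add: algebra_simps\<close>)
    then have "3 dvd b" using 2 by simp
    then show ?thesis using a by (auto intro!: dvd_add dvd_diff simp: power2_eq_square)
  next
    case 3
    have "3 dvd k^2 * d"
      by (rule sub[of _ "2 * n * m + m^2 * b"]) (use assms(2) 3 in \<open>simp_all add: algebra_simps\<close>)
    then have d: "3 dvd d" using 3 by simp
    have "3 dvd n^2"
      by (rule sub[of _ "- (m^2 * a * c) - k^2 * b * d - 2 * m * k * a * d"])
        (use 0 d 3 in \<open>simp_all add: algebra_simps dvd_diff\<close>)
    then have n: "3 dvd n" by simp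
    have "3 dvd k^2 * c"
      by (rule sub[of _ "m^2 * a - 2 * n * k"])
        (use assms(3) n 3 dvd_minus_iff[of 3 "2 * n * k - m^2 * a - k^2 * c"] in \<open>simp_all add: algebra_simps dvd_diff\<close>)
    then have "3 dvd c" using 3 by simp
    then show ?thesis using d by (auto intro!: dvd_add dvd_diff simp: power2_eq_square)
  next
    case 4
    \<comment> \<open>Modulo 3 both \<open>m^2\<close> and \<open>k^2\<close> are 1, so the second
      and third hypotheses express \<open>d\<close> and \<open>a\<close> through the other
      variables. The first one then becomes \<open>(b - m * k * c)^2 = 0\<close>. With
      \<open>b\<close> eliminated as well, the discriminant vanishes modulo 3, its cubes being
      reduced by Fermat's little theorem.\<close>
    note m = cong_3_square[OF 4(1)] and k = cong_3_square[OF 4(2)]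
    have ci: "[x = y] (mod 3) \<longleftrightarrow> 3 dvd x - y" for x y :: int by (rule cong_iff_dvd_diff)
    have d: "[d = n * m - b] (mod 3)"
    proof -
      have "[2 * n * m + 1 * b + 1 * d = 2 * n * m + m^2 * b + k^2 * d] (mod 3)"
        by (intro cong_add cong_mult cong_refl cong_sym[OF m] cong_sym[OF k])
      also have "[2 * n * m + m^2 * b + k^2 * d = 0] (mod 3)" using 1 by (simp add: ci)
      finally have "3 dvd 2 * n * m + b + d" by (simp add: ci)
      then have "3 dvd (2 * n * m + b + d) - 3 * (n * m)" by (rule dvd_diff) simp
      then show ?thesis unfolding ci by (simp add: algebra_simps)
    qed
    have a: "[a = - (n * k) - c] (mod 3)"
    proof -
      have "[2 * n * k - 1 * a - 1 * c = 2 * n * k - m^2 * a - k^2 * c] (mod 3)"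
        by (intro cong_diff cong_mult cong_refl cong_sym[OF m] cong_sym[OF k])
      also have "[2 * n * k - m^2 * a - k^2 * c = 0] (mod 3)" using 2 by (simp add: ci)
      finally have "3 dvd 2 * n * k - a - c" by (simp add: ci)
      then have "3 dvd 3 * (n * k) - (2 * n * k - a - c)" by (rule dvd_diff[OF dvd_triv_left])
      then show ?thesis unfolding ci by (simp add: algebra_simps)
    qed
    have "[n^2 - m^2 * a * c - k^2 * b * d - 2 * m * k * a * d
       = n^2 - 1 * (- (n * k) - c) * c - 1 * b * (n * m - b) - 2 * m * k * (- (n * k) - c) * (n * m - b)] (mod 3)"
      by (intro cong_diff cong_mult cong_refl m k a d)
    also have "n^2 - 1 * (- (n * k) - c) * c - 1 * b * (n * m - b) - 2 * m * k * (- (n * k) - c) * (n * m - b)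
      = n^2 + n * k * c + c^2 - n * m * b + b^2
        + (2 * n^2 * m^2 * k^2 - 2 * n * m * b * k^2 + 2 * c * n * k * m^2 - 2 * m * k * b * c)"
      by (simp add: algebra_simps power2_eq_square)
    also have "[\<dots> = n^2 + n * k * c + c^2 - n * m * b + b^2
        + (2 * n^2 * 1 * 1 - 2 * n * m * b * 1 + 2 * c * n * k * 1 - 2 * m * k * b * c)] (mod 3)"
      by (intro cong_add cong_diff cong_mult cong_refl m k)
    also have "[n^2 + n * k * c + c^2 - n * m * b + b^2
        + (2 * n^2 * 1 * 1 - 2 * n * m * b * 1 + 2 * c * n * k * 1 - 2 * m * k * b * c)
      = b^2 - 2 * m * k * b * c + c^2 * 1 * 1] (mod 3)"
      unfolding ci by (rule dvdI[of _ _ "n^2 + n * k * c - n * m * b"]) (simp add: algebra_simps)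
    also have "[b^2 - 2 * m * k * b * c + c^2 * 1 * 1
      = b^2 - 2 * m * k * b * c + c^2 * m^2 * k^2] (mod 3)"
      by (intro cong_add cong_mult cong_refl cong_sym[OF m] cong_sym[OF k])
    also have "b^2 - 2 * m * k * b * c + c^2 * m^2 * k^2 = (b - m * k * c)^2" by (simp add: algebra_simps power2_eq_square)
    finally have "[(b - m * k * c)^2 = 0] (mod 3)"
      using 0 by (metis ci cong_sym cong_trans diff_zero)
    then have "3 dvd b - m * k * c" by (simp add: ci)
    then have b: "[b = m * k * c] (mod 3)" by (simp add: ci)
    have "[cubic_disc (a, b, c, d) = b^2 * c^2 - a * c^3 - b^3 * d] (mod 3)"
      unfolding ci by (rule dvdI[of _ _ "6 * a * b * c * d - a * c^3 - b^3 * d - 9 * a^2 * d^2"])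
        (simp add: algebra_simps)
    also have "[b^2 * c^2 - a * c^3 - b^3 * d
      = b^2 * c^2 - (- (n * k) - c) * c - b * (n * m - b)] (mod 3)"
      by (intro cong_diff cong_mult cong_refl a d cong_3_cube)
    also have "b^2 * c^2 - (- (n * k) - c) * c - b * (n * m - b)
       = b^2 * c^2 + n * k * c + c^2 - n * m * b + b^2"
      by (simp add: algebra_simps power2_eq_square)
    also have "[\<dots> = (m * k * c)^2 * c^2 + n * k * c + c^2 - n * m * (m * k * c) + (m * k * c)^2] (mod 3)"
      by (intro cong_add cong_diff cong_mult cong_refl cong_pow b)
    also have "(m * k * c)^2 * c^2 + n * k * c + c^2 - n * m * (m * k * c) + (m * k * c)^2
       = m^2 * k^2 * c^3 * c + n * k * c + c^2 - n * k * c * m^2 + m^2 * k^2 * c^2"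
      by (simp add: algebra_simps power2_eq_square power3_eq_cube)
    also have "[\<dots> = 1 * 1 * c * c + n * k * c + c^2 - n * k * c * 1 + 1 * 1 * c^2] (mod 3)"
      by (intro cong_add cong_diff cong_mult cong_refl m k cong_3_cube)
    also have "[1 * 1 * c * c + n * k * c + c^2 - n * k * c * 1 + 1 * 1 * c^2 = 0] (mod 3)" unfolding ci by (rule dvdI[of _ _ "c^2"]) (simp add: power2_eq_square)
    finally show ?thesis by (simp add: ci)
  qed
qed

text \<open>Write (p) = P J with J = P A. If J were contained in (p), then P J would lie in p P;
  since p lies in P J, cancelling it would put 1 into P. So some x in J is outside (p), and its
  square lies in J J, which is contained in P P A = (p) because A A is contained in A.\<close>

lemma ramifies_square_dvd:
  fixes K :: "'a::field_char_0 set"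
  assumes ram: "ramifies p K" and p: "p \<noteq> 0"
  obtains x y where "x \<in> ring_of_integers K" "\<And>z. z \<in> ring_of_integers K \<Longrightarrow> x \<noteq> of_nat p * z"
    "y \<in> ring_of_integers K" "x^2 = of_nat p * y"
proof -
  let ?O = "ring_of_integers K"
  define R where "R = (ring_of_type_algebra :: 'a ring)\<lparr>carrier := ?O\<rparr>"
  have [simp]: "carrier R = ?O" "monoid.mult R = (*)" "add R = (+)" "one R = 1" "zero R = 0"
    by (simp_all add: R_def ring_of_type_algebra_def fun_eq_iff)
  obtain P A where P: "primeideal P R" and A: "ideal A R"
    and eq: "cgenideal R (of_nat p) = ideal_prod R (ideal_prod R P P) A"
    using ram unfolding ramifies_def R_def Let_def by blast
  interpret P: primeideal P R by (rule P)
  interpret A: ideal A R by (rule A)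
  have PI: "ideal P R" by (rule P.is_ideal)
  have gen: "cgenideal R (of_nat p) = {of_nat p * z | z. z \<in> ?O}"
    by (simp add: cgenideal_def mult.commute)
  have one: "1 \<in> ?O" using P.one_closed by simp
  define J where "J = ideal_prod R P A"
  have PJ: "{of_nat p * z | z. z \<in> ?O} = ideal_prod R P J"
    using eq P.ideal_prod_assoc[OF PI PI A] unfolding gen J_def by simp
  have "\<exists>x\<in>J. x \<notin> {of_nat p * z | z. z \<in> ?O}"
  proof (rule ccontr)
    assume "\<not> (\<exists>x\<in>J. x \<notin> {of_nat p * z | z. z \<in> ?O})"
    then have J: "\<exists>z\<in>?O. x = of_nat p * z" if "x \<in> J" for x using that by blast
    have "\<exists>y\<in>P. x = of_nat p * y" if "x \<in> ideal_prod R P J" for x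
      using that
    proof (induction x rule: ideal_prod.induct)
      case (prod i j)
      obtain z where z: "z \<in> ?O" "j = of_nat p * z" using J[OF prod(2)] by blast
      have "i * z \<in> P" using P.I_r_closed[OF prod(1), of z] z by simp
      then show ?case using z by (intro bexI[of _ "i * z"]) simp_all
    next
      case (sum x y)
      then obtain x' y' where "x' \<in> P" "y' \<in> P" "x = of_nat p * x'" "y = of_nat p * y'" by blast
      then show ?case using additive_subgroup.a_closed[OF ideal.axioms(1)[OF PI], of x' y']
        by (intro bexI[of _ "x' + y'"]) (simp_all add: distrib_left)
    qed
    moreover have "of_nat p \<in> ideal_prod R P J" unfolding PJ[symmetric] using one by force
    ultimately obtain y where "y \<in> P" "(of_nat p :: 'a) = of_nat p * y" by blast
    then have "\<one>\<^bsub>R\<^esub> \<in> P" using p by simp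
    then show False using P.one_imp_carrier P.I_notcarr by simp
  qed
  then obtain x where x: "x \<in> J" "x \<notin> {of_nat p * z | z. z \<in> ?O}" by blast
  have JO: "J \<subseteq> ?O" unfolding J_def using P.ideal_prod_in_carrier[OF PI A] by simp
  have AA: "a * a' \<in> A" if "a \<in> A" "a' \<in> A" for a a'
    using A.I_l_closed[OF that(2), of a] A.a_subset that(1) by auto
  have prod: "u * v \<in> ideal_prod R (ideal_prod R P P) A" if "u \<in> J" "v \<in> J" for u v
    using that(1) unfolding J_def
  proof (induction u rule: ideal_prod.induct)
    case (prod i a)
    show ?case using that(2) unfolding J_def
    proof (induction v rule: ideal_prod.induct)
      case (prod i' a')
      have "(i * i') * (a * a') \<in> ideal_prod R (ideal_prod R P P) A"
        using ideal_prod.prod[OF ideal_prod.prod[OF \<open>i \<in> P\<close> \<open>i' \<in> P\<close>] AA[OF \<open>a \<in> A\<close> \<open>a' \<in> A\<close>], of R R]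
        by simp
      then show ?case by (simp add: mult_ac)
    next
      case (sum v v')
      then show ?case using ideal_prod.sum[of _ R] by (simp add: distrib_left)
    qed
  next
    case (sum u u')
    then show ?case using ideal_prod.sum[of _ R] by (simp add: distrib_right)
  qed
  have "x^2 \<in> {of_nat p * z | z. z \<in> ?O}"
    using prod[OF x(1) x(1)] unfolding eq[symmetric] gen by (simp add: power2_eq_square)
  then show ?thesis using that x JO by blast
qed

section \<open>Cubic fields\<close>

lemma basis_product:
  fixes x y p q r p' q' r' k l m n b d e :: "'a::comm_ring_1"
  assumes xx: "x * x = - k + b * x - n * y" and xy: "x * y = - l" and yy: "y * y = - m + d * x - e * y"
  shows "(p + q * x + r * y) * (p' + q' * x + r' * y)
    = (p * p' - q * q' * k - (q * r' + r * q') * l - r * r' * m)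
      + (p * q' + q * p' + q * q' * b + r * r' * d) * x
      + (p * r' + r * p' - q * q' * n - r * r' * e) * y"
proof -
  have "(p + q * x + r * y) * (p' + q' * x + r' * y) = p * p' + (p * q' + q * p') * x
      + (p * r' + r * p') * y + q * q' * (x * x) + (q * r' + r * q') * (x * y) + r * r' * (y * y)"
    by (simp add: algebra_simps)
  then show ?thesis unfolding xx xy yy by (simp add: algebra_simps)
qed

locale cubic_ring =
  fixes K :: "'a::field_char_0 set" and \<theta> :: 'a and a b c d :: int
  assumes nf: "number_field 3 K" and assoc: "associated_form K (a, b, c, d) \<theta>"
begin

definition \<alpha> :: 'a where "\<alpha> = - of_int a * \<theta>"
definition \<beta> :: 'a where "\<beta> = of_int d / \<theta>"

lemma root: "of_int a * \<theta>^3 + of_int b * \<theta>^2 + of_int c * \<theta> + of_int d = 0"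
  using assoc by simp

lemma int_basis: "int_basis [1, \<alpha>, \<beta>] (ring_of_integers K)"
  using assoc unfolding associated_form.simps \<alpha>_def \<beta>_def by blast

lemma disc: "cubic_disc (a, b, c, d) = field_disc K"
  using assoc by simp

lemma int_sum: "(\<Sum>i<length [1, \<alpha>, \<beta>]. of_int (f i) * [1, \<alpha>, \<beta>] ! i)
    = of_int (f 0) + of_int (f 1) * \<alpha> + of_int (f 2) * \<beta>"
  by (simp add: numeral_2_eq_2)

lemma int_mem: "of_int n + of_int m * \<alpha> + of_int k * \<beta> \<in> ring_of_integers K"
  using int_basis_sum_mem[OF int_basis, of "\<lambda>i. [n, m, k] ! i"] unfolding int_sum by simp

lemma int_repr:
  assumes "x \<in> ring_of_integers K"
  obtains n m k :: int where "x = of_int n + of_int m * \<alpha> + of_int k * \<beta>"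
  using int_basis_repr[OF int_basis assms] that unfolding int_sum by metis

lemma int_unique:
  assumes "of_int n + of_int m * \<alpha> + of_int k * \<beta> = of_int n' + of_int m' * \<alpha> + of_int k' * \<beta>"
  shows "n = n'" "m = m'" "k = k'"
proof -
  let ?f = "\<lambda>i. [n, m, k] ! i" and ?g = "\<lambda>i. [n', m', k'] ! i"
  have "?f i = ?g i" if "i < length [1, \<alpha>, \<beta>]" for i
    by (rule int_basis_unique[OF int_basis _ that]) (use assms in \<open>unfold int_sum, simp\<close>)
  from this[of 0] this[of 1] this[of 2] show "n = n'" "m = m'" "k = k'" by simp_all
qed

lemma nonzero: "a \<noteq> 0" "d \<noteq> 0" "\<theta> \<noteq> 0"
proof -
  show "a \<noteq> 0" using int_unique(2)[of 0 1 0 0 0 0] by (auto simp: \<alpha>_def)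
  show d: "d \<noteq> 0" using int_unique(3)[of 0 0 1 0 0 0] by (auto simp: \<beta>_def)
  then show "\<theta> \<noteq> 0" using root by auto
qed

text \<open>Dividing the equation of \<open>\<theta>\<close> by \<open>\<theta>\<close> gives
  \<open>\<beta> = - (a \<theta>^2 + b \<theta> + c)\<close>. This and
  \<open>\<beta> \<theta> = d\<close> yield the Delone-Faddeev multiplication table.\<close>

lemma mult_table:
  "\<alpha> * \<alpha> = - of_int (a * c) + of_int b * \<alpha> - of_int a * \<beta>"
  "\<alpha> * \<beta> = - of_int (a * d)"
  "\<beta> * \<beta> = - of_int (b * d) + of_int d * \<alpha> - of_int c * \<beta>"
proof -
  have d: "of_int d = - (of_int a * \<theta>^3 + of_int b * \<theta>^2 + of_int c * \<theta>)"
    using root by (simp add: eq_neg_iff_add_eq_0 algebra_simps)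
  have \<beta>: "\<beta> = - (of_int a * \<theta>^2 + of_int b * \<theta> + of_int c)"
    unfolding \<beta>_def d using nonzero by (simp add: field_simps power2_eq_square power3_eq_cube)
  show "\<alpha> * \<alpha> = - of_int (a * c) + of_int b * \<alpha> - of_int a * \<beta>"
    unfolding \<beta> \<alpha>_def by (simp add: algebra_simps power2_eq_square)
  show "\<alpha> * \<beta> = - of_int (a * d)"
    unfolding \<beta>_def \<alpha>_def using nonzero by simp
  have \<beta>\<theta>: "\<beta> * \<theta> = of_int d" using nonzero by (simp add: \<beta>_def)
  have "\<beta> * \<beta> = - (of_int a * \<theta> * (\<beta> * \<theta>) + of_int b * (\<beta> * \<theta>) + of_int c * \<beta>)"
    by (subst \<beta>) (simp add: algebra_simps power2_eq_square)
  then show "\<beta> * \<beta> = - of_int (b * d) + of_int d * \<alpha> - of_int c * \<beta>"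
    unfolding \<beta>\<theta> by (simp add: \<alpha>_def algebra_simps)
qed

text \<open>Coordinates are rational, not integral, because trace-free parts have denominator
  3.\<close>

definition vec :: "rat \<Rightarrow> rat \<Rightarrow> rat \<Rightarrow> 'a" where
  "vec p q r = of_rat p + of_rat q * \<alpha> + of_rat r * \<beta>"

lemma vec_mult:
  "vec p q r * vec p' q' r' = vec
     (p * p' - q * q' * of_int (a * c) - (q * r' + r * q') * of_int (a * d) - r * r' * of_int (b * d))
     (p * q' + q * p' + q * q' * of_int b + r * r' * of_int d)
     (p * r' + r * p' - q * q' * of_int a - r * r' * of_int c)"
  unfolding vec_def of_rat_add of_rat_mult of_rat_diff of_rat_of_int_eq
  by (rule basis_product[OF mult_table])

lemma vec_add: "vec p q r + vec p' q' r' = vec (p + p') (q + q') (r + r')"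
  by (simp add: vec_def of_rat_add algebra_simps)

lemma vec_scale: "of_rat s * vec p q r = vec (s * p) (s * q) (s * r)"
  unfolding vec_def of_rat_mult by (simp only: distrib_left mult.assoc)

lemma vec_zero:
  assumes "vec p q r = 0"
  shows "p = 0" "q = 0" "r = 0"
proof -
  obtain p1 p2 where p: "p = of_int p1 / of_int p2" "p2 > 0" by (metis Fract_of_int_quotient Rat_cases)
  obtain q1 q2 where q: "q = of_int q1 / of_int q2" "q2 > 0" by (metis Fract_of_int_quotient Rat_cases)
  obtain r1 r2 where r: "r = of_int r1 / of_int r2" "r2 > 0" by (metis Fract_of_int_quotient Rat_cases)
  \<comment> \<open>A common denominator turns a rational relation into an integral one, where
    uniqueness of integral coordinates applies.\<close>
  define s :: rat where "s = of_int (p2 * q2 * r2)"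
  have "vec (s * p) (s * q) (s * r) = 0" using assms vec_scale[of s p q r] by simp
  moreover have "s * p = of_int (p1 * q2 * r2)" "s * q = of_int (p2 * q1 * r2)" "s * r = of_int (p2 * q2 * r1)"
    using p q r by (simp_all add: s_def)
  ultimately have "of_int (p1 * q2 * r2) + of_int (p2 * q1 * r2) * \<alpha> + of_int (p2 * q2 * r1) * \<beta>
      = of_int 0 + of_int 0 * \<alpha> + of_int 0 * \<beta>"
    by (simp only: vec_def of_rat_of_int_eq) simp
  from int_unique[OF this] have "p1 = 0" "q1 = 0" "r1 = 0" using p(2) q(2) r(2) by simp_all
  then show "p = 0" "q = 0" "r = 0" unfolding p(1) q(1) r(1) by simp_all
qed

lemma distinct: "1 \<noteq> \<alpha>" "1 \<noteq> \<beta>" "\<alpha> \<noteq> \<beta>"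
proof -
  have "vec 1 (- 1) 0 = 1 - \<alpha>" "vec 1 0 (- 1) = 1 - \<beta>" "vec 0 1 (- 1) = \<alpha> - \<beta>"
    by (simp_all add: vec_def of_rat_minus)
  moreover have "vec 1 (- 1) 0 \<noteq> 0" "vec 1 0 (- 1) \<noteq> 0" "vec 0 1 (- 1) \<noteq> 0"
    using vec_zero(1)[of 1 "- 1" 0] vec_zero(1)[of 1 0 "- 1"] vec_zero(2)[of 0 1 "- 1"] by auto
  ultimately show "1 \<noteq> \<alpha>" "1 \<noteq> \<beta>" "\<alpha> \<noteq> \<beta>"
    by (simp_all only: right_minus_eq not_False_eq_True)
qed

section \<open>Trace form and trace-zero integers\<close>

lemma K_closed: "x \<in> K \<Longrightarrow> y \<in> K \<Longrightarrow> x * y \<in> K"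
  using nf subfield_mult unfolding number_field_def by blast

lemma basis: "finite {1, \<alpha>, \<beta>}" "rat_vs.independent {1, \<alpha>, \<beta>}" "rat_vs.span {1, \<alpha>, \<beta>} = K"
proof -
  show "finite {1, \<alpha>, \<beta>}" by simp
  show ind: "rat_vs.independent {1, \<alpha>, \<beta>}"
  proof -
    have "f x = 0" if *: "(\<Sum>x\<in>{1, \<alpha>, \<beta>}. of_rat (f x) * x) = 0" and x: "x \<in> {1, \<alpha>, \<beta>}" for f x
    proof -
      have "vec (f 1) (f \<alpha>) (f \<beta>) = 0" using * distinct by (simp add: vec_def add.assoc)
      from vec_zero[OF this] x show ?thesis by auto
    qed
    then show ?thesis by (intro rat_vs.independent_if_scalars_zero) auto
  qed
  have "{1, \<alpha>, \<beta>} \<subseteq> K"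
    using int_mem[of 1 0 0] int_mem[of 0 1 0] int_mem[of 0 0 1] by (auto simp: ring_of_integers_def)
  then show "rat_vs.span {1, \<alpha>, \<beta>} = K"
    using distinct by (intro number_field_span[OF nf ind]) auto
qed

lemma vec_mem: "vec p q r \<in> K"
proof -
  have "of_rat p * 1 + of_rat q * \<alpha> + of_rat r * \<beta> \<in> rat_vs.span {1, \<alpha>, \<beta>}"
    by (intro rat_vs.span_add rat_vs.span_scale rat_vs.span_base) auto
  then show ?thesis by (simp add: vec_def basis)
qed

lemma trace: "field_trace K (vec p q r) = 3 * p + of_int b * q - of_int c * r"
proof -
  define M where "M = (\<lambda>(x :: 'a) (y :: 'a).
    if x = 1 then (if y = 1 then p else if y = \<alpha> then q else r)
    else if x = \<alpha> then (if y = 1 then - q * of_int (a * c) - r * of_int (a * d)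
      else if y = \<alpha> then p + q * of_int b else - q * of_int a)
    else (if y = 1 then - q * of_int (a * d) - r * of_int (b * d)
      else if y = \<alpha> then r * of_int d else p - r * of_int c))"
  note ne = distinct distinct[symmetric]
  have M: "M 1 1 = p" "M 1 \<alpha> = q" "M 1 \<beta> = r"
    "M \<alpha> 1 = - q * of_int (a * c) - r * of_int (a * d)" "M \<alpha> \<alpha> = p + q * of_int b" "M \<alpha> \<beta> = - q * of_int a"
    "M \<beta> 1 = - q * of_int (a * d) - r * of_int (b * d)" "M \<beta> \<alpha> = r * of_int d" "M \<beta> \<beta> = p - r * of_int c"
    unfolding M_def using ne by simp_all
  have unit: "vec 0 1 0 = \<alpha>" "vec 0 0 1 = \<beta>" by (simp_all add: vec_def)
  have sum: "(\<Sum>y\<in>{1, \<alpha>, \<beta>}. of_rat (M x y) * y) = vec (M x 1) (M x \<alpha>) (M x \<beta>)" for x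
    using distinct by (simp add: vec_def add.assoc)
  have cols: "vec p q r * 1 = vec (M 1 1) (M 1 \<alpha>) (M 1 \<beta>)"
    "vec p q r * \<alpha> = vec (M \<alpha> 1) (M \<alpha> \<alpha>) (M \<alpha> \<beta>)"
    "vec p q r * \<beta> = vec (M \<beta> 1) (M \<beta> \<alpha>) (M \<beta> \<beta>)"
    using vec_mult[of p q r 0 1 0] vec_mult[of p q r 0 0 1] unfolding unit M by simp_all
  have "vec p q r * x = (\<Sum>y\<in>{1, \<alpha>, \<beta>}. of_rat (M x y) * y)" if x: "x \<in> {1, \<alpha>, \<beta>}" for x
  proof -
    from x consider "x = 1" | "x = \<alpha>" | "x = \<beta>" by blast
    then show ?thesis by cases (simp_all only: sum cols)
  qed
  then have "field_trace K (vec p q r) = (\<Sum>x\<in>{1, \<alpha>, \<beta>}. M x x)"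
    using K_closed by (intro field_trace_matrix[OF basis _ vec_mem, where M = M])
  also have "\<dots> = M 1 1 + M \<alpha> \<alpha> + M \<beta> \<beta>"
    using distinct by (simp add: add.assoc)
  finally show ?thesis unfolding M by simp
qed

lemma trace_square:
  "field_trace K ((vec p q r)^2) = 3 * (p^2 - q^2 * of_int (a * c) - 2 * q * r * of_int (a * d) - r^2 * of_int (b * d))
    + of_int b * (2 * p * q + q^2 * of_int b + r^2 * of_int d)
    - of_int c * (2 * p * r - q^2 * of_int a - r^2 * of_int c)"
  unfolding power2_eq_square vec_mult trace by (simp add: algebra_simps)

lemma int_vec: "of_int n + of_int m * \<alpha> + of_int k * \<beta> = vec (of_int n) (of_int m) (of_int k)"
  by (simp add: vec_def)

lemma trace_free_vec:
  "trace_free_part K (vec p q r) = vec ((of_int c * r - of_int b * q) / 3) q r"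
  unfolding trace_free_part_def trace
  by (simp add: vec_def of_rat_add of_rat_diff of_rat_divide of_rat_mult add_divide_distrib diff_divide_distrib)

lemma trace_free_parts:
  "trace_free_part K (- of_int a * \<theta>) = vec (- of_int b / 3) 1 0"
  "trace_free_part K (of_int d / \<theta>) = vec (of_int c / 3) 0 1"
proof -
  have "- of_int a * \<theta> = vec 0 1 0" "of_int d / \<theta> = vec 0 0 1"
    by (simp_all add: vec_def \<alpha>_def \<beta>_def)
  then show "trace_free_part K (- of_int a * \<theta>) = vec (- of_int b / 3) 1 0"
    "trace_free_part K (of_int d / \<theta>) = vec (of_int c / 3) 0 1"
    by (simp_all only: trace_free_vec) simp_all
qed

lemma trace_zero_integers_eq:
  "trace_zero_integers K = {vec (of_int n) (of_int m) (of_int k) | n m k. 3 * n + b * m - c * k = 0}"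
proof -
  have tr: "field_trace K (vec (of_int n) (of_int m) (of_int k)) = 0 \<longleftrightarrow> 3 * n + b * m - c * k = 0"
    for n m k
  proof -
    have "field_trace K (vec (of_int n) (of_int m) (of_int k)) = of_int (3 * n + b * m - c * k)"
      by (simp add: trace)
    then show ?thesis by (simp only: of_int_eq_0_iff)
  qed
  show ?thesis
  proof (rule subset_antisym; rule subsetI)
    fix x assume "x \<in> trace_zero_integers K"
    then have x: "x \<in> ring_of_integers K" "field_trace K x = 0" by (auto simp: trace_zero_integers_def)
    obtain n m k where "x = vec (of_int n) (of_int m) (of_int k)"
      using int_repr[OF x(1)] int_vec by metis
    then show "x \<in> {vec (of_int n) (of_int m) (of_int k) | n m k. 3 * n + b * m - c * k = 0}"
      using x(2) tr by blast
  next
    fix x assume "x \<in> {vec (of_int n) (of_int m) (of_int k) | n m k. 3 * n + b * m - c * k = 0}"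
    then obtain n m k where "x = vec (of_int n) (of_int m) (of_int k)" "3 * n + b * m - c * k = 0" by blast
    then show "x \<in> trace_zero_integers K"
      using tr int_mem[of n m k] unfolding trace_zero_integers_def int_vec by blast
  qed
qed

lemma trace_zero_basisI:
  assumes sub: "\<And>m n. \<exists>i j k. of_int m * u + of_int n * v = vec (of_int i) (of_int j) (of_int k)
      \<and> 3 * i + b * j - c * k = 0"
    and sup: "\<And>i j k. 3 * i + b * j - c * k = 0 \<Longrightarrow>
      \<exists>m n. vec (of_int i) (of_int j) (of_int k) = of_int m * u + of_int n * v"
    and ind: "\<And>m n. of_int m * u + of_int n * v = 0 \<Longrightarrow> m = 0 \<and> n = 0"
  shows "int_basis [u, v] (trace_zero_integers K)"
proof (rule int_basis_pairI[OF _ ind])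
  show "trace_zero_integers K = {of_int m * u + of_int n * v | m n :: int. True}"
    unfolding trace_zero_integers_eq
  proof (rule subset_antisym; rule subsetI)
    fix x assume "x \<in> {vec (of_int n) (of_int m) (of_int k) | n m k. 3 * n + b * m - c * k = 0}"
    then show "x \<in> {of_int m * u + of_int n * v | m n :: int. True}" using sup by auto
  next
    fix x assume "x \<in> {of_int m * u + of_int n * v | m n :: int. True}"
    then obtain m n :: int where "x = of_int m * u + of_int n * v" by blast
    then show "x \<in> {vec (of_int n) (of_int m) (of_int k) | n m k. 3 * n + b * m - c * k = 0}"
      using sub[of m n] by auto
  qed
qed

text \<open>The coordinates of \<open>x^2\<close>, for an \<open>x\<close> outside 3 times the ring
  of integers with \<open>x^2\<close> inside it, are exactly the three expressions in
  \<open>three_dvd_cubic_disc\<close>.\<close>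

lemma three_dvd_disc:
  assumes "ramifies 3 K"
  shows "3 dvd cubic_disc (a, b, c, d)"
proof -
  obtain x y where x: "x \<in> ring_of_integers K" "\<And>z. z \<in> ring_of_integers K \<Longrightarrow> x \<noteq> of_nat 3 * z"
    and y: "y \<in> ring_of_integers K" "x^2 = of_nat 3 * y"
    using ramifies_square_dvd[OF assms] by auto
  obtain n m k where xe: "x = of_int n + of_int m * \<alpha> + of_int k * \<beta>" using int_repr[OF x(1)] .
  obtain n' m' k' where ye: "y = of_int n' + of_int m' * \<alpha> + of_int k' * \<beta>" using int_repr[OF y(1)] .
  have "x^2 = vec (of_int (n^2 - m^2 * (a * c) - 2 * m * k * (a * d) - k^2 * (b * d)))
     (of_int (2 * n * m + m^2 * b + k^2 * d)) (of_int (2 * n * k - m^2 * a - k^2 * c))"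
    unfolding xe int_vec power2_eq_square vec_mult by (simp add: algebra_simps)
  moreover have "of_nat 3 * y = vec (of_int (3 * n')) (of_int (3 * m')) (of_int (3 * k'))"
    unfolding ye int_vec using vec_scale[of 3] by simp
  ultimately have eq: "n^2 - m^2 * (a * c) - 2 * m * k * (a * d) - k^2 * (b * d) = 3 * n'"
    "2 * n * m + m^2 * b + k^2 * d = 3 * m'" "2 * n * k - m^2 * a - k^2 * c = 3 * k'"
    using int_unique y(2) unfolding int_vec[symmetric] by metis+
  show ?thesis
  proof (rule three_dvd_cubic_disc[of n m a c k b d])
    show "3 dvd n^2 - m^2 * a * c - k^2 * b * d - 2 * m * k * a * d"
      by (rule dvdI[of _ _ n']) (use eq(1) in \<open>simp add: algebra_simps\<close>)
    show "3 dvd 2 * n * m + m^2 * b + k^2 * d" "3 dvd 2 * n * k - m^2 * a - k^2 * c"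
      unfolding eq by simp_all
    show "\<not> (3 dvd n \<and> 3 dvd m \<and> 3 dvd k)"
    proof
      assume "3 dvd n \<and> 3 dvd m \<and> 3 dvd k"
      then obtain n1 m1 k1 where "n = 3 * n1" "m = 3 * m1" "k = 3 * k1" by (auto elim!: dvdE)
      then have "x = of_nat 3 * (of_int n1 + of_int m1 * \<alpha> + of_int k1 * \<beta>)"
        unfolding xe by (simp add: algebra_simps)
      then show False using x(2) int_mem by blast
    qed
  qed
qed

text \<open>The three cases of \<open>trace_zero_basis\<close> in which \<open>\<beta>\<^sub>0\<close> is multiplied by \<open>3\<close> are the
  case \<open>b \<equiv> 0\<close> after the substitution \<open>(x, y) \<mapsto> (x, y + t x)\<close> with \<open>t = 0, -1, 1\<close>. The
  coefficients of the substituted form are \<open>3 a', 3 b', c + 3 d t, d\<close>.\<close>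

lemma shifted_comb:
  assumes b: "b + 2 * c * t + 3 * d * t^2 = 3 * b'"
    and u: "u = vec (- of_int b / 3) 1 0 + of_int t * vec (of_int c / 3) 0 1"
    and v: "v = 3 * vec (of_int c / 3) 0 1"
  shows "of_int m * u + of_int n * v
    = vec (of_int (m * (c * t + d * t^2 - b') + n * c)) (of_int m) (of_int (m * t + 3 * n))"
proof -
  define e where "e = c * t + d * t^2 - b'"
  have "3 * e = c * t - b" using b by (simp add: e_def algebra_simps)
  then have e: "(of_int c * of_int t - of_int b) / 3 = (of_int e :: rat)"
    by (metis nonzero_mult_div_cancel_left of_int_diff of_int_mult of_int_numeral zero_neq_numeral)
  have u': "u = vec (of_int e) 1 (of_int t)"
    unfolding u e[symmetric] using vec_scale[of "of_int t"]
    by (simp add: vec_add diff_divide_distrib mult.commute)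
  have v': "v = vec (of_int c) 0 3" unfolding v using vec_scale[of 3] by simp
  show ?thesis
    unfolding u' v' e_def[symmetric] using vec_scale[of "of_int m"] vec_scale[of "of_int n"]
    by (simp add: vec_add mult.commute)
qed

text \<open>With \<open>3 * e = c * t - b\<close>, trace zero for coordinates
  \<open>(i, j, k)\<close> reads \<open>c * (k - t * j) = 3 * (i - e * j)\<close>. As 3 does not
  divide \<open>c\<close>, this forces \<open>k = t * j + 3 * n\<close>, and \<open>j\<close>,
  \<open>n\<close> are the coordinates with respect to \<open>u\<close>, \<open>v\<close>.\<close>

lemma shifted_basis:
  assumes c: "\<not> 3 dvd c" and b: "b + 2 * c * t + 3 * d * t^2 = 3 * b'"
    and u: "u = vec (- of_int b / 3) 1 0 + of_int t * vec (of_int c / 3) 0 1"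
    and v: "v = 3 * vec (of_int c / 3) 0 1"
  shows "int_basis [u, v] (trace_zero_integers K)"
proof -
  define e where "e = c * t + d * t^2 - b'"
  have e: "3 * e = c * t - b" using b by (simp add: e_def algebra_simps)
  note comb = shifted_comb[OF b u v, folded e_def]
  show ?thesis
  proof (rule trace_zero_basisI)
    show "\<exists>i j k. of_int m * u + of_int n * v = vec (of_int i) (of_int j) (of_int k)
      \<and> 3 * i + b * j - c * k = 0" for m n
    proof (intro exI conjI)
      show "of_int m * u + of_int n * v = vec (of_int (m * e + n * c)) (of_int m) (of_int (m * t + 3 * n))"
        by (rule comb)
      have "3 * (m * e + n * c) + b * m - c * (m * t + 3 * n) = m * (3 * e) + b * m - c * m * t"
        by (simp add: algebra_simps)
      then show "3 * (m * e + n * c) + b * m - c * (m * t + 3 * n) = 0"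
        unfolding e by (simp add: algebra_simps)
    qed
    fix i j k assume z: "3 * i + b * j - c * k = 0"
    have "c * (k - t * j) = 3 * (i - e * j)"
    proof -
      have "c * (k - t * j) = 3 * i + b * j - (c * t) * j" using z by (simp add: algebra_simps)
      also have "c * t = 3 * e + b" using e by simp
      finally show ?thesis by (simp add: algebra_simps)
    qed
    then have "3 dvd c * (k - t * j)" by simp
    then have "3 dvd k - t * j" using c by (simp add: prime_dvd_mult_iff)
    then obtain n where n: "k - t * j = 3 * n" ..
    then have k: "k = j * t + 3 * n" by (simp add: algebra_simps)
    have "i = j * e + n * c" using \<open>c * (k - t * j) = 3 * (i - e * j)\<close> unfolding n
      by (simp add: algebra_simps)
    then show "\<exists>m n. vec (of_int i) (of_int j) (of_int k) = of_int m * u + of_int n * v"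
      unfolding comb k by blast
  next
    fix m n assume "of_int m * u + of_int n * v = 0"
    from vec_zero[OF this[unfolded comb]] show "m = 0 \<and> n = 0" by simp
  qed
qed

lemma shifted_trace_form:
  assumes a: "a + b * t + c * t^2 + d * t^3 = 3 * a'" and b: "b + 2 * c * t + 3 * d * t^2 = 3 * b'"
    and u: "u = vec (- of_int b / 3) 1 0 + of_int t * vec (of_int c / 3) 0 1"
    and v: "v = 3 * vec (of_int c / 3) 0 1"
  shows "of_int (quad_eval (phi1_form (a', 3 * b', 3 * (c + 3 * d * t), 9 * d)) x y)
    = 1 / 6 * field_trace K ((of_int x * u + of_int y * v)^2)"
proof -
  define e where "e = c * t + d * t^2 - b'"
  define p where "p = x * e + y * c"
  define r where "r = x * t + 3 * y"
  have comb: "of_int x * u + of_int y * v = vec (of_int p) (of_int x) (of_int r)"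
    unfolding p_def e_def r_def by (rule shifted_comb[OF b u v])
  \<comment> \<open>Eliminating \<open>a\<close> and \<open>b\<close> in favour of \<open>a'\<close>
    and \<open>b'\<close> removes the divisibility conditions; the factor 6 then appears in an
    identity of polynomials.\<close>
  have a: "a = 3 * a' - b * t - c * t^2 - d * t^3" using a by simp
  have b: "b = 3 * b' - 2 * c * t - 3 * d * t^2" using b by simp
  have "field_trace K ((of_int x * u + of_int y * v)^2)
     = of_int (3 * (p^2 - x^2 * (a * c) - 2 * x * r * (a * d) - r^2 * (b * d))
    + b * (2 * p * x + x^2 * b + r^2 * d) - c * (2 * p * r - x^2 * a - r^2 * c))"
    unfolding comb trace_square by simp
  also have "3 * (p^2 - x^2 * (a * c) - 2 * x * r * (a * d) - r^2 * (b * d))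
    + b * (2 * p * x + x^2 * b + r^2 * d) - c * (2 * p * r - x^2 * a - r^2 * c)
    = 6 * quad_eval (phi1_form (a', 3 * b', 3 * (c + 3 * d * t), 9 * d)) x y"
    unfolding p_def e_def r_def a b
    by (simp add: Let_def algebra_simps power2_eq_square power3_eq_cube)
  finally show ?thesis by simp
qed

text \<open>The mirror image of the shift \<open>t = 0\<close>: exchanging x and y exchanges the
  roles of \<alpha>0 and \<beta>0 and of \<open>b\<close> and \<open>c\<close>. Trace zero now
  forces the middle coordinate to be divisible by 3.\<close>

lemma swapped_basis:
  assumes b: "\<not> 3 dvd b" and c: "c = 3 * c'"
    and u: "u = 3 * vec (- of_int b / 3) 1 0" and v: "v = vec (of_int c / 3) 0 1"
  shows "int_basis [u, v] (trace_zero_integers K)"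
    and "of_int m * u + of_int n * v = vec (of_int (n * c' - m * b)) (of_int (3 * m)) (of_int n)"
proof -
  have uv: "u = vec (- of_int b) 3 0" "v = vec (of_int c') 0 1"
    unfolding u v c using vec_scale[of 3] by simp_all
  have comb: "of_int m * u + of_int n * v = vec (of_int (n * c' - m * b)) (of_int (3 * m)) (of_int n)"
    for m n
    unfolding uv using vec_scale[of "of_int m"] vec_scale[of "of_int n"]
    by (simp add: vec_add mult.commute)
  then show "of_int m * u + of_int n * v = vec (of_int (n * c' - m * b)) (of_int (3 * m)) (of_int n)" .
  show "int_basis [u, v] (trace_zero_integers K)"
  proof (rule trace_zero_basisI)
    show "\<exists>i j k. of_int m * u + of_int n * v = vec (of_int i) (of_int j) (of_int k)
      \<and> 3 * i + b * j - c * k = 0" for m n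
    proof (intro exI conjI)
      show "of_int m * u + of_int n * v = vec (of_int (n * c' - m * b)) (of_int (3 * m)) (of_int n)"
        by (rule comb)
      show "3 * (n * c' - m * b) + b * (3 * m) - c * n = 0" by (simp add: c algebra_simps)
    qed
    fix i j k assume z: "3 * i + b * j - c * k = 0"
    then have "b * j = 3 * (c' * k - i)" by (simp add: c algebra_simps)
    then have "3 dvd b * j" by simp
    then have "3 dvd j" using b by (simp add: prime_dvd_mult_iff)
    then obtain m where j: "j = 3 * m" ..
    have "i = k * c' - m * b" using z by (simp add: c j algebra_simps)
    then show "\<exists>m n. vec (of_int i) (of_int j) (of_int k) = of_int m * u + of_int n * v"
      unfolding comb j by blast
  next
    fix m n assume "of_int m * u + of_int n * v = 0"
    from vec_zero[OF this[unfolded comb]] show "m = 0 \<and> n = 0" by simp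
  qed
qed

lemma swapped_trace_form:
  assumes b: "\<not> 3 dvd b" and c: "c = 3 * c'" and d: "d = 3 * d'"
    and u: "u = 3 * vec (- of_int b / 3) 1 0" and v: "v = vec (of_int c / 3) 0 1"
  shows "of_int (quad_eval (phi1_form (9 * a, 3 * b, 3 * c', d')) x y)
    = 1 / 6 * field_trace K ((of_int x * u + of_int y * v)^2)"
proof -
  define p where "p = y * c' - x * b"
  define q where "q = 3 * x"
  have comb: "of_int x * u + of_int y * v = vec (of_int p) (of_int q) (of_int y)"
    unfolding p_def q_def by (rule swapped_basis(2)[OF b c u v])
  have "field_trace K ((of_int x * u + of_int y * v)^2)
     = of_int (3 * (p^2 - q^2 * (a * c) - 2 * q * y * (a * d) - y^2 * (b * d))
    + b * (2 * p * q + q^2 * b + y^2 * d) - c * (2 * p * y - q^2 * a - y^2 * c))"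
    unfolding comb trace_square by simp
  also have "3 * (p^2 - q^2 * (a * c) - 2 * q * y * (a * d) - y^2 * (b * d))
    + b * (2 * p * q + q^2 * b + y^2 * d) - c * (2 * p * y - q^2 * a - y^2 * c)
    = 6 * quad_eval (phi1_form (9 * a, 3 * b, 3 * c', d')) x y"
    unfolding p_def q_def c d
    by (simp add: Let_def algebra_simps power2_eq_square)
  finally show ?thesis by simp
qed

end

text \<open>The common conclusion of all cases. The factor 9 is 3^6 from the substitution of
  determinant 3 or -3, times 3^(-4) from dividing the form by 3; against the 27 relating cube and
  cubic discriminants it leaves \<open>\<Delta> = - D / 3\<close>.\<close>

lemma gaussian_form_classes:
  assumes f: "f = (a0, 3 * a1, 3 * a2, a3)" and D: "cubic_disc f = 9 * D" "3 dvd D" "minimal_disc D"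
    and \<Delta>: "\<Delta> = - (D div 3)"
  shows "cubic_class f \<in> Cl_Sym3 \<Delta>"
    and "quad_class (phi1_form f) \<in> three_torsion (narrow_class_group (rat_adjoin (csqrt (of_int \<Delta>))))"
    and "phi1 (cubic_class f) = quad_class (phi1_form f)"
proof -
  have g: "gaussian_cubic_form f" using f unfolding gaussian_cubic_form_def by blast
  have D3: "D = - 3 * \<Delta>" using D(2) \<Delta> by auto
  have cube: "cube_disc (symmetric_cube f) = \<Delta>"
    using cube_disc_gaussian[OF g] D(1) D3 by linarith
  then show "cubic_class f \<in> Cl_Sym3 \<Delta>" using g unfolding Cl_Sym3_def by blast
  have min: "minimal_disc \<Delta>" using minimal_disc_div_neg_3 D(3) D3 by metis
  have disc: "quad_disc (phi1_form f) = \<Delta>"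
    using cube cube_disc_eq_quad_disc[of a0 a1 a2 a3] unfolding f by simp
  show "quad_class (phi1_form f) \<in> three_torsion (narrow_class_group (rat_adjoin (csqrt (of_int \<Delta>))))"
    using hessian_class_three_torsion[OF _ g] min
    unfolding narrow_class_group_def field_disc_rat_adjoin_csqrt[OF min] disc by blast
  show "phi1 (cubic_class f) = quad_class (phi1_form f)" by (rule phi1_cubic_class[OF g])
qed

section \<open>The shifted and the swapped case\<close>

context cubic_ring
begin

lemma shifted_case:
  assumes min: "minimal_disc (field_disc K)" and ram: "3 dvd field_disc K"
    and t: "3 dvd b + 2 * c * t + 3 * d * t^2"
    and u: "u = vec (- of_int b / 3) 1 0 + of_int t * vec (of_int c / 3) 0 1"
    and v: "v = 3 * vec (of_int c / 3) 0 1"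
    and \<Delta>: "\<Delta> = - (field_disc K div 3)"
  shows "int_basis [u, v] (trace_zero_integers K) \<and>
    (\<exists>f Q. (\<forall>x y. of_int (cubic_eval f x y) = (1 / 3 * of_int (cubic_eval (a, b, c, d) x (3 * y + t * x)) :: rat)) \<and>
      (\<forall>x y. of_int (quad_eval Q x y) = 1 / 6 * field_trace K ((of_int x * u + of_int y * v)^2)) \<and>
      cubic_class f \<in> Cl_Sym3 \<Delta> \<and>
      quad_class Q \<in> three_torsion (narrow_class_group (rat_adjoin (csqrt (of_int \<Delta>)))) \<and>
      phi1 (cubic_class f) = quad_class Q)"
proof -
  obtain b' where b': "b + 2 * c * t + 3 * d * t^2 = 3 * b'" using t ..
  define A where "A = a + b * t + c * t^2 + d * t^3"
  define C where "C = c + 3 * d * t"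
  have disc': "field_disc K = cubic_disc (A, 3 * b', C, d)"
  proof -
    have "cubic_disc (A, b + 2 * c * t + 3 * d * t^2, C, d) = cubic_disc (a, b, c, d)"
      unfolding A_def C_def by (simp add: algebra_simps power2_eq_square power3_eq_cube)
    then show ?thesis unfolding b' disc by simp
  qed
  \<comment> \<open>Otherwise both middle coefficients of the shifted form are divisible by 3, and
    every term of its discriminant is divisible by 9.\<close>
  have c3: "\<not> 3 dvd c"
  proof
    assume "3 dvd c"
    then obtain z where "c = 3 * z" ..
    then have "C = 3 * (z + d * t)" by (simp add: C_def)
    then have "9 dvd field_disc K" unfolding disc'
      by (intro dvdI[of _ _ "9 * b'^2 * (z + d * t)^2 - 12 * A * (z + d * t)^3 - 12 * b'^3 * d
          - 3 * A^2 * d^2 + 18 * A * b' * (z + d * t) * d"])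
        (simp add: algebra_simps power2_eq_square power3_eq_cube)
    then show False using minimal_disc_not_9_dvd[OF min] by blast
  qed
  then have C3: "\<not> 3 dvd C" by (simp add: C_def dvd_add_left_iff mult.assoc)
  \<comment> \<open>Since the second coefficient is \<open>3 * b'\<close>, the discriminant is
    congruent to \<open>- A * C^3\<close> modulo 3, and \<open>C\<close> is prime to 3. In the
    swapped case the same argument applies to \<open>b^3 * d\<close>.\<close>
  have "3 dvd A"
  proof -
    have "A * C^3 = 3 * (3 * b'^2 * C^2 - A * C^3 - 36 * b'^3 * d - 9 * A^2 * d^2 + 18 * A * b' * C * d)
        - field_disc K"
      unfolding disc' by (simp add: algebra_simps power2_eq_square power3_eq_cube)
    then have "3 dvd A * C^3" using ram by (metis dvd_diff dvd_triv_left)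
    moreover have "prime (3::int)" by simp
    ultimately show ?thesis using C3 by (metis prime_dvd_mult_iff prime_dvd_power)
  qed
  then obtain a' where a': "a + b * t + c * t^2 + d * t^3 = 3 * a'" unfolding A_def ..
  define f where "f = (a', 3 * b', 3 * C, 9 * d)"
  have f_disc: "cubic_disc f = 9 * field_disc K"
    unfolding disc' f_def A_def a' by (simp add: algebra_simps power2_eq_square power3_eq_cube)
  have eval: "of_int (cubic_eval f x y) = (1 / 3 * of_int (cubic_eval (a, b, c, d) x (3 * y + t * x)) :: rat)" for x y
  proof -
    have a: "a = 3 * a' - b * t - c * t^2 - d * t^3" using a' by simp
    have b: "b = 3 * b' - 2 * c * t - 3 * d * t^2" using b' by simp
    have "cubic_eval (a, b, c, d) x (3 * y + t * x) = 3 * cubic_eval f x y"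
      unfolding f_def C_def a b by (simp add: algebra_simps power2_eq_square power3_eq_cube)
    then show ?thesis by simp
  qed
  note cl = gaussian_form_classes[OF f_def f_disc ram min \<Delta>]
  have "of_int (quad_eval (phi1_form f) x y) = 1 / 6 * field_trace K ((of_int x * u + of_int y * v)^2)" for x y
    unfolding f_def C_def by (rule shifted_trace_form[OF a' b' u v])
  then show ?thesis using shifted_basis[OF c3 b' u v] eval cl by blast
qed

lemma swapped_case:
  assumes min: "minimal_disc (field_disc K)" and ram: "3 dvd field_disc K"
    and b3: "\<not> 3 dvd b" and c3: "3 dvd c"
    and u: "u = 3 * vec (- of_int b / 3) 1 0" and v: "v = vec (of_int c / 3) 0 1"
    and \<Delta>: "\<Delta> = - (field_disc K div 3)"
  shows "int_basis [u, v] (trace_zero_integers K) \<and>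
    (\<exists>f Q. (\<forall>x y. of_int (cubic_eval f x y) = (1 / 3 * of_int (cubic_eval (a, b, c, d) (3 * x) y) :: rat)) \<and>
      (\<forall>x y. of_int (quad_eval Q x y) = 1 / 6 * field_trace K ((of_int x * u + of_int y * v)^2)) \<and>
      cubic_class f \<in> Cl_Sym3 \<Delta> \<and>
      quad_class Q \<in> three_torsion (narrow_class_group (rat_adjoin (csqrt (of_int \<Delta>)))) \<and>
      phi1 (cubic_class f) = quad_class Q)"
proof -
  obtain c' where c': "c = 3 * c'" using c3 ..
  have "3 dvd d"
  proof -
    have "b^3 * d = 3 * (3 * b^2 * c'^2 - 36 * a * c'^3 - b^3 * d - 9 * a^2 * d^2 + 18 * a * b * c' * d)
        - field_disc K"
      unfolding disc[symmetric] c' by (simp add: algebra_simps power2_eq_square power3_eq_cube)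
    then have "3 dvd b^3 * d" using ram by (metis dvd_diff dvd_triv_left)
    moreover have "prime (3::int)" by simp
    ultimately show ?thesis using b3 by (metis prime_dvd_mult_iff prime_dvd_power)
  qed
  then obtain d' where d': "d = 3 * d'" ..
  define f where "f = (9 * a, 3 * b, 3 * c', d')"
  have f_disc: "cubic_disc f = 9 * field_disc K"
    unfolding disc[symmetric] f_def c' d' by (simp add: algebra_simps power2_eq_square power3_eq_cube)
  have eval: "of_int (cubic_eval f x y) = (1 / 3 * of_int (cubic_eval (a, b, c, d) (3 * x) y) :: rat)" for x y
  proof -
    have "cubic_eval (a, b, c, d) (3 * x) y = 3 * cubic_eval f x y"
      unfolding f_def c' d' by (simp add: algebra_simps power2_eq_square power3_eq_cube)
    then show ?thesis by simp
  qed
  note cl = gaussian_form_classes[OF f_def f_disc ram min \<Delta>]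
  have "of_int (quad_eval (phi1_form f) x y) = 1 / 6 * field_trace K ((of_int x * u + of_int y * v)^2)" for x y
    unfolding f_def by (rule swapped_trace_form[OF b3 c' d' u v])
  then show ?thesis using swapped_basis(1)[OF b3 c' u v] eval cl by blast
qed

end

theorem theorem6p4:
  fixes K :: "'a::field_char_0 set" and F :: cubic_form and \<theta> u v :: 'a and \<Delta> :: int
  assumes "number_field 3 K"
    and "fundamental_discriminant (field_disc K)"
    and "ramifies 3 K"
    and "associated_form K F \<theta>"
  defines "\<Delta> \<equiv> - (field_disc K div 3)"
    and "u \<equiv> fst (trace_zero_basis K F \<theta>)"
    and "v \<equiv> snd (trace_zero_basis K F \<theta>)"
  shows "3 dvd field_disc K \<and>
    int_basis [u, v] (trace_zero_integers K) \<and>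
    (\<exists>f Q.
      (\<forall>x y. of_int (cubic_eval f x y) = f_K F x y) \<and>
      (\<forall>x y. of_int (quad_eval Q x y) =
         1/6 * field_trace K ((of_int x * u + of_int y * v)^2)) \<and>
      cubic_class f \<in> Cl_Sym3 \<Delta> \<and>
      quad_class Q \<in> three_torsion (narrow_class_group (rat_adjoin (csqrt (of_int \<Delta>)))) \<and>
      phi1 (cubic_class f) = quad_class Q)"
proof -
  obtain a b c d where F: "F = (a, b, c, d)" by (cases F)
  interpret cubic_ring K \<theta> a b c d
    using assms(1,4) unfolding F by unfold_locales
  have min: "minimal_disc (field_disc K)" using minimal_disc_of_fundamental assms(2) .
  have ram: "3 dvd field_disc K" using three_dvd_disc[OF assms(3)] disc by simp
  have \<Delta>: "\<Delta> = - (field_disc K div 3)" by (simp add: \<Delta>_def)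
  have cong: "[x = y] (mod 3) \<longleftrightarrow> 3 dvd x - y" for x y :: int by (rule cong_iff_dvd_diff)
  define \<alpha>\<^sub>0 where "\<alpha>\<^sub>0 = vec (- of_int b / 3) 1 0"
  define \<beta>\<^sub>0 where "\<beta>\<^sub>0 = vec (of_int c / 3) 0 1"
  have uv: "(u, v) = (if 3 dvd b then (\<alpha>\<^sub>0, 3 * \<beta>\<^sub>0) else if 3 dvd c then (3 * \<alpha>\<^sub>0, \<beta>\<^sub>0)
      else if 3 dvd b + c then (\<alpha>\<^sub>0 - \<beta>\<^sub>0, 3 * \<beta>\<^sub>0) else (\<alpha>\<^sub>0 + \<beta>\<^sub>0, 3 * \<beta>\<^sub>0))"
    unfolding u_def v_def F trace_zero_basis.simps trace_free_parts \<alpha>\<^sub>0_def \<beta>\<^sub>0_def Let_def cong by simp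
  note shifted = shifted_case[OF min ram _ _ _ \<Delta>, folded \<alpha>\<^sub>0_def \<beta>\<^sub>0_def]
  note swapped = swapped_case[OF min ram _ _ _ _ \<Delta>, folded \<alpha>\<^sub>0_def \<beta>\<^sub>0_def]
  consider "3 dvd b" | "\<not> 3 dvd b" "3 dvd c" | "\<not> 3 dvd b" "\<not> 3 dvd c" "3 dvd b + c"
    | "\<not> 3 dvd b" "\<not> 3 dvd c" "\<not> 3 dvd b + c" by blast
  then show ?thesis
  proof cases
    case 1
    have f: "f_K F x y = 1 / 3 * of_int (cubic_eval (a, b, c, d) x (3 * y + 0 * x))" for x y
      using 1 by (simp add: F Let_def cong)
    show ?thesis unfolding f
      by (intro conjI[OF ram] shifted) (use 1 uv in simp_all)
  next
    case 2
    have f: "f_K F x y = 1 / 3 * of_int (cubic_eval (a, b, c, d) (3 * x) y)" for x y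
      using 2 by (simp add: F Let_def cong)
    show ?thesis unfolding f
      by (intro conjI[OF ram] swapped) (use 2 uv in simp_all)
  next
    case 3
    have f: "f_K F x y = 1 / 3 * of_int (cubic_eval (a, b, c, d) x (3 * y + (- 1) * x))" for x y
      using 3 by (simp add: F Let_def cong)
    \<comment> \<open>Modulo 3 the left side is \<open>b + c\<close>, so the shift
      \<open>t = -1\<close> is the right one here.\<close>
    have "3 dvd b + 2 * c * (- 1) + 3 * d * (- 1)^2" using 3(3) by simp presburger
    then show ?thesis unfolding f
      by (intro conjI[OF ram] shifted) (use 3 uv in simp_all)
  next
    case 4
    have f: "f_K F x y = 1 / 3 * of_int (cubic_eval (a, b, c, d) x (3 * y + 1 * x))" for x y
      using 4 by (simp add: F Let_def cong)
    \<comment> \<open>None of \<open>b\<close>, \<open>c\<close>, \<open>b + c\<close> is divisible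
      by 3, hence \<open>b\<close> and \<open>c\<close> have the same residue, and
      \<open>b + 2 * c\<close> vanishes modulo 3.\<close>
    have "3 dvd b + 2 * c * 1 + 3 * d * 1^2" using 4 by simp presburger
    then show ?thesis unfolding f
      by (intro conjI[OF ram] shifted) (use 4 uv in simp_all)
  qed
qed

end
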